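(* Let $A$ be an irreducible affine Cartan matrix which is not of type $B_n^{(1)}, C_n^{(1)}, F_4^{(1)}, G_2^{(1)}$, and let $S(A)$ be its Dynkin diagram. The double affine Weyl group $\tilde W$ is given by generators and relations as follows. Generators: one generator $s_i$ for each node $i\ne0$, and three generators $s_{01},s_{02},s_{03}$ for the affine node $0$. Relations: a) the braid relation for each pair of generators associated to any pair of distinct nodes (there are three generators associated to the affine node); b) if the affine node is connected with a node $\alpha$ by two laces, $s_{01}s_\alpha s_{03}s_\alpha=s_\alpha s_{03}s_\alpha s_{01}$; c) all generators have order two; d) the element $\tau_{a_0^{-1}\delta}:=s_{01}s_{02}s_{03}s_\theta$ is central. The elliptic Weyl group has the same description, except that relation d) is replaced by $\tau_{a_0^{-1}\delta}=1$.
   Context: $A=(a_{jk})_{0\le j,k\le n}$ is an irreducible affine Cartan matrix, labelled as in Kac's book, node $0$ being the affine node; types $B_n^{(1)}, C_n^{(1)}, F_4^{(1)}, G_2^{(1)}$ are excluded. In the Dynkin diagram distinct nodes $i,j$ are connected by $a_{ij}a_{ji}$ laces. The braid relation between elements $x,y$ attached to distinct nodes $i,j$ is $xyx\cdots=yxy\cdots$ with $m_{ij}$ factors on each side, $m_{ij}=2,3,4,6$ for $0,1,2,3$ laces (no relation for $4$ laces, which happens only when $n=1$). $(a_0,\dots,a_n)$, $(a_0^\vee,\dots,a_n^\vee)$ are Kac's numerical labels of $S(A)$ and $S(A^t)$ ($a_0=1$ except $a_0=2$ for $A_{2n}^{(2)}$). Let $\alpha_0,\dots,\alpha_n$ be the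 simple roots, $\delta=\sum_j a_j\alpha_j$, $\theta=\delta-a_0\alpha_0$, $d_j=a_j/a_j^\vee$; on the real span of the $\alpha_j$ take the form $(\alpha_j,\alpha_k)=d_j^{-1}a_{jk}$, and put $\alpha_j^\vee=d_j\alpha_j$, $s_j(x)=x-(x,\alpha_j^\vee)\alpha_j$. The affine Weyl group $W$ is generated by $s_0,\dots,s_n$ and the finite Weyl group $\mathring W$ by $s_1,\dots,s_n$; $s_\theta\in\mathring W$ is the reflection in $\theta$ (in the presentation, $s_\theta$ is the corresponding word in the $s_i$, $i\neq0$). The lattice $\mathring Q$ is $\bigoplus_{j=1}^n\mathbb Z\alpha_j$, except for $A_{2n}^{(2)}$ where it is $\bigoplus_{j=1}^{n-1}\mathbb Z\alpha_j\oplus\mathbb Z\tfrac12\alpha_n$ (the weight lattice of the finite root system); $Q=\mathring Q\oplus\mathbb Z a_0^{-1}\delta$. The double affine Weyl group is $\tilde W=W\ltimes Q$, where $Q$ is written multiplicatively with elements $\tau_\beta$, $\beta\in Q$, and $w\tau_\beta w^{-1}=\tau_{w(\beta)}$. The elliptic Weyl group is the quotient of $\tilde W$ by the (central) subgroup generated by $\tau_{a_0^{-1}\delta}$. In the presentation, the $s_i$ ($i\ne0$) and $\tau_{a_0^{-1}\delta}$ stand for the elements of $\tilde W$ of the same name. *)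

theory Defs
  imports Complex_Main "HOL-Algebra.Generated_Groups" "HOL-Algebra.Bij"
begin

section \<open>Affine Cartan matrices\<close>

text \<open>
  Matrices are functions on pairs of natural numbers of which only the entries with both
  indices in \<open>{..n}\<close> matter.
\<close>

type_synonym cmatrix = "nat \<Rightarrow> nat \<Rightarrow> int"

definition gen_cartan_matrix :: "nat \<Rightarrow> cmatrix \<Rightarrow> bool" where
  "gen_cartan_matrix n A \<longleftrightarrow>
     (\<forall>i\<le>n. A i i = 2) \<and>
     (\<forall>i\<le>n. \<forall>j\<le>n. i \<noteq> j \<longrightarrow> A i j \<le> 0) \<and>
     (\<forall>i\<le>n. \<forall>j\<le>n. A i j = 0 \<longrightarrow> A j i = 0)"

definition irreducible_matrix :: "nat \<Rightarrow> cmatrix \<Rightarrow> bool" where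
  "irreducible_matrix n A \<longleftrightarrow>
     (\<forall>I. I \<subseteq> {..n} \<and> I \<noteq> {} \<and> I \<noteq> {..n} \<longrightarrow> (\<exists>i\<in>I. \<exists>j\<in>{..n} - I. A i j \<noteq> 0))"

definition matrix_apply :: "nat \<Rightarrow> cmatrix \<Rightarrow> (nat \<Rightarrow> real) \<Rightarrow> nat \<Rightarrow> real" where
  "matrix_apply n A v i = (\<Sum>j\<le>n. of_int (A i j) * v j)"

text \<open>
  Condition (Aff) of Kac's trichotomy: there is a positive null vector \<open>u\<close>, the corank is \<open>1\<close>
  (the null space is spanned by \<open>u\<close>), and \<open>A v \<ge> 0\<close> implies \<open>A v = 0\<close>.
\<close>

definition affine_matrix :: "nat \<Rightarrow> cmatrix \<Rightarrow> bool" where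
  "affine_matrix n A \<longleftrightarrow>
     (\<exists>u. (\<forall>j\<le>n. u j > 0) \<and> (\<forall>i\<le>n. matrix_apply n A u i = 0) \<and>
          (\<forall>v. (\<forall>i\<le>n. matrix_apply n A v i = 0) \<longrightarrow> (\<exists>c. \<forall>j\<le>n. v j = c * u j))) \<and>
     (\<forall>v. (\<forall>i\<le>n. matrix_apply n A v i \<ge> 0) \<longrightarrow> (\<forall>i\<le>n. matrix_apply n A v i = 0))"

definition irreducible_affine_cartan_matrix :: "nat \<Rightarrow> cmatrix \<Rightarrow> bool" where
  "irreducible_affine_cartan_matrix n A \<longleftrightarrow>
     gen_cartan_matrix n A \<and> irreducible_matrix n A \<and> affine_matrix n A"


section \<open>Kac's tables\<close>

text \<open>
  The affine types and their labellings, in the notation \<open>X\<^sub>N\<^sup>(\<^sup>r\<^sup>)\<close> of Kac's book. A natural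
  number argument is always the rank \<open>n\<close>, i.e. there are \<open>n + 1\<close> nodes \<open>0, \<dots>, n\<close>:
  \<open>Aeven2 n\<close> is \<open>A\<^sub>2\<^sub>n\<^sup>(\<^sup>2\<^sup>)\<close>, \<open>Aodd2 n\<close> is \<open>A\<^sub>2\<^sub>n\<^sub>-\<^sub>1\<^sup>(\<^sup>2\<^sup>)\<close>, \<open>D2 n\<close> is \<open>D\<^sub>n\<^sub>+\<^sub>1\<^sup>(\<^sup>2\<^sup>)\<close>, \<open>E6_2\<close> is
  \<open>E\<^sub>6\<^sup>(\<^sup>2\<^sup>)\<close> and \<open>D4_3\<close> is \<open>D\<^sub>4\<^sup>(\<^sup>3\<^sup>)\<close>; the remaining constructors are the untwisted types.
\<close>

datatype kac_type =
    A1 nat | B1 nat | C1 nat | D1 nat | E6_1 | E7_1 | E8_1 | F4_1 | G2_1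
  | Aeven2 nat | Aodd2 nat | D2 nat | E6_2 | D4_3

fun kac_rank :: "kac_type \<Rightarrow> nat" where
  "kac_rank (A1 n) = n"
| "kac_rank (B1 n) = n"
| "kac_rank (C1 n) = n"
| "kac_rank (D1 n) = n"
| "kac_rank E6_1 = 6"
| "kac_rank E7_1 = 7"
| "kac_rank E8_1 = 8"
| "kac_rank F4_1 = 4"
| "kac_rank G2_1 = 2"
| "kac_rank (Aeven2 n) = n"
| "kac_rank (Aodd2 n) = n"
| "kac_rank (D2 n) = n"
| "kac_rank E6_2 = 4"
| "kac_rank D4_3 = 2"

fun kac_admissible :: "kac_type \<Rightarrow> bool" where
  "kac_admissible (A1 n) \<longleftrightarrow> n \<ge> 1"
| "kac_admissible (B1 n) \<longleftrightarrow> n \<ge> 3"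
| "kac_admissible (C1 n) \<longleftrightarrow> n \<ge> 2"
| "kac_admissible (D1 n) \<longleftrightarrow> n \<ge> 4"
| "kac_admissible (Aeven2 n) \<longleftrightarrow> n \<ge> 1"
| "kac_admissible (Aodd2 n) \<longleftrightarrow> n \<ge> 3"
| "kac_admissible (D2 n) \<longleftrightarrow> n \<ge> 2"
| "kac_admissible _ \<longleftrightarrow> True"

text \<open>
  An entry \<open>(i, j, p, q)\<close> is an edge of the Dynkin diagram with \<open>a\<^sub>i\<^sub>j = - p\<close> and \<open>a\<^sub>j\<^sub>i = - q\<close>.
  Thus \<open>(i, j, 2, 1)\<close> is a double edge whose arrow points towards \<open>i\<close> (the shorter root).
\<close>

type_synonym edge = "nat \<times> nat \<times> int \<times> int"

definition chain :: "nat \<Rightarrow> nat \<Rightarrow> edge list" where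
  "chain k l = map (\<lambda>i. (i, Suc i, 1, 1)) [k..<l]"

fun kac_edges :: "kac_type \<Rightarrow> edge list" where
  "kac_edges (A1 n) = (if n = 1 then [(0, 1, 2, 2)] else (0, n, 1, 1) # chain 0 n)"
| "kac_edges (B1 n) = (0, 2, 1, 1) # chain 1 (n - 1) @ [(n - 1, n, 1, 2)]"
| "kac_edges (C1 n) = (0, 1, 1, 2) # chain 1 (n - 1) @ [(n - 1, n, 2, 1)]"
| "kac_edges (D1 n) = (0, 2, 1, 1) # chain 1 (n - 1) @ [(n - 2, n, 1, 1)]"
| "kac_edges E6_1 = chain 1 5 @ [(3, 6, 1, 1), (0, 6, 1, 1)]"
| "kac_edges E7_1 = chain 0 6 @ [(3, 7, 1, 1)]"
| "kac_edges E8_1 = chain 0 7 @ [(5, 8, 1, 1)]"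
| "kac_edges F4_1 = [(0, 1, 1, 1), (1, 2, 1, 1), (2, 3, 1, 2), (3, 4, 1, 1)]"
| "kac_edges G2_1 = [(0, 1, 1, 1), (1, 2, 1, 3)]"
| "kac_edges (Aeven2 n) =
     (if n = 1 then [(0, 1, 4, 1)] else (0, 1, 2, 1) # chain 1 (n - 1) @ [(n - 1, n, 2, 1)])"
| "kac_edges (Aodd2 n) = (0, 2, 1, 1) # chain 1 (n - 1) @ [(n - 1, n, 2, 1)]"
| "kac_edges (D2 n) = (0, 1, 2, 1) # chain 1 (n - 1) @ [(n - 1, n, 1, 2)]"
| "kac_edges E6_2 = [(0, 1, 1, 1), (1, 2, 1, 1), (2, 3, 2, 1), (3, 4, 1, 1)]"
| "kac_edges D4_3 = [(0, 1, 1, 1), (1, 2, 3, 1)]"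

definition kac_matrix :: "kac_type \<Rightarrow> cmatrix" where
  "kac_matrix X i j =
     (if i = j then 2
      else - (\<Sum>(k, l, p, q)\<leftarrow>kac_edges X.
                if k = i \<and> l = j then p else if k = j \<and> l = i then q else 0))"

definition labelled_as_in_kac :: "kac_type \<Rightarrow> nat \<Rightarrow> cmatrix \<Rightarrow> bool" where
  "labelled_as_in_kac X n A \<longleftrightarrow>
     kac_admissible X \<and> n = kac_rank X \<and> (\<forall>i\<le>n. \<forall>j\<le>n. A i j = kac_matrix X i j)"

definition excluded_type :: "kac_type \<Rightarrow> bool" where
  "excluded_type X \<longleftrightarrow> (\<exists>n. X = B1 n) \<or> (\<exists>n. X = C1 n) \<or> X = F4_1 \<or> X = G2_1"


section \<open>Roots, invariant form, reflections\<close>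

definition is_numerical_labels :: "nat \<Rightarrow> cmatrix \<Rightarrow> (nat \<Rightarrow> nat) \<Rightarrow> bool" where
  "is_numerical_labels n A a \<longleftrightarrow>
     (\<forall>j\<le>n. a j > 0) \<and> (\<forall>j>n. a j = 0) \<and> Gcd (a ` {..n}) = 1 \<and>
     (\<forall>i\<le>n. (\<Sum>j\<le>n. A i j * int (a j)) = 0)"

definition labels :: "nat \<Rightarrow> cmatrix \<Rightarrow> nat \<Rightarrow> nat" where
  "labels n A = (THE a. is_numerical_labels n A a)"

definition dual_labels :: "nat \<Rightarrow> cmatrix \<Rightarrow> nat \<Rightarrow> nat" where
  "dual_labels n A = labels n (\<lambda>i j. A j i)"

text \<open>
  A vector of the real span of \<open>\<alpha>\<^sub>0, \<dots>, \<alpha>\<^sub>n\<close> is the function of its coordinates. The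
  coordinates with index \<open>> n\<close> are inert: the form ignores them, and the reflections leave
  them unchanged, so that the reflections generate the same group as on the span itself.
\<close>

type_synonym vect = "nat \<Rightarrow> real"

definition simple_root :: "nat \<Rightarrow> vect" where
  "simple_root j = (\<lambda>k. if k = j then 1 else 0)"

definition dcoeff :: "nat \<Rightarrow> cmatrix \<Rightarrow> nat \<Rightarrow> real" where
  "dcoeff n A j = real (labels n A j) / real (dual_labels n A j)"

definition inv_form :: "nat \<Rightarrow> cmatrix \<Rightarrow> vect \<Rightarrow> vect \<Rightarrow> real" where
  "inv_form n A x y =
     (\<Sum>j\<le>n. \<Sum>k\<le>n. x j * y k * (inverse (dcoeff n A j) * of_int (A j k)))"

definition simple_coroot :: "nat \<Rightarrow> cmatrix \<Rightarrow> nat \<Rightarrow> vect" where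
  "simple_coroot n A j = (\<lambda>k. dcoeff n A j * simple_root j k)"

definition simple_reflection :: "nat \<Rightarrow> cmatrix \<Rightarrow> nat \<Rightarrow> vect \<Rightarrow> vect" where
  "simple_reflection n A j x =
     (\<lambda>k. x k - inv_form n A x (simple_coroot n A j) * simple_root j k)"

definition delta :: "nat \<Rightarrow> cmatrix \<Rightarrow> vect" where
  "delta n A = (\<lambda>k. \<Sum>j\<le>n. real (labels n A j) * simple_root j k)"

definition theta :: "nat \<Rightarrow> cmatrix \<Rightarrow> vect" where
  "theta n A = (\<lambda>k. delta n A k - real (labels n A 0) * simple_root 0 k)"

definition s_theta :: "nat \<Rightarrow> cmatrix \<Rightarrow> vect \<Rightarrow> vect" where
  "s_theta n A x =
     (\<lambda>k. x k - 2 * inv_form n A x (theta n A) / inv_form n A (theta n A) (theta n A) * theta n A k)"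

definition affine_weyl :: "nat \<Rightarrow> cmatrix \<Rightarrow> (vect \<Rightarrow> vect) set" where
  "affine_weyl n A = generate (BijGroup UNIV) (simple_reflection n A ` {..n})"

text \<open>
  \<open>theta_word n A w\<close>: the word \<open>s\<^sub>i\<^sub>1 \<dots> s\<^sub>i\<^sub>m\<close> given by the list \<open>w = [i\<^sub>1, \<dots>, i\<^sub>m]\<close> of nonzero nodes
  is an expression for \<open>s\<^sub>\<theta>\<close> in the finite Weyl group.
\<close>

definition theta_word :: "nat \<Rightarrow> cmatrix \<Rightarrow> nat list \<Rightarrow> bool" where
  "theta_word n A w \<longleftrightarrow>
     set w \<subseteq> {1..n} \<and> foldr (\<lambda>i f. simple_reflection n A i \<circ> f) w id = s_theta n A"


section \<open>The double affine Weyl group and the elliptic Weyl group\<close>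

text \<open>
  The coordinate of \<open>\<alpha>\<^sub>n\<close> may be a half integer exactly in type \<open>A\<^sub>2\<^sub>n\<^sup>(\<^sup>2\<^sup>)\<close>.
\<close>

definition finite_lattice :: "kac_type \<Rightarrow> nat \<Rightarrow> vect set" where
  "finite_lattice X n =
     {x. (\<forall>k. k \<notin> {1..n} \<longrightarrow> x k = 0) \<and>
         (\<forall>k\<in>{1..n}. if X = Aeven2 n \<and> k = n then 2 * x k \<in> \<int> else x k \<in> \<int>)}"

definition scaled_delta :: "nat \<Rightarrow> cmatrix \<Rightarrow> vect" where
  "scaled_delta n A = (\<lambda>k. inverse (real (labels n A 0)) * delta n A k)"

definition Q_lattice :: "kac_type \<Rightarrow> nat \<Rightarrow> cmatrix \<Rightarrow> vect set" where
  "Q_lattice X n A =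
     {\<lambda>k. x k + of_int m * scaled_delta n A k | x m. x \<in> finite_lattice X n}"

text \<open>
  The pair \<open>(\<beta>, w)\<close> stands for \<open>\<tau>\<^sub>\<beta> w\<close>; hence
  \<open>(\<beta>, w) (\<gamma>, v) = \<tau>\<^sub>\<beta> (w \<tau>\<^sub>\<gamma> w\<^sup>-\<^sup>1) w v = (\<beta> + w \<gamma>, w v)\<close>.
\<close>

definition double_affine_weyl ::
    "kac_type \<Rightarrow> nat \<Rightarrow> cmatrix \<Rightarrow> (vect \<times> (vect \<Rightarrow> vect)) monoid" where
  "double_affine_weyl X n A =
     \<lparr>carrier = Q_lattice X n A \<times> affine_weyl n A,
      mult = (\<lambda>(\<beta>, w) (\<gamma>, v). (\<lambda>k. \<beta> k + w \<gamma> k, w \<circ> v)),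
      one = (\<lambda>k. 0, id)\<rparr>"

definition weyl_elt :: "(vect \<Rightarrow> vect) \<Rightarrow> vect \<times> (vect \<Rightarrow> vect)" where
  "weyl_elt w = (\<lambda>k. 0, w)"

definition tau :: "vect \<Rightarrow> vect \<times> (vect \<Rightarrow> vect)" where
  "tau \<beta> = (\<beta>, id)"

definition central_subgroup ::
    "kac_type \<Rightarrow> nat \<Rightarrow> cmatrix \<Rightarrow> (vect \<times> (vect \<Rightarrow> vect)) set" where
  "central_subgroup X n A = generate (double_affine_weyl X n A) {tau (scaled_delta n A)}"

definition elliptic_weyl ::
    "kac_type \<Rightarrow> nat \<Rightarrow> cmatrix \<Rightarrow> (vect \<times> (vect \<Rightarrow> vect)) set monoid" where
  "elliptic_weyl X n A = double_affine_weyl X n A Mod central_subgroup X n A"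


section \<open>Groups given by generators and relations\<close>

text \<open>
  The letter \<open>(x, True)\<close> stands for the generator \<open>x\<close> and \<open>(x, False)\<close> for its inverse.
  \<open>word_cong S R\<close> is the least congruence on the words over \<open>S\<close> that contains free
  cancellation and the relations \<open>u = v\<close> for \<open>(u, v) \<in> R\<close>.
\<close>

type_synonym 'g word = "('g \<times> bool) list"

definition words :: "'g set \<Rightarrow> 'g word set" where
  "words S = lists (S \<times> UNIV)"

inductive_set word_cong :: "'g set \<Rightarrow> ('g word \<times> 'g word) set \<Rightarrow> ('g word \<times> 'g word) set"
  for S :: "'g set" and R :: "('g word \<times> 'g word) set" where
  refl: "u \<in> words S \<Longrightarrow> (u, u) \<in> word_cong S R"
| sym: "(u, v) \<in> word_cong S R \<Longrightarrow> (v, u) \<in> word_cong S R"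
| trans: "(u, v) \<in> word_cong S R \<Longrightarrow> (v, t) \<in> word_cong S R \<Longrightarrow> (u, t) \<in> word_cong S R"
| app: "(u, u') \<in> word_cong S R \<Longrightarrow> (v, v') \<in> word_cong S R \<Longrightarrow> (u @ v, u' @ v') \<in> word_cong S R"
| cancel: "x \<in> S \<Longrightarrow> ([(x, b), (x, \<not> b)], []) \<in> word_cong S R"
| rel: "(u, v) \<in> R \<Longrightarrow> u \<in> words S \<Longrightarrow> v \<in> words S \<Longrightarrow> (u, v) \<in> word_cong S R"

definition word_class :: "'g set \<Rightarrow> ('g word \<times> 'g word) set \<Rightarrow> 'g word \<Rightarrow> 'g word set" where
  "word_class S R u = word_cong S R `` {u}"

definition presented_group :: "'g set \<Rightarrow> ('g word \<times> 'g word) set \<Rightarrow> 'g word set monoid" where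
  "presented_group S R =
     \<lparr>carrier = words S // word_cong S R,
      mult = (\<lambda>C D. \<Union>u\<in>C. \<Union>v\<in>D. word_class S R (u @ v)),
      one = word_class S R []\<rparr>"

definition pos_word :: "'g list \<Rightarrow> 'g word" where
  "pos_word xs = map (\<lambda>x. (x, True)) xs"


section \<open>The presentations\<close>

text \<open>\<open>Affine k\<close>, for \<open>k = 1, 2, 3\<close>, is the generator \<open>s\<^sub>0\<^sub>k\<close>.\<close>

datatype generator = Node nat | Affine nat

definition generators :: "nat \<Rightarrow> generator set" where
  "generators n = Node ` {1..n} \<union> Affine ` {1, 2, 3}"

fun node :: "generator \<Rightarrow> nat" where
  "node (Node i) = i"
| "node (Affine k) = 0"

fun alternating :: "nat \<Rightarrow> 'g \<Rightarrow> 'g \<Rightarrow> 'g list" where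
  "alternating 0 x y = []"
| "alternating (Suc m) x y = x # alternating m y x"

definition laces :: "cmatrix \<Rightarrow> nat \<Rightarrow> nat \<Rightarrow> int" where
  "laces A i j = A i j * A j i"

definition braid_relations :: "nat \<Rightarrow> cmatrix \<Rightarrow> (generator word \<times> generator word) set" where
  "braid_relations n A =
     {(pos_word (alternating m x y), pos_word (alternating m y x)) | m x y.
        x \<in> generators n \<and> y \<in> generators n \<and> node x \<noteq> node y \<and>
        (laces A (node x) (node y), m) \<in> {(0, 2), (1, 3), (2, 4), (3, 6)}}"

definition double_lace_relations :: "nat \<Rightarrow> cmatrix \<Rightarrow> (generator word \<times> generator word) set" where
  "double_lace_relations n A =
     {(pos_word [Affine 1, Node i, Affine 3, Node i],
       pos_word [Node i, Affine 3, Node i, Affine 1]) | i. i \<in> {1..n} \<and> laces A 0 i = 2}"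

definition order_two_relations :: "nat \<Rightarrow> (generator word \<times> generator word) set" where
  "order_two_relations n = {(pos_word [x, x], []) | x. x \<in> generators n}"

definition central_word :: "nat list \<Rightarrow> generator list" where
  "central_word w = [Affine 1, Affine 2, Affine 3] @ map Node w"

definition double_affine_relations ::
    "nat \<Rightarrow> cmatrix \<Rightarrow> nat list \<Rightarrow> (generator word \<times> generator word) set" where
  "double_affine_relations n A w =
     braid_relations n A \<union> double_lace_relations n A \<union> order_two_relations n \<union>
     {(pos_word (central_word w @ [x]), pos_word (x # central_word w)) | x. x \<in> generators n}"

definition elliptic_relations ::
    "nat \<Rightarrow> cmatrix \<Rightarrow> nat list \<Rightarrow> (generator word \<times> generator word) set" where
  "elliptic_relations n A w =
     braid_relations n A \<union> double_lace_relations n A \<union> order_two_relations n \<union>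
     {(pos_word (central_word w), [])}"

end

theory Submission
  imports Defs
begin

text \<open>
  The generators \<open>s\<^sub>0\<^sub>1, s\<^sub>0\<^sub>2, s\<^sub>0\<^sub>3\<close> are sent to three affine reflections whose linear parts pair with
  the simple roots exactly as \<open>\<alpha>\<^sub>0\<close> does, so that all relations reduce to one computation with two
  reflections. Conversely, let \<open>G\<close> be the group presented with \<open>s\<^sub>0\<^sub>1 s\<^sub>0\<^sub>2 s\<^sub>0\<^sub>3 s\<^sub>\<theta> = 1\<close>. By Tits'
  theorem (the reflection representation of a Coxeter group is faithful) the words in \<open>s\<^sub>0\<^sub>k\<close> and
  the \<open>s\<^sub>i\<close> give, for each \<open>k\<close>, a copy in \<open>G\<close> of the affine Weyl group, hence of its lattice of
  translations \<open>T\<^sub>k(\<beta>)\<close>. Since \<open>s\<^sub>0\<^sub>2 = T\<^sub>1(\<eta>) T\<^sub>3(\<eta>) s\<^sub>\<theta>\<close> with \<open>\<eta> = \<theta> / a\<^sub>0\<close>, the relations of \<open>s\<^sub>0\<^sub>2\<close>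
  say that \<open>T\<^sub>1(\<eta>)\<close> commutes with \<open>T\<^sub>3(\<eta>)\<close> and, for a node \<open>i\<close> joined to \<open>0\<close> by one lace, with
  \<open>T\<^sub>3(s\<^sub>i \<eta>)\<close>; relation b) yields the latter for two laces. Conjugating with the \<open>s\<^sub>j\<close> that fix \<open>\<eta>\<close>,
  \<open>T\<^sub>1(\<eta>)\<close> commutes with all \<open>T\<^sub>3(\<beta>)\<close>, because these vectors generate the lattice. This gives the
  normal form \<open>T\<^sub>3(\<beta>) u\<close>, with \<open>u\<close> in the first affine Weyl group, and therefore injectivity for the
  elliptic Weyl group. When \<open>s\<^sub>0\<^sub>1 s\<^sub>0\<^sub>2 s\<^sub>0\<^sub>3 s\<^sub>\<theta>\<close> is only central, an element of the kernel is a power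
  of it, and its image \<open>\<tau>\<close> has infinite order.
\<close>

section \<open>Affine reflections\<close>

text \<open>The obstacle is the interaction of different copies. Inside one copy every identity can
  be read off the reflection representation, but words in \<open>s\<^sub>0\<^sub>1\<close> and words
  in \<open>s\<^sub>0\<^sub>3\<close> meet only in relation b) and, once
  \<open>s\<^sub>0\<^sub>2\<close> is eliminated, in the relations of
  \<open>s\<^sub>0\<^sub>2\<close>. Hence everything is reduced to one family of commutators, and
  the lattice hypothesis \<open>generation\<close> lists just those closure properties that this
  family is known to have. It also explains the excluded types: there \<theta> is a long root and
  its orbit spans only the sublattice of long roots, which is proper; for the other types the orbit
  of \<eta> spans the whole lattice. The normal form can be tested in the double affine Weyl group
  because there the word for \<open>T\<^sub>3(\<beta>)\<close> becomes \<tau>_\<beta>, while a word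
  in the first copy becomes the affine Weyl group element that it spells.\<close>

definition aff_refl :: "(vect \<Rightarrow> real) \<Rightarrow> vect \<Rightarrow> vect \<Rightarrow> vect" where
  "aff_refl F a x = (\<lambda>k. x k - F x * a k)"

section \<open>Alternating words and the braid relation of two affine reflections\<close>

lemma map_alternating: "map f (alternating m x y) = alternating m (f x) (f y)"
  by (induction m arbitrary: x y) auto

lemma length_alternating [simp]: "length (alternating m x y) = m"
  by (induction m arbitrary: x y) auto

lemma set_alternating: "set (alternating m x y) \<subseteq> {x, y}"
  by (induction m arbitrary: x y) fastforce+

lemma alternating_snoc:
  "alternating (Suc m) x y = alternating m x y @ [if even m then x else y]"
  by (induction m arbitrary: x y) simp_all

lemma rev_alternating:
  "rev (alternating m x y) = (if even m then alternating m y x else alternating m x y)"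
proof (induction m arbitrary: x y)
  case (Suc m)
  have "rev (alternating (Suc m) x y) = rev (alternating m y x) @ [x]"
    by simp
  also have "\<dots> = (if even m then alternating m x y else alternating m y x) @ [x]"
    using Suc by simp
  also have "\<dots> = (if even (Suc m) then alternating (Suc m) y x else alternating (Suc m) x y)"
    unfolding alternating_snoc by simp
  finally show ?case .
qed simp

lemma alternating_add:
  "\<exists>u. set u \<subseteq> {x, y} \<and> length u = l \<and> alternating (m + l) x y = alternating m x y @ u"
proof (induction l)
  case (Suc l)
  then obtain u where "set u \<subseteq> {x, y}" "length u = l" "alternating (m + l) x y = alternating m x y @ u"
    by blast
  moreover have "alternating (m + Suc l) x y = alternating (m + l) x y @ [if even (m + l) then x else y]"
    unfolding add_Suc_right alternating_snoc ..
  ultimately show ?case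
    by (intro exI[of _ "u @ [if even (m + l) then x else y]"]) auto
qed simp

text \<open>Both reflections preserve x + span(a, b), so the relation is a computation with two
  coordinates. \<open>F\<close> and \<open>G\<close> enter only through their increments along a and
  b; thus linear functionals with an added constant are covered, and one lemma serves the linear and
  the affine situation.\<close>

lemma aff_refl_braid:
  fixes p q :: real
  assumes F: "\<And>x s t. F (\<lambda>k. x k + s * a k + t * b k) = F x + 2 * s + p * t"
    and G: "\<And>x s t. G (\<lambda>k. x k + s * a k + t * b k) = G x + q * s + 2 * t"
    and m: "(p * q, m) \<in> {(0, 2), (1, 3), (2, 4), (3, 6)}"
    and z: "p = 0 \<longleftrightarrow> q = 0"
  shows "foldr (\<circ>) (alternating m (aff_refl F a) (aff_refl G b)) id =
         foldr (\<circ>) (alternating m (aff_refl G b) (aff_refl F a)) id"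
proof
  fix x
  \<comment> \<open>\<open>c s t\<close> is the point with coordinates (s, t) in the plane through
    x.\<close>
  define c where "c s t = (\<lambda>k. x k + s * a k + t * b k)" for s t
  have Fc: "aff_refl F a (c s t) = c (- s - F x - p * t) t" for s t
    unfolding aff_refl_def c_def F by (auto simp: algebra_simps)
  have Gc: "aff_refl G b (c s t) = c s (- t - G x - q * s)" for s t
    unfolding aff_refl_def c_def G by (auto simp: algebra_simps)
  have x: "x = c 0 0"
    by (simp add: c_def)
  consider "p = 0" "q = 0" "m = 2" | "p * q = 1" "m = 3" | "p * q = 2" "m = 4" | "p * q = 3" "m = 6"
    using m z by auto
  then have "foldr (\<circ>) (alternating m (aff_refl F a) (aff_refl G b)) id (c 0 0) =
             foldr (\<circ>) (alternating m (aff_refl G b) (aff_refl F a)) id (c 0 0)"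
  proof cases
    case 1
    then show ?thesis by (simp add: numeral_eq_Suc Fc Gc)
  next
    case 2
    have e: "p * (q * y) = y" "q * (p * y) = y" for y
      using 2 by (metis mult.assoc mult.commute mult_1)+
    show ?thesis
      unfolding \<open>m = 3\<close> by (simp add: numeral_eq_Suc Fc Gc, simp add: algebra_simps e 2)
  next
    case 3
    have e: "p * (q * y) = 2 * y" "q * (p * y) = 2 * y" for y
      using 3 by (metis mult.assoc mult.commute)+
    show ?thesis
      unfolding \<open>m = 4\<close> by (simp add: eval_nat_numeral Fc Gc, simp add: algebra_simps e 3)
  next
    case 4
    have e: "p * (q * y) = 3 * y" "q * (p * y) = 3 * y" for y
      using 4 by (metis mult.assoc mult.commute)+
    show ?thesis
      unfolding \<open>m = 6\<close> by (simp add: eval_nat_numeral Fc Gc, simp add: algebra_simps e 4)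
  qed
  then show "foldr (\<circ>) (alternating m (aff_refl F a) (aff_refl G b)) id x =
             foldr (\<circ>) (alternating m (aff_refl G b) (aff_refl F a)) id x"
    using x by simp
qed

lemma aff_refl_involution:
  assumes "\<And>x s. F (\<lambda>k. x k + s * a k) = F x + 2 * s"
  shows "aff_refl F a (aff_refl F a x) = x"
  using assms[of x "- F x"] by (simp add: aff_refl_def)


section \<open>The reflection representation\<close>

text \<open>The coordinate \<open>matrix_apply n A x j\<close> is the pairing of x with the j-th
  coroot. This form of s_j uses the Cartan matrix alone, so Tits' argument needs neither labels nor
  an invariant form.\<close>

definition root_refl :: "nat \<Rightarrow> cmatrix \<Rightarrow> nat \<Rightarrow> vect \<Rightarrow> vect" where
  "root_refl n A j = aff_refl (\<lambda>x. matrix_apply n A x j) (simple_root j)"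

definition act :: "nat \<Rightarrow> cmatrix \<Rightarrow> nat list \<Rightarrow> vect \<Rightarrow> vect" where
  "act n A u = foldr (\<lambda>i f. root_refl n A i \<circ> f) u id"

lemma matrix_apply_comb:
  "matrix_apply n A (\<lambda>k. s * x k + t * y k) j = s * matrix_apply n A x j + t * matrix_apply n A y j"
  unfolding matrix_apply_def by (simp add: algebra_simps sum.distrib sum_distrib_left)

lemma matrix_apply_add:
  "matrix_apply n A (\<lambda>k. x k + y k) j = matrix_apply n A x j + matrix_apply n A y j"
  using matrix_apply_comb[of n A 1 x 1 y] by simp

lemma matrix_apply_scale: "matrix_apply n A (\<lambda>k. s * x k) j = s * matrix_apply n A x j"
  using matrix_apply_comb[of n A s x 0 x] by simp

lemma matrix_apply_simple_root: "i \<le> n \<Longrightarrow> matrix_apply n A (simple_root i) j = of_int (A j i)"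
  unfolding matrix_apply_def simple_root_def by (simp add: sum.delta' if_distrib cong: if_cong)

lemma root_refl_eq: "root_refl n A j x = (\<lambda>k. x k - matrix_apply n A x j * simple_root j k)"
  by (simp add: root_refl_def aff_refl_def)

lemma root_refl_comb:
  "root_refl n A j (\<lambda>k. s * x k + t * y k) = (\<lambda>k. s * root_refl n A j x k + t * root_refl n A j y k)"
  by (auto simp: root_refl_eq matrix_apply_comb algebra_simps)

lemma act_Nil [simp]: "act n A [] = id"
  by (simp add: act_def)

lemma act_Cons [simp]: "act n A (i # u) = root_refl n A i \<circ> act n A u"
  by (simp add: act_def)

lemma act_append [simp]: "act n A (u @ v) = act n A u \<circ> act n A v"
  by (induction u) auto

lemma act_comb:
  "act n A u (\<lambda>k. s * x k + t * y k) = (\<lambda>k. s * act n A u x k + t * act n A u y k)"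
  by (induction u) (simp_all add: root_refl_comb)

lemma act_add: "act n A u (\<lambda>k. x k + y k) = (\<lambda>k. act n A u x k + act n A u y k)"
  using act_comb[of n A u 1 x 1 y] by simp

lemma act_scale: "act n A u (\<lambda>k. s * x k) = (\<lambda>k. s * act n A u x k)"
  using act_comb[of n A u s x 0 x] by simp

lemma act_zero [simp]: "act n A u (\<lambda>k. 0) = (\<lambda>k. 0)"
  using act_comb[of n A u 0 "\<lambda>_. 0" 0 "\<lambda>_. 0"] by simp

lemma act_alternating:
  "act n A (alternating m i j) = foldr (\<circ>) (alternating m (root_refl n A i) (root_refl n A j)) id"
  unfolding act_def map_alternating[symmetric] foldr_map by (simp add: comp_def)

locale cartan =
  fixes n :: nat and A :: cmatrix
  assumes cartan: "gen_cartan_matrix n A"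
begin

lemma diag: "i \<le> n \<Longrightarrow> A i i = 2"
  using cartan by (auto simp: gen_cartan_matrix_def)

lemma offdiag: "i \<le> n \<Longrightarrow> j \<le> n \<Longrightarrow> i \<noteq> j \<Longrightarrow> A i j \<le> 0"
  using cartan by (auto simp: gen_cartan_matrix_def)

lemma zero_iff: "i \<le> n \<Longrightarrow> j \<le> n \<Longrightarrow> A i j = 0 \<longleftrightarrow> A j i = 0"
  using cartan by (auto simp: gen_cartan_matrix_def)

lemma root_refl_root_refl: "i \<le> n \<Longrightarrow> root_refl n A i (root_refl n A i x) = x"
  unfolding root_refl_def
  by (rule aff_refl_involution) (simp add: matrix_apply_add matrix_apply_scale
      matrix_apply_simple_root diag)

lemma root_refl_self: "i \<le> n \<Longrightarrow> root_refl n A i (simple_root i) = (\<lambda>k. - simple_root i k)"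
  by (auto simp: root_refl_eq matrix_apply_simple_root diag)

lemma act_rev: "set u \<subseteq> {..n} \<Longrightarrow> act n A (rev u) \<circ> act n A u = id"
  by (induction u) (auto simp: fun_eq_iff root_refl_root_refl)

lemma act_rev': "set u \<subseteq> {..n} \<Longrightarrow> act n A u \<circ> act n A (rev u) = id"
  using act_rev[of "rev u"] by simp

lemma act_braid:
  assumes "i \<le> n" "j \<le> n" "i \<noteq> j" and m: "(laces A i j, m) \<in> {(0, 2), (1, 3), (2, 4), (3, 6)}"
  shows "act n A (alternating m i j) = act n A (alternating m j i)"
  unfolding act_alternating root_refl_def
proof (rule aff_refl_braid[where p = "of_int (A i j)" and q = "of_int (A j i)"])
  have "real_of_int (A i j) * real_of_int (A j i) = of_int (laces A i j)"
    by (simp add: laces_def)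
  then show "(real_of_int (A i j) * real_of_int (A j i), m) \<in> {(0, 2), (1, 3), (2, 4), (3, 6)}"
    using m by auto
qed (use assms zero_iff in \<open>simp_all add: matrix_apply_add matrix_apply_scale
      matrix_apply_simple_root diag\<close>)

end


section \<open>Faithfulness of the reflection representation\<close>

text \<open>The letters have an arbitrary type, so that words in nodes, in generators and in signed
  letters are evaluated by the same function.\<close>

definition word_prod :: "('a, 'b) monoid_scheme \<Rightarrow> ('c \<Rightarrow> 'a) \<Rightarrow> 'c list \<Rightarrow> 'a" where
  "word_prod G f u = foldr (\<lambda>x y. f x \<otimes>\<^bsub>G\<^esub> y) u \<one>\<^bsub>G\<^esub>"

lemma word_prod_Nil [simp]: "word_prod G f [] = \<one>\<^bsub>G\<^esub>"
  and word_prod_Cons [simp]: "word_prod G f (x # u) = f x \<otimes>\<^bsub>G\<^esub> word_prod G f u"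
  by (simp_all add: word_prod_def)

lemma word_prod_map: "word_prod G f (map h u) = word_prod G (\<lambda>x. f (h x)) u"
  by (induction u) auto

lemma word_prod_cong: "(\<And>x. x \<in> set u \<Longrightarrow> f x = g x) \<Longrightarrow> word_prod G f u = word_prod G g u"
  by (induction u) auto

context group
begin

lemma word_prod_closed [simp]: "(\<And>x. x \<in> set u \<Longrightarrow> f x \<in> carrier G) \<Longrightarrow> word_prod G f u \<in> carrier G"
  by (induction u) auto

lemma word_prod_append:
  "(\<And>x. x \<in> set u \<union> set v \<Longrightarrow> f x \<in> carrier G) \<Longrightarrow>
   word_prod G f (u @ v) = word_prod G f u \<otimes> word_prod G f v"
  by (induction u) (auto simp: m_assoc)

end

text \<open>
  Tits' argument. Words are compared by their value in \<open>G\<close> together with their action; for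
  \<open>G\<close> the Coxeter group itself the second condition would be redundant.
\<close>

locale coxeter_images = group G + cartan n A
  for G (structure) and n A +
  fixes f :: "nat \<Rightarrow> 'a"
  assumes f_closed: "i \<le> n \<Longrightarrow> f i \<in> carrier G"
    and f_square: "i \<le> n \<Longrightarrow> f i \<otimes> f i = \<one>"
    and f_braid: "i \<le> n \<Longrightarrow> j \<le> n \<Longrightarrow> i \<noteq> j \<Longrightarrow>
      (laces A i j, m) \<in> {(0, 2), (1, 3), (2, 4), (3, 6)} \<Longrightarrow>
      word_prod G f (alternating m i j) = word_prod G f (alternating m j i)"
begin

section \<open>Words up to equality, and their length\<close>

definition sim :: "nat list \<Rightarrow> nat list \<Rightarrow> bool" where
  "sim u v \<longleftrightarrow> set u \<subseteq> {..n} \<and> set v \<subseteq> {..n} \<and>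
     word_prod G f u = word_prod G f v \<and> act n A u = act n A v"

text \<open>This takes the place of the Coxeter length: the least length in the class under
  \<open>sim\<close>.\<close>

definition len :: "nat list \<Rightarrow> nat" where
  "len u = (LEAST m. \<exists>v. sim u v \<and> length v = m)"

lemma prod_closed: "set u \<subseteq> {..n} \<Longrightarrow> word_prod G f u \<in> carrier G"
  by (rule word_prod_closed) (use f_closed in auto)

lemma prod_append:
  "set u \<subseteq> {..n} \<Longrightarrow> set v \<subseteq> {..n} \<Longrightarrow>
   word_prod G f (u @ v) = word_prod G f u \<otimes> word_prod G f v"
  by (rule word_prod_append) (use f_closed in auto)

lemma sim_refl: "set u \<subseteq> {..n} \<Longrightarrow> sim u u"
  by (simp add: sim_def)

lemma sim_sym: "sim u v \<Longrightarrow> sim v u"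
  by (auto simp: sim_def)

lemma sim_trans: "sim u v \<Longrightarrow> sim v w \<Longrightarrow> sim u w"
  by (auto simp: sim_def)

lemma sim_append: "sim u u' \<Longrightarrow> sim v v' \<Longrightarrow> sim (u @ v) (u' @ v')"
  by (auto simp: sim_def prod_append)

lemma sim_square: "i \<le> n \<Longrightarrow> sim [i, i] []"
  by (auto simp: sim_def f_square f_closed fun_eq_iff root_refl_root_refl)

lemma sim_cancel: "set u \<subseteq> {..n} \<Longrightarrow> i \<le> n \<Longrightarrow> sim (u @ [i, i]) u"
  using sim_append[OF sim_refl sim_square, of u i] by simp

text \<open>The words are reversed because, below, dihedral words are described by their last
  letter, the one that acts first on a root.\<close>

lemma sim_braid:
  assumes "i \<le> n" "j \<le> n" "i \<noteq> j" and "(laces A i j, m) \<in> {(0, 2), (1, 3), (2, 4), (3, 6)}"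
  shows "sim (rev (alternating m i j)) (rev (alternating m j i))"
  using set_alternating[of m i j] set_alternating[of m j i] f_braid[OF assms] act_braid[OF assms] assms
  unfolding sim_def rev_alternating by auto

lemma len_le: "sim u v \<Longrightarrow> len u \<le> length v"
  unfolding len_def by (rule Least_le) auto

lemma len_attained: "set u \<subseteq> {..n} \<Longrightarrow> \<exists>v. sim u v \<and> length v = len u"
  unfolding len_def by (rule LeastI_ex) (use sim_refl in blast)

lemma len_sim: "sim u v \<Longrightarrow> len u = len v"
  by (metis dual_order.antisym len_attained len_le sim_def sim_sym sim_trans)

text \<open>A word in two letters either repeats a letter, which then cancels, or alternates. The
  two alternating words are distinguished by their last letter: t in the first, s in the
  second.\<close>

lemma dihedral_word_cases:
  assumes "s \<le> n" "t \<le> n" and "set d \<subseteq> {s, t}"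
  shows "(\<exists>d'. set d' \<subseteq> {..n} \<and> sim d d' \<and> length d' < length d) \<or>
     d = rev (alternating (length d) t s) \<or> d = rev (alternating (length d) s t)"
  using assms(3)
proof (induction d rule: rev_induct)
  case (snoc x d)
  have x: "x = s \<or> x = t" and dn: "set d \<subseteq> {..n}"
    using snoc.prems assms by auto
  have xn: "x \<le> n"
    using x assms by auto
  \<comment> \<open>A nonempty \<open>d\<close> ends in y. Appending y cancels against it, appending
    z prolongs the alternation.\<close>
  have key: ?case if dyz: "d = rev (alternating (length d) y z)" "{y, z} = {s, t}" for y z
  proof (cases "x = y \<and> length d > 0")
    case True
    then obtain l where "length d = Suc l"
      using gr0_conv_Suc by blast
    with True have d: "d = rev (alternating l z y) @ [x]"
      using dyz(1) unfolding \<open>length d = Suc l\<close> by simp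
    then have "sim (d @ [x]) (rev (alternating l z y))"
      using sim_cancel[of "rev (alternating l z y)" x] dn xn by simp
    then show ?thesis
      using d by (metis (no_types, lifting) le_imp_less_Suc length_append_singleton
          less_Suc_eq sim_def)
  next
    case False
    then consider "length d = 0" | "x = z"
      using x dyz(2) unfolding doubleton_eq_iff by blast
    then show ?thesis
    proof cases
      case 1
      then show ?thesis using x by auto
    next
      case 2
      have "rev (alternating (length (d @ [x])) z y) = rev (alternating (length d) y z) @ [z]"
        by simp
      then have snoc_eq: "d @ [x] = rev (alternating (length (d @ [x])) z y)"
        unfolding 2 dyz(1)[symmetric] ..
      have "y = s \<and> z = t \<or> y = t \<and> z = s"
        using dyz(2) by (simp add: doubleton_eq_iff)
      then show ?thesis
      proof (elim disjE conjE)
        assume "y = s" "z = t"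
        then show ?thesis
          by (intro disjI2 disjI1) (rule snoc_eq[unfolded \<open>y = s\<close> \<open>z = t\<close>])
      next
        assume "y = t" "z = s"
        then show ?thesis
          by (intro disjI2) (rule snoc_eq[unfolded \<open>y = t\<close> \<open>z = s\<close>])
      qed
    qed
  qed
  have "set d \<subseteq> {s, t}"
    using snoc.prems by simp
  from snoc.IH[OF this] consider
      (a) d' where "set d' \<subseteq> {..n}" "sim d d'" "length d' < length d"
    | (b) "d = rev (alternating (length d) t s)" | (c) "d = rev (alternating (length d) s t)"
    by blast
  then show ?case
  proof cases
    case a
    then have "sim (d @ [x]) (d' @ [x])"
      using sim_append[OF a(2) sim_refl[of "[x]"]] xn by simp
    then show ?thesis
      using a xn by (intro disjI1 exI[of _ "d' @ [x]"]) auto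
  next
    case b
    show ?thesis
      by (rule key[OF b insert_commute])
  next
    case c
    show ?thesis
      by (rule key[OF c HOL.refl])
  qed
qed simp

section \<open>Positivity of roots for dihedral groups\<close>

abbreviation comb :: "nat \<Rightarrow> nat \<Rightarrow> real \<Rightarrow> real \<Rightarrow> vect" where
  "comb s t x y \<equiv> (\<lambda>k. x * simple_root s k + y * simple_root t k)"

lemma root_refl_dihedral:
  "s \<le> n \<Longrightarrow> t \<le> n \<Longrightarrow> root_refl n A t (comb s t x y) = comb s t x (- of_int (A t s) * x - y)"
  by (auto simp: root_refl_eq matrix_apply_comb matrix_apply_simple_root diag algebra_simps)

text \<open>The last letter acts first and changes only one coefficient; afterwards s and t exchange
  their roles, which is what makes the recursion work.\<close>

lemma act_dihedral_Suc:
  assumes "s \<le> n" "t \<le> n"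
  shows "act n A (rev (alternating (Suc k) t s)) (comb s t x y) =
    act n A (rev (alternating k s t)) (comb t s (- of_int (A t s) * x - y) x)"
proof -
  have "comb s t x z = comb t s z x" for z
    by (auto simp: add.commute)
  then show ?thesis
    using root_refl_dihedral[OF assms, of x y] by (simp del: of_int_minus)
qed

text \<open>The inequality on \<open>(x, y)\<close> keeps the roots of an infinite dihedral group positive.\<close>

lemma dihedral_pos_infinite:
  assumes "s \<le> n" "t \<le> n" "s \<noteq> t" and "laces A s t \<ge> 4"
    and "x \<ge> 0" "y \<ge> 0" "- of_int (A s t) * y \<le> 2 * x"
  shows "\<exists>x' y'. x' \<ge> 0 \<and> y' \<ge> 0 \<and>
    act n A (rev (alternating k t s)) (comb s t x y) = comb s t x' y'"
  using assms
proof (induction k arbitrary: s t x y)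
  case 0
  then show ?case by auto
next
  case (Suc k)
  define p q where "p = - real_of_int (A t s)" and "q = - real_of_int (A s t)"
  have p0: "p \<ge> 0" "q \<ge> 0"
    using Suc.prems offdiag by (auto simp: p_def q_def)
  have pq: "p * q \<ge> 4"
    using Suc.prems(4) unfolding p_def q_def laces_def
    by (metis minus_mult_minus mult.commute of_int_le_iff of_int_mult of_int_numeral)
  have qy: "q * y \<le> 2 * x"
    using Suc.prems(7) by (simp add: q_def)
  \<comment> \<open>The new pair is (p x - y, x). Its nonnegativity and its instance of the
    invariant both follow from 2 y \<le> p x, and this is where p q \<ge> 4 is used.\<close>
  have "4 * y \<le> (p * q) * y"
    using pq Suc.prems(6) mult_right_mono by blast
  also have "\<dots> \<le> p * (2 * x)"
    using qy p0 mult_left_mono[of "q * y" "2 * x" p] by (simp add: mult.assoc)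
  finally have *: "2 * y \<le> p * x"
    by simp
  have "\<exists>x' y'. x' \<ge> 0 \<and> y' \<ge> 0 \<and>
    act n A (rev (alternating k s t)) (comb t s (p * x - y) x) = comb t s x' y'"
  proof (rule Suc.IH)
    show "4 \<le> laces A t s"
      using Suc.prems(4) by (simp add: laces_def mult.commute)
    show "0 \<le> p * x - y"
      using * Suc.prems(6) by linarith
    show "- real_of_int (A t s) * x \<le> 2 * (p * x - y)"
      using * by (simp add: p_def mult.commute)
  qed (use Suc.prems in auto)
  then obtain x' y' where "x' \<ge> 0" "y' \<ge> 0"
    "act n A (rev (alternating k s t)) (comb t s (p * x - y) x) = comb t s x' y'"
    by blast
  then show ?case
    using act_dihedral_Suc[OF Suc.prems(1,2), of k x y]
    by (intro exI[of _ y'] exI[of _ x']) (auto simp: p_def add.commute)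
qed

text \<open>Before the longest element is reached, the images of \<alpha>_s have coefficients that
  are explicit polynomials in p and q. There are at most six of them, and they are checked for p q =
  0, 1, 2, 3.\<close>

lemma dihedral_pos_finite:
  assumes "s \<le> n" "t \<le> n" "s \<noteq> t"
    and m: "(laces A s t, m) \<in> {(0, 2), (1, 3), (2, 4), (3, 6)}" and "k < m"
  shows "\<exists>x' y'. x' \<ge> 0 \<and> y' \<ge> 0 \<and>
    act n A (rev (alternating k t s)) (comb s t 1 0) = comb s t x' y'"
proof -
  define p q where "p = - real_of_int (A t s)" and "q = - real_of_int (A s t)"
  have p0: "p \<ge> 0" "q \<ge> 0"
    using assms offdiag by (auto simp: p_def q_def)
  have pq: "p * q = of_int (laces A s t)"
    by (simp add: p_def q_def laces_def mult.commute)
  have z: "p = 0 \<longleftrightarrow> q = 0"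
    using zero_iff assms by (simp add: p_def q_def)
  have st: "act n A (rev (alternating (Suc k) t s)) (comb s t x y) =
    act n A (rev (alternating k s t)) (comb t s (p * x - y) x)" for k x y
    using act_dihedral_Suc[of s t k x y] assms by (simp add: p_def)
  have ts: "act n A (rev (alternating (Suc k) s t)) (comb t s x y) =
    act n A (rev (alternating k t s)) (comb s t (q * x - y) x)" for k x y
    using act_dihedral_Suc[of t s k x y] assms by (simp add: q_def)
  have k: "k < 6" using m \<open>k < m\<close> by auto
  \<comment> \<open>The successive images of \<alpha>_s. For p q = 3 the last one is \<alpha>_s
    again, in accordance with m = 6.\<close>
  have e0: "act n A (rev (alternating 0 t s)) (comb s t 1 0) = comb s t 1 0"
    and e1: "act n A (rev (alternating (Suc 0) t s)) (comb s t 1 0) = comb s t 1 p"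
    and e2: "act n A (rev (alternating (Suc (Suc 0)) t s)) (comb s t 1 0) = comb s t (q * p - 1) p"
    and e3: "act n A (rev (alternating (Suc (Suc (Suc 0))) t s)) (comb s t 1 0) =
      comb s t (q * p - 1) (p * (q * p - 1) - p)"
    and e4: "act n A (rev (alternating (Suc (Suc (Suc (Suc 0)))) t s)) (comb s t 1 0) =
      comb s t (q * (p * (q * p - 1) - p) - (q * p - 1)) (p * (q * p - 1) - p)"
    and e5: "act n A (rev (alternating (Suc (Suc (Suc (Suc (Suc 0))))) t s)) (comb s t 1 0) =
      comb s t (q * (p * (q * p - 1) - p) - (q * p - 1))
        (p * (q * (p * (q * p - 1) - p) - (q * p - 1)) - (p * (q * p - 1) - p))"
    unfolding st ts alternating.simps(1) rev.simps(1) act_Nil id_apply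
    by (simp_all add: add.commute)
  have cases: "k = 0 \<or> k = Suc 0 \<or> k = Suc (Suc 0) \<or> k = Suc (Suc (Suc 0)) \<or>
      k = Suc (Suc (Suc (Suc 0))) \<or> k = Suc (Suc (Suc (Suc (Suc 0))))"
    using k by linarith
  define P where "P \<longleftrightarrow> (\<exists>x' y'. x' \<ge> 0 \<and> y' \<ge> 0 \<and>
    act n A (rev (alternating k t s)) (comb s t 1 0) = comb s t x' y')"
  have P: P if "k = j" "act n A (rev (alternating j t s)) (comb s t 1 0) = comb s t x y"
    "x \<ge> 0" "y \<ge> 0" for j x y
    unfolding P_def using that by blast
  note Ps = P[OF _ e0] P[OF _ e1] P[OF _ e2] P[OF _ e3] P[OF _ e4] P[OF _ e5]
  have "(p = 0 \<and> q = 0 \<and> m = 2) \<or> (q * p = 1 \<and> m = 3) \<or> (q * p = 2 \<and> m = 4) \<or> (q * p = 3 \<and> m = 6)"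
    using m pq z by (auto simp: mult.commute)
  then have P
  proof (elim disjE conjE)
    assume "p = 0" "m = 2"
    moreover from this have "k = 0 \<or> k = Suc 0"
      using \<open>k < m\<close> by auto
    ultimately show P
      using Ps(1,2) by auto
  next
    assume qp: "q * p = 1" and "m = 3"
    then have "k = 0 \<or> k = Suc 0 \<or> k = Suc (Suc 0)"
      using \<open>k < m\<close> by auto
    then show P
      using Ps(1-3) p0 unfolding qp by auto
  next
    assume qp: "q * p = 2" and "m = 4"
    then have "k = 0 \<or> k = Suc 0 \<or> k = Suc (Suc 0) \<or> k = Suc (Suc (Suc 0))"
      using \<open>k < m\<close> by auto
    then show P
      using Ps(1-4) p0 unfolding qp by auto
  next
    assume qp: "q * p = 3"
    then have "q * (p * (3 - 1) - p) = 3"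
      by (simp add: algebra_simps)
    then show P
      using cases Ps p0 unfolding qp by auto
  qed
  then show ?thesis
    unfolding P_def .
qed

lemma dihedral_pos:
  assumes "s \<le> n" "t \<le> n" "s \<noteq> t"
    and short: "\<And>m. (laces A s t, m) \<in> {(0, 2), (1, 3), (2, 4), (3, 6)} \<Longrightarrow> k < m"
  shows "\<exists>x' y'. x' \<ge> 0 \<and> y' \<ge> 0 \<and>
    act n A (rev (alternating k t s)) (simple_root s) = comb s t x' y'"
proof -
  have "laces A s t \<ge> 0"
    unfolding laces_def using assms offdiag by (simp add: mult_nonpos_nonpos)
  then consider "laces A s t \<in> {0, 1, 2, 3}" | "laces A s t \<ge> 4"
    by force
  then have "\<exists>x' y'. x' \<ge> 0 \<and> y' \<ge> 0 \<and>
    act n A (rev (alternating k t s)) (comb s t 1 0) = comb s t x' y'"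
  proof cases
    case 1
    then obtain m where "(laces A s t, m) \<in> {(0, 2), (1, 3), (2, 4), (3, 6::nat)}"
      by blast
    then show ?thesis
      using dihedral_pos_finite short assms by blast
  next
    case 2
    then show ?thesis
      by (intro dihedral_pos_infinite assms) auto
  qed
  then show ?thesis by simp
qed

section \<open>Tits' positivity theorem and faithfulness\<close>

text \<open>The element is split as v d, with d a word in s and in the last letter t of a reduced
  word, and v as short as possible. By induction v keeps \<alpha>_s and \<alpha>_t positive, and d
  sends \<alpha>_s to a nonnegative combination of these two roots.\<close>

lemma act_pos:
  assumes "set u \<subseteq> {..n}" "s \<le> n" "len (u @ [s]) \<ge> len u"
  shows "act n A u (simple_root s) k \<ge> 0"
  using assms
proof (induction "len u" arbitrary: u s k rule: less_induct)
  case less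
  obtain r where r: "sim u r" "length r = len u"
    using len_attained less.prems(1) by blast
  show ?case
  proof (cases r rule: rev_cases)
    case Nil
    then show ?thesis
      using r by (auto simp: sim_def simple_root_def)
  next
    case (snoc r' t)
    have rn: "set r' \<subseteq> {..n}" "t \<le> n"
      using r snoc by (auto simp: sim_def)
    have us: "len (r @ [s]) \<ge> len u"
      using less.prems sim_append[OF r(1) sim_refl[of "[s]"]] len_sim by fastforce
    have "t \<noteq> s"
    proof
      assume "t = s"
      then have "sim (r @ [s]) r'"
        using snoc sim_cancel rn by simp
      then show False
        using us len_le[of "r @ [s]" r'] r(2) snoc by simp
    qed
    \<comment> \<open>Factorisations v d with additive lengths; \<open>l\<close> is the least
      possible length of v. The reduced word itself, split before its last letter t, is one of them,
      so v is shorter than u and the induction applies to it.\<close>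
    define P where "P l \<longleftrightarrow> (\<exists>v d. length v = l \<and> set v \<subseteq> {..n} \<and> set d \<subseteq> {s, t} \<and>
        sim u (v @ d) \<and> length v + length d = len u)" for l
    have P1: "P (length r')"
      unfolding P_def using r rn snoc by (intro exI[of _ r'] exI[of _ "[t]"]) auto
    define l where "l = (LEAST l. P l)"
    have "P l" and l_le: "l \<le> length r'"
      unfolding l_def using P1 by (auto intro: LeastI Least_le)
    then obtain v d where v: "length v = l" "set v \<subseteq> {..n}" "set d \<subseteq> {s, t}"
        "sim u (v @ d)" "length v + length d = len u"
      unfolding P_def by blast
    have dn: "set d \<subseteq> {..n}"
      using v(3) less.prems(2) rn by auto
    have reduced: "length v \<le> length v'" if "sim v v'" for v'
    proof -
      have "sim u (v' @ d)"
        using v(4) sim_append[OF that sim_refl[OF dn]] sim_trans by blast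
      then show ?thesis
        using len_le v(5) by fastforce
    qed
    have lv: "len v = length v"
      using reduced len_attained[OF v(2)] len_le[OF sim_refl[OF v(2)]] by fastforce
    \<comment> \<open>If a letter z = s or t shortened v, it could be moved from v to d, contrary to
      the choice of v.\<close>
    have vpos: "act n A v (simple_root z) k \<ge> 0" if z: "z \<in> {s, t}" for z k
    proof (rule less.hyps)
      have zn: "z \<le> n"
        using z less.prems(2) rn by auto
      show "len v < len u"
        using lv v(1) l_le r(2) snoc by simp
      show "len v \<le> len (v @ [z])"
      proof (rule ccontr)
        assume c: "\<not> ?thesis"
        obtain v' where v': "sim (v @ [z]) v'" "length v' = len (v @ [z])"
          using len_attained[of "v @ [z]"] v(2) zn by auto
        have "sim (v @ [z, z]) (v' @ [z])"
          using sim_append[OF v'(1) sim_refl[of "[z]"]] zn by simp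
        then have "sim v (v' @ [z])"
          using sim_cancel[OF v(2) zn] sim_sym sim_trans by blast
        then have s2: "sim u (v' @ z # d)"
          using sim_append[OF _ sim_refl[OF dn], of v "v' @ [z]"] v(4) sim_trans by fastforce
        have "len u \<le> length (v' @ z # d)"
          using len_le[OF s2] .
        then have "P (length v')"
          unfolding P_def using s2 c v v' z lv
          by (intro exI[of _ v'] exI[of _ "z # d"]) (auto simp: sim_def)
        then have "l \<le> length v'"
          unfolding l_def by (rule Least_le)
        then show False
          using c v' lv v(1) by simp
      qed
    qed (use v z less.prems(2) rn in auto)
    have no_short: "length d \<le> length d'" if "sim d d'" for d'
    proof -
      have "sim u (v @ d')"
        using v(4) sim_append[OF sim_refl[OF v(2)] that] sim_trans by blast
      then show ?thesis
        using len_le v(5) by fastforce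
    qed
    have no_short': "length d \<le> length d'" if "sim (d @ [s]) d'" for d'
    proof -
      have "sim (u @ [s]) (v @ d @ [s])"
        using sim_append[OF v(4) sim_refl[of "[s]"]] less.prems(2) by simp
      also have "sim (v @ d @ [s]) (v @ d')"
        using sim_append[OF sim_refl[OF v(2)] that] .
      finally (sim_trans) show ?thesis
        using len_le[of "u @ [s]" "v @ d'"] less.prems(3) v(5) by simp
    qed
    \<comment> \<open>As d cannot be shortened, it alternates. It cannot end in s, because then
      appending s would shorten u.\<close>
    have dd: "d = rev (alternating (length d) t s)"
    proof -
      consider "d = rev (alternating (length d) t s)" | "d = rev (alternating (length d) s t)"
        using dihedral_word_cases[OF less.prems(2) rn(2) v(3)] no_short by (meson leD)
      then show ?thesis
      proof cases
        case 2
        show ?thesis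
        proof (cases "length d")
          case (Suc l')
          then have d: "d = rev (alternating l' t s) @ [s]"
            using 2 unfolding Suc by simp
          then have "sim (d @ [s]) (rev (alternating l' t s))"
            using sim_cancel[of "rev (alternating l' t s)" s] dn less.prems(2) by simp
          then show ?thesis
            using no_short'[of "rev (alternating l' t s)"] Suc by simp
        qed simp
      qed
    qed
    \<comment> \<open>If d had m or more letters, its tail of length m could be rewritten by the
      braid relation so as to end in s, and appending s would again shorten u.\<close>
    have short: "length d < m" if m: "(laces A s t, m) \<in> {(0, 2), (1, 3), (2, 4), (3, 6)}" for m
    proof (rule ccontr)
      assume "\<not> ?thesis"
      then obtain l' where l': "length d = m + l'"
        using le_Suc_ex not_less by blast
      obtain m' where m': "m = Suc m'"
        using m by auto
      obtain e where e: "set e \<subseteq> {t, s}" "length e = l'"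
          "alternating (m + l') t s = alternating m t s @ e"
        using alternating_add by metis
      have en: "set (rev e) \<subseteq> {..n}"
        using e(1) less.prems(2) rn by auto
      have an: "set (rev (alternating m' t s)) \<subseteq> {..n}"
        using set_alternating[of m' t s] less.prems(2) rn by auto
      have "d = rev e @ rev (alternating m t s)"
        using dd unfolding l' e(3) rev_append .
      moreover have "sim (rev (alternating m t s)) (rev (alternating m s t))"
        using sim_braid[OF less.prems(2) rn(2) \<open>t \<noteq> s\<close>[symmetric] m] sim_sym by blast
      ultimately have "sim (d @ [s]) (rev e @ rev (alternating m s t) @ [s])"
        using sim_append[OF sim_append[OF sim_refl[OF en]] sim_refl[of "[s]"]] less.prems(2) by simp
      also have "sim (rev e @ rev (alternating m s t) @ [s]) (rev e @ rev (alternating m' t s))"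
        using sim_append[OF sim_refl[OF en] sim_cancel[OF an less.prems(2)]] by (simp add: m')
      finally (sim_trans) show False
        using no_short'[of "rev e @ rev (alternating m' t s)"] l' e(2) m' by simp
    qed
    have "\<exists>x y. x \<ge> 0 \<and> y \<ge> 0 \<and>
        act n A (rev (alternating (length d) t s)) (simple_root s) = comb s t x y"
      by (rule dihedral_pos[OF less.prems(2) rn(2) \<open>t \<noteq> s\<close>[symmetric]]) (rule short)
    then obtain x y where xy: "x \<ge> 0" "y \<ge> 0" "act n A d (simple_root s) = comb s t x y"
      unfolding dd[symmetric] by blast
    have "act n A u (simple_root s) = act n A v (comb s t x y)"
      using v(4) xy(3) by (simp add: sim_def)
    also have "\<dots> = (\<lambda>k. x * act n A v (simple_root s) k + y * act n A v (simple_root t) k)"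
      by (rule act_comb)
    finally show ?thesis
      using xy vpos by simp
  qed
qed

text \<open>A nonempty reduced word v' s acting as the identity would give v'(\<alpha>_s) =
  -\<alpha>_s, although v' is not lengthened by removing nothing but s and hence keeps \<alpha>_s
  positive.\<close>

theorem act_faithful:
  assumes u: "set u \<subseteq> {..n}" "act n A u = id"
  shows "word_prod G f u = \<one>"
proof -
  obtain v where v: "sim u v" "length v = len u"
    using len_attained u by blast
  show ?thesis
  proof (cases v rule: rev_cases)
    case Nil
    then show ?thesis
      using v by (simp add: sim_def)
  next
    case (snoc v' s)
    then have n: "set v' \<subseteq> {..n}" "s \<le> n"
      using v by (auto simp: sim_def)
    have "len (v' @ [s]) = length v"
      using len_sim[OF v(1)] v(2) snoc by simp
    moreover have "len v' \<le> length v'"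
      using len_le[OF sim_refl[OF n(1)]] .
    ultimately have "act n A v' (simple_root s) s \<ge> 0"
      by (intro act_pos n) (simp add: snoc)
    moreover have "act n A v' (simple_root s) = (\<lambda>k. - simple_root s k)"
    proof -
      have "act n A v' (root_refl n A s (simple_root s)) = simple_root s"
        using u(2) v(1) snoc by (simp add: sim_def fun_eq_iff)
      then have "act n A v' (\<lambda>k. (-1) * simple_root s k) = simple_root s"
        using root_refl_self[OF n(2)] by simp
      then show ?thesis
        unfolding act_scale by (metis minus_minus mult_minus1)
    qed
    ultimately show ?thesis
      by (simp add: simple_root_def)
  qed
qed

text \<open>This is the homomorphism from the reflection group to \<open>G\<close>, stated on words:
  values in \<open>G\<close> may be compared by comparing actions.\<close>

corollary act_eq_imp_prod_eq:
  assumes "set u \<subseteq> {..n}" "set v \<subseteq> {..n}" "act n A u = act n A v"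
  shows "word_prod G f u = word_prod G f v"
proof -
  have "word_prod G f (u @ rev v) = \<one>" "word_prod G f (rev v @ v) = \<one>"
    using assms act_rev'[OF assms(2)] act_rev[OF assms(2)] by (intro act_faithful; simp)+
  then have *: "word_prod G f u \<otimes> word_prod G f (rev v) = \<one>"
    "word_prod G f (rev v) \<otimes> word_prod G f v = \<one>"
    using prod_append assms by simp_all
  then show ?thesis
    using prod_closed assms
    by (metis inv_equality inv_inv set_rev)
qed

end


section \<open>Groups given by generators and relations\<close>

lemma words_Nil [simp]: "[] \<in> words S"
  and words_Cons [simp]: "x # u \<in> words S \<longleftrightarrow> fst x \<in> S \<and> u \<in> words S"
  and words_append [simp]: "u @ v \<in> words S \<longleftrightarrow> u \<in> words S \<and> v \<in> words S"
  by (cases x; auto simp: words_def)+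

lemma words_fst: "u \<in> words S \<Longrightarrow> x \<in> set u \<Longrightarrow> fst x \<in> S"
  by (auto simp: words_def)

lemma pos_word_in_words [simp]: "pos_word xs \<in> words S \<longleftrightarrow> set xs \<subseteq> S"
  by (induction xs) (auto simp: pos_word_def)

lemma word_cong_in_words: "(u, v) \<in> word_cong S R \<Longrightarrow> u \<in> words S \<and> v \<in> words S"
  by (induction rule: word_cong.induct) auto

lemma equiv_word_cong: "equiv (words S) (word_cong S R)"
proof (rule equivI)
  show "word_cong S R \<subseteq> words S \<times> words S"
    using word_cong_in_words by fast
  show "refl_on (words S) (word_cong S R)"
    by (intro refl_onI) (rule word_cong.refl)
  show "sym (word_cong S R)"
    by (intro symI) (rule word_cong.sym)
  show "trans (word_cong S R)"
    by (intro transI) (rule word_cong.trans)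
qed

lemma word_class_eq_iff:
  "u \<in> words S \<Longrightarrow> v \<in> words S \<Longrightarrow> word_class S R u = word_class S R v \<longleftrightarrow> (u, v) \<in> word_cong S R"
  unfolding word_class_def using eq_equiv_class_iff[OF equiv_word_cong] by blast

lemma word_class_rel:
  "(u, v) \<in> R \<Longrightarrow> u \<in> words S \<Longrightarrow> v \<in> words S \<Longrightarrow> word_class S R u = word_class S R v"
  by (simp add: word_class_eq_iff word_cong.rel)

lemma presented_carrierI [intro]: "u \<in> words S \<Longrightarrow> word_class S R u \<in> carrier (presented_group S R)"
  by (simp add: presented_group_def word_class_def quotientI)

lemma presented_carrierE:
  assumes "C \<in> carrier (presented_group S R)"
  obtains u where "u \<in> words S" "C = word_class S R u"
  using assms by (auto simp: presented_group_def word_class_def elim: quotientE)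

lemma presented_mult:
  assumes "u \<in> words S" "v \<in> words S"
  shows "word_class S R u \<otimes>\<^bsub>presented_group S R\<^esub> word_class S R v = word_class S R (u @ v)"
proof -
  have "word_class S R (u' @ v') = word_class S R (u @ v)"
    if "u' \<in> word_class S R u" "v' \<in> word_class S R v" for u' v'
  proof -
    have "(u @ v, u' @ v') \<in> word_cong S R"
      using that by (auto simp: word_class_def intro: word_cong.app)
    then show ?thesis
      by (metis word_class_eq_iff word_cong_in_words)
  qed
  then have "(\<Union>u'\<in>word_class S R u. \<Union>v'\<in>word_class S R v. word_class S R (u' @ v')) =
      (\<Union>u'\<in>word_class S R u. \<Union>v'\<in>word_class S R v. word_class S R (u @ v))"
    by (intro SUP_cong HOL.refl)
  moreover have "u \<in> word_class S R u" "v \<in> word_class S R v"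
    using assms by (auto simp: word_class_def intro: word_cong.refl)
  ultimately show ?thesis
    by (auto simp: presented_group_def)
qed

lemma presented_one: "\<one>\<^bsub>presented_group S R\<^esub> = word_class S R []"
  by (simp add: presented_group_def)

text \<open>The reversed word with all signs changed is the formal inverse; it cancels from the
  middle outwards.\<close>

lemma word_cong_cancel_rev:
  "u \<in> words S \<Longrightarrow> (map (\<lambda>(x, b). (x, \<not> b)) (rev u) @ u, []) \<in> word_cong S R"
proof (induction u)
  case (Cons x u)
  obtain y b where x: "x = (y, b)"
    by (cases x)
  let ?r = "\<lambda>u. map (\<lambda>(x, b). (x, \<not> b)) (rev u)"
  have y: "y \<in> S" and u: "u \<in> words S"
    using Cons.prems x by auto
  have r: "?r u \<in> words S"
    using u by (auto simp: words_def)
  have "([(y, \<not> b), (y, b)] @ u, [] @ u) \<in> word_cong S R"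
    using word_cong.cancel[OF y, of "\<not> b"] u by (intro word_cong.app word_cong.refl) auto
  then have "(?r u @ [(y, \<not> b), (y, b)] @ u, ?r u @ u) \<in> word_cong S R"
    using r by (auto intro: word_cong.app word_cong.refl)
  then have "(?r u @ [(y, \<not> b), (y, b)] @ u, []) \<in> word_cong S R"
    using Cons.IH[OF u] word_cong.trans by blast
  then show ?case
    by (simp add: x)
qed (simp add: word_cong.refl)

lemma group_presented_group: "group (presented_group S R)"
proof (rule groupI)
  fix C assume "C \<in> carrier (presented_group S R)"
  then obtain u where u: "u \<in> words S" "C = word_class S R u"
    by (rule presented_carrierE)
  let ?v = "map (\<lambda>(x, b). (x, \<not> b)) (rev u)"
  have v: "?v \<in> words S"
    using u(1) by (auto simp: words_def)
  then have "word_class S R ?v \<otimes>\<^bsub>presented_group S R\<^esub> C = \<one>\<^bsub>presented_group S R\<^esub>"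
    using word_cong_cancel_rev[OF u(1), of R] u
    by (simp only: u(2) presented_mult presented_one word_class_eq_iff words_append words_Nil simp_thms)
  then show "\<exists>D\<in>carrier (presented_group S R). D \<otimes>\<^bsub>presented_group S R\<^esub> C = \<one>\<^bsub>presented_group S R\<^esub>"
    using v by blast
qed (auto elim!: presented_carrierE simp: presented_mult presented_one intro!: presented_carrierI)

section \<open>Evaluation of words and the universal property\<close>

definition signed :: "('a, 'b) monoid_scheme \<Rightarrow> ('c \<Rightarrow> 'a) \<Rightarrow> 'c \<times> bool \<Rightarrow> 'a" where
  "signed G f = (\<lambda>(x, b). if b then f x else inv\<^bsub>G\<^esub> f x)"

lemma word_prod_pos_word: "word_prod G (signed G f) (pos_word xs) = word_prod G f xs"
  by (simp add: pos_word_def word_prod_map signed_def)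

lemma (in group) signed_closed: "f \<in> S \<rightarrow> carrier G \<Longrightarrow> fst x \<in> S \<Longrightarrow> signed G f x \<in> carrier G"
  by (cases x) (auto simp: signed_def)

lemma (in group) word_prod_signed_closed:
  "f \<in> S \<rightarrow> carrier G \<Longrightarrow> u \<in> words S \<Longrightarrow> word_prod G (signed G f) u \<in> carrier G"
  by (rule word_prod_closed) (auto intro: signed_closed words_fst)

lemma (in group) word_prod_signed_append:
  "f \<in> S \<rightarrow> carrier G \<Longrightarrow> u \<in> words S \<Longrightarrow> v \<in> words S \<Longrightarrow>
   word_prod G (signed G f) (u @ v) = word_prod G (signed G f) u \<otimes> word_prod G (signed G f) v"
  by (rule word_prod_append) (auto intro: signed_closed words_fst)

text \<open>Von Dyck's theorem on the level of words: the kernel of the evaluation is a congruence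
  that contains the relations and free cancellation.\<close>

lemma (in group) word_prod_signed_cong:
  assumes f: "f \<in> S \<rightarrow> carrier G"
    and R: "\<And>u v. (u, v) \<in> R \<Longrightarrow> u \<in> words S \<Longrightarrow> v \<in> words S \<Longrightarrow>
      word_prod G (signed G f) u = word_prod G (signed G f) v"
    and uv: "(u, v) \<in> word_cong S R"
  shows "word_prod G (signed G f) u = word_prod G (signed G f) v"
  using uv
proof (induction rule: word_cong.induct)
  case (app u u' v v')
  then show ?case
    using word_cong_in_words[OF app.hyps(1)] word_cong_in_words[OF app.hyps(2)]
    by (simp add: word_prod_signed_append[OF f])
next
  case (cancel x b)
  then have "f x \<in> carrier G"
    using f by auto
  then show ?case
    by (simp add: signed_def)
qed (use R in auto)

text \<open>Free cancellation makes the class of an inverse letter the inverse of the class. Facts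
  about products in an abstract group thereby apply to classes of words.\<close>

lemma word_class_conv_word_prod:
  assumes "u \<in> words S"
  shows "word_class S R u =
    word_prod (presented_group S R) (signed (presented_group S R) (\<lambda>x. word_class S R [(x, True)])) u"
  using assms
proof (induction u)
  case (Cons x u)
  interpret P: group "presented_group S R"
    by (rule group_presented_group)
  obtain y b where x: "x = (y, b)"
    by (cases x)
  have y: "y \<in> S" and u: "u \<in> words S"
    using Cons.prems x by auto
  have "word_class S R [(y, False)] \<otimes>\<^bsub>presented_group S R\<^esub> word_class S R [(y, True)] =
      \<one>\<^bsub>presented_group S R\<^esub>"
    using word_cong.cancel[OF y, of False R] y
    by (simp add: presented_mult presented_one word_class_eq_iff)
  then have "inv\<^bsub>presented_group S R\<^esub> word_class S R [(y, True)] = word_class S R [(y, False)]"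
    using y by (intro P.inv_equality) auto
  then have "signed (presented_group S R) (\<lambda>x. word_class S R [(x, True)]) x = word_class S R [x]"
    by (cases b) (simp_all add: x signed_def)
  then show ?case
    using Cons.IH[OF u] presented_mult[of "[x]" S u R] y u by (simp add: x)
qed (simp add: presented_one)

lemma word_class_pos_word:
  assumes "set xs \<subseteq> S"
  shows "word_class S R (pos_word xs) = word_prod (presented_group S R) (\<lambda>x. word_class S R [(x, True)]) xs"
  using word_class_conv_word_prod[of "pos_word xs" S R] assms by (simp add: word_prod_pos_word)

text \<open>The representative chosen below is irrelevant when the relations hold in \<open>G\<close>.\<close>

definition presented_map ::
    "('a, 'b) monoid_scheme \<Rightarrow> ('c \<Rightarrow> 'a) \<Rightarrow> 'c word set \<Rightarrow> 'a" where
  "presented_map G f C = word_prod G (signed G f) (SOME u. u \<in> C)"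

lemma (in group) presented_map_word_class:
  assumes f: "f \<in> S \<rightarrow> carrier G"
    and R: "\<And>u v. (u, v) \<in> R \<Longrightarrow> u \<in> words S \<Longrightarrow> v \<in> words S \<Longrightarrow>
      word_prod G (signed G f) u = word_prod G (signed G f) v"
    and u: "u \<in> words S"
  shows "presented_map G f (word_class S R u) = word_prod G (signed G f) u"
proof -
  have "u \<in> word_class S R u"
    using u by (simp add: word_class_def word_cong.refl)
  then have "(SOME v. v \<in> word_class S R u) \<in> word_class S R u"
    by (rule someI)
  then have "(u, SOME v. v \<in> word_class S R u) \<in> word_cong S R"
    by (simp add: word_class_def)
  then show ?thesis
    unfolding presented_map_def by (intro word_prod_signed_cong[OF f R, symmetric])
qed

lemma (in group) presented_map_hom:
  assumes f: "f \<in> S \<rightarrow> carrier G"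
    and R: "\<And>u v. (u, v) \<in> R \<Longrightarrow> u \<in> words S \<Longrightarrow> v \<in> words S \<Longrightarrow>
      word_prod G (signed G f) u = word_prod G (signed G f) v"
  shows "presented_map G f \<in> hom (presented_group S R) G"
  by (rule homI) (auto elim!: presented_carrierE simp: presented_map_word_class[OF f R] presented_mult
      word_prod_signed_append[OF f] word_prod_signed_closed[OF f])

text \<open>Surjectivity and triviality of the kernel are required for words only, so no choice of
  representatives appears when the lemma is applied.\<close>

lemma (in group) presented_map_iso:
  assumes f: "f \<in> S \<rightarrow> carrier G"
    and R: "\<And>u v. (u, v) \<in> R \<Longrightarrow> u \<in> words S \<Longrightarrow> v \<in> words S \<Longrightarrow>
      word_prod G (signed G f) u = word_prod G (signed G f) v"
    and surj: "\<And>x. x \<in> carrier G \<Longrightarrow> \<exists>u\<in>words S. word_prod G (signed G f) u = x"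
    and inj: "\<And>u. u \<in> words S \<Longrightarrow> word_prod G (signed G f) u = \<one> \<Longrightarrow> (u, []) \<in> word_cong S R"
  shows "presented_map G f \<in> iso (presented_group S R) G"
proof -
  interpret P: group "presented_group S R"
    by (rule group_presented_group)
  note map = presented_map_word_class[OF f R]
  have hom: "presented_map G f \<in> hom (presented_group S R) G"
    by (rule presented_map_hom[OF f R])
  have "inj_on (presented_map G f) (carrier (presented_group S R))"
    unfolding inj_on_one_iff'[OF hom P.is_group is_group]
  proof (intro allI impI)
    fix C assume "C \<in> carrier (presented_group S R)" and 1: "presented_map G f C = \<one>"
    then obtain u where "u \<in> words S" "C = word_class S R u"
      by (elim presented_carrierE)
    then show "C = \<one>\<^bsub>presented_group S R\<^esub>"
      using inj[of u] 1 by (simp add: map presented_one word_class_eq_iff)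
  qed
  moreover have "carrier G \<subseteq> presented_map G f ` carrier (presented_group S R)"
  proof
    fix x assume "x \<in> carrier G"
    then obtain u where "u \<in> words S" "word_prod G (signed G f) u = x"
      using surj by blast
    then show "x \<in> presented_map G f ` carrier (presented_group S R)"
      using map by (intro image_eqI[of _ _ "word_class S R u"]) auto
  qed
  moreover have "presented_map G f ` carrier (presented_group S R) \<subseteq> carrier G"
    using hom by (auto simp: hom_def)
  ultimately show ?thesis
    using hom by (auto simp: iso_def bij_betw_def)
qed


section \<open>The double affine Weyl group\<close>

text \<open>The natural action of \<tau>_\<beta> w by affine maps. It is faithful on the double
  affine Weyl group, so the relations between the images of the generators can be checked as
  identities between affine reflections.\<close>

definition aff :: "vect \<times> (vect \<Rightarrow> vect) \<Rightarrow> vect \<Rightarrow> vect" where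
  "aff p x = (\<lambda>k. fst p k + snd p x k)"

text \<open>
  Here \<open>\<eta> = \<theta> / a\<^sub>0\<close>, the \<open>e\<^sub>j\<close> are the inverses of the \<open>d\<^sub>j\<close>, and \<open>w\<close> is a word for \<open>s\<^sub>\<theta>\<close>.
  The assumption \<open>generation\<close> is the only one that fails for the excluded types.
\<close>

locale double_affine = cartan n A for n A +
  fixes X :: kac_type and \<eta> :: vect and e :: "nat \<Rightarrow> real" and w :: "nat list"
  assumes simple_reflection: "j \<le> n \<Longrightarrow> simple_reflection n A j = root_refl n A j"
    and s_theta: "s_theta n A x = (\<lambda>k. x k + matrix_apply n A x 0 * \<eta> k)"
    and scaled_delta: "scaled_delta n A = (\<lambda>k. \<eta> k + simple_root 0 k)"
    and null: "i \<le> n \<Longrightarrow> matrix_apply n A (scaled_delta n A) i = 0"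
    and sym: "i \<le> n \<Longrightarrow> j \<le> n \<Longrightarrow> e i * of_int (A i j) = e j * of_int (A j i)"
    and e0: "e 0 \<noteq> 0"
    and eta: "\<eta> \<in> finite_lattice X n"
    and lattice_int: "x \<in> finite_lattice X n \<Longrightarrow> i \<le> n \<Longrightarrow> matrix_apply n A x i \<in> \<int>"
    and generation: "\<lbrakk>\<eta> \<in> M; \<And>x y. x \<in> M \<Longrightarrow> y \<in> M \<Longrightarrow> (\<lambda>k. x k - y k) \<in> M;
       \<And>i. i \<in> {1..n} \<Longrightarrow> laces A 0 i \<in> {1, 2} \<Longrightarrow> root_refl n A i \<eta> \<in> M;
       \<And>i x. i \<in> {1..n} \<Longrightarrow> laces A 0 i = 0 \<Longrightarrow> x \<in> M \<Longrightarrow> root_refl n A i x \<in> M\<rbrakk>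
       \<Longrightarrow> finite_lattice X n \<subseteq> M"
    and theta_word: "theta_word n A w"
begin

section \<open>The lattices and the group law\<close>

abbreviation "\<delta> \<equiv> scaled_delta n A"
abbreviation "L \<equiv> finite_lattice X n"
abbreviation "W \<equiv> double_affine_weyl X n A"
abbreviation "Mat \<equiv> matrix_apply n A"

lemma w_set: "set w \<subseteq> {1..n}" "set w \<subseteq> {..n}"
  using theta_word by (auto simp: theta_word_def)

lemma act_w: "act n A w x = (\<lambda>k. x k + Mat x 0 * \<eta> k)"
proof -
  have "foldr (\<lambda>i f. simple_reflection n A i \<circ> f) w id = act n A w"
    unfolding act_def using w_set(2) by (intro foldr_cong) (auto simp: simple_reflection)
  then show ?thesis
    using theta_word s_theta by (simp add: theta_word_def)
qed

lemma Mat_eta: "i \<le> n \<Longrightarrow> Mat \<eta> i = - of_int (A i 0)"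
  using null[of i] matrix_apply_simple_root[of 0 n A i]
  by (simp add: scaled_delta matrix_apply_add)

lemma root_refl_delta: "i \<le> n \<Longrightarrow> root_refl n A i \<delta> = \<delta>"
  by (simp add: root_refl_eq null)

lemma act_delta: "set u \<subseteq> {..n} \<Longrightarrow> act n A u \<delta> = \<delta>"
  by (induction u) (auto simp: root_refl_delta)

lemma lattice_zero: "(\<lambda>k. 0) \<in> L"
  by (auto simp: finite_lattice_def)

lemma lattice_comb:
  assumes "x \<in> L" "y \<in> L" "s \<in> \<int>" "t \<in> \<int>"
  shows "(\<lambda>k. s * x k + t * y k) \<in> L"
proof -
  have "2 * (s * a) + 2 * (t * b) \<in> \<int>" if "2 * a \<in> \<int>" "2 * b \<in> \<int>" for a b :: real
    unfolding mult.left_commute[of 2]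
    by (rule Ints_add[OF Ints_mult[OF assms(3) that(1)] Ints_mult[OF assms(4) that(2)]])
  then show ?thesis
    using assms unfolding finite_lattice_def by (auto simp: distrib_left)
qed

lemma lattice_add: "x \<in> L \<Longrightarrow> y \<in> L \<Longrightarrow> (\<lambda>k. x k + y k) \<in> L"
  and lattice_diff: "x \<in> L \<Longrightarrow> y \<in> L \<Longrightarrow> (\<lambda>k. x k - y k) \<in> L"
  using lattice_comb[of x y 1 1] lattice_comb[of x y 1 "-1"] by auto

lemma simple_root_lattice: "i \<in> {1..n} \<Longrightarrow> simple_root i \<in> L"
  by (auto simp: finite_lattice_def simple_root_def)

lemma lattice_0: "x \<in> L \<Longrightarrow> x 0 = 0"
  by (simp add: finite_lattice_def)

lemma root_refl_lattice: "i \<in> {1..n} \<Longrightarrow> x \<in> L \<Longrightarrow> root_refl n A i x \<in> L"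
  using lattice_comb[of x "simple_root i" 1 "- Mat x i"] lattice_int[of x i] simple_root_lattice[of i]
  by (simp add: root_refl_eq)

lemma act_lattice: "set u \<subseteq> {1..n} \<Longrightarrow> x \<in> L \<Longrightarrow> act n A u x \<in> L"
  by (induction u) (auto simp: root_refl_lattice)

lemma Q_lattice_iff: "x \<in> Q_lattice X n A \<longleftrightarrow> (\<exists>y\<in>L. \<exists>m::int. x = (\<lambda>k. y k + of_int m * \<delta> k))"
  by (auto simp: Q_lattice_def)

lemma lattice_subset_Q: "x \<in> L \<Longrightarrow> x \<in> Q_lattice X n A"
  unfolding Q_lattice_iff by (intro bexI[of _ x] exI[of _ 0]) auto

lemma Q_lattice_comb:
  assumes "x \<in> Q_lattice X n A" "y \<in> Q_lattice X n A" "s \<in> \<int>" "t \<in> \<int>"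
  shows "(\<lambda>k. s * x k + t * y k) \<in> Q_lattice X n A"
proof -
  obtain x' m y' m' where "x' \<in> L" "y' \<in> L" "x = (\<lambda>k. x' k + of_int m * \<delta> k)"
      "y = (\<lambda>k. y' k + of_int m' * \<delta> k)"
    using assms(1,2) Q_lattice_iff by metis
  moreover obtain s' t' where "s = of_int s'" "t = of_int t'"
    using assms(3,4) by (auto elim!: Ints_cases)
  ultimately show ?thesis
    unfolding Q_lattice_iff
    by (intro bexI[of _ "\<lambda>k. s * x' k + t * y' k"] exI[of _ "s' * m + t' * m'"])
      (use assms lattice_comb in \<open>auto simp: algebra_simps\<close>)
qed

lemma delta_Q: "\<delta> \<in> Q_lattice X n A"
  unfolding Q_lattice_iff using lattice_zero by (intro bexI[of _ "\<lambda>k. 0"] exI[of _ 1]) auto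

text \<open>Only s_0 needs an argument. As \<alpha>_0 = \<delta> - \<eta> for the scaled \<delta>,
  subtracting an integral multiple of \<alpha>_0 amounts to adding that multiple of \<eta> and
  subtracting it of \<delta>.\<close>

lemma root_refl_Q:
  assumes "i \<le> n" "x \<in> Q_lattice X n A"
  shows "root_refl n A i x \<in> Q_lattice X n A"
proof -
  obtain y m where y: "y \<in> L" "x = (\<lambda>k. y k + of_int m * \<delta> k)"
    using assms Q_lattice_iff by metis
  have "root_refl n A i y \<in> Q_lattice X n A"
  proof (cases "i = 0")
    case True
    have "(\<lambda>k. y k + Mat y 0 * \<eta> k) \<in> L"
      using lattice_comb[OF y(1) eta, of 1 "Mat y 0"] lattice_int y(1) by simp
    moreover have "- Mat y 0 \<in> \<int>"
      using lattice_int y(1) by simp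
    moreover have "root_refl n A i y = (\<lambda>k. 1 * (y k + Mat y 0 * \<eta> k) + (- Mat y 0) * \<delta> k)"
      using True by (auto simp: root_refl_eq scaled_delta algebra_simps)
    ultimately show ?thesis
      by (simp only: Q_lattice_comb lattice_subset_Q delta_Q Ints_1)
  next
    case False
    then show ?thesis
      using root_refl_lattice[of i y] assms y(1) lattice_subset_Q by simp
  qed
  moreover have "root_refl n A i x = (\<lambda>k. 1 * root_refl n A i y k + of_int m * \<delta> k)"
    using root_refl_comb[of n A i 1 y "of_int m" \<delta>] root_refl_delta[OF assms(1)] y(2) by simp
  ultimately show ?thesis
    using delta_Q by (simp only: Q_lattice_comb Ints_1 Ints_of_int)
qed

lemma act_Q: "set u \<subseteq> {..n} \<Longrightarrow> x \<in> Q_lattice X n A \<Longrightarrow> act n A u x \<in> Q_lattice X n A"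
  by (induction u) (auto simp: root_refl_Q)

text \<open>The generating reflections are involutions, so products without inverses suffice and
  elements can be handled as words.\<close>

lemma affine_weyl_iff: "v \<in> affine_weyl n A \<longleftrightarrow> (\<exists>u. set u \<subseteq> {..n} \<and> v = act n A u)"
proof -
  interpret B: group "BijGroup (UNIV :: vect set)"
    by (rule group_BijGroup)
  have bij: "root_refl n A i \<in> Bij UNIV" if "i \<le> n" for i
    unfolding Bij_def using that root_refl_root_refl by (auto intro!: bij_betwI[of _ _ _ "root_refl n A i"])
  have act_bij: "act n A u \<in> Bij UNIV" if "set u \<subseteq> {..n}" for u
    unfolding Bij_def using that act_rev[OF that] act_rev'[OF that]
    by (auto intro!: o_bij[of "act n A (rev u)"])
  have mult: "f \<otimes>\<^bsub>BijGroup UNIV\<^esub> g = f \<circ> g"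
    if "f \<in> Bij UNIV" "g \<in> Bij UNIV" for f g :: "vect \<Rightarrow> vect"
    using that by (simp add: BijGroup_def compose_def comp_def restrict_def)
  have bij_one: "\<one>\<^bsub>BijGroup UNIV\<^esub> = (id :: vect \<Rightarrow> vect)"
    by (simp add: BijGroup_def id_def restrict_def)
  have inv: "inv\<^bsub>BijGroup UNIV\<^esub> root_refl n A i = root_refl n A i" if "i \<le> n" for i
  proof (rule B.inv_equality)
    show "root_refl n A i \<otimes>\<^bsub>BijGroup UNIV\<^esub> root_refl n A i = \<one>\<^bsub>BijGroup UNIV\<^esub>"
      unfolding mult[OF bij bij, OF that that] bij_one by (auto simp: root_refl_root_refl[OF that])
  qed (use bij[OF that] in \<open>simp_all add: BijGroup_def\<close>)
  have gens: "simple_reflection n A ` {..n} = root_refl n A ` {..n}"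
    by (auto simp: simple_reflection)
  have "\<exists>u. set u \<subseteq> {..n} \<and> v = act n A u" if "v \<in> affine_weyl n A"
    using that unfolding affine_weyl_def gens
  proof (induction rule: generate.induct)
    case one
    then show ?case
      unfolding bij_one by (intro exI[of _ "[]"]) simp
  next
    case (incl h)
    then obtain i where "i \<le> n" "h = root_refl n A i"
      by auto
    then show ?case
      by (intro exI[of _ "[i]"]) simp
  next
    case (inv h)
    then obtain i where "i \<le> n" "h = root_refl n A i"
      by auto
    then show ?case
      using \<open>\<And>i. i \<le> n \<Longrightarrow> inv\<^bsub>BijGroup UNIV\<^esub> root_refl n A i = root_refl n A i\<close>
      by (intro exI[of _ "[i]"]) simp
  next
    case (eng h1 h2)
    then obtain u1 u2 where "set u1 \<subseteq> {..n}" "h1 = act n A u1" "set u2 \<subseteq> {..n}" "h2 = act n A u2"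
      by blast
    then show ?case
      using mult act_bij by (intro exI[of _ "u1 @ u2"]) simp
  qed
  moreover have "act n A u \<in> affine_weyl n A" if "set u \<subseteq> {..n}" for u
    using that unfolding affine_weyl_def gens
  proof (induction u)
    case Nil
    show ?case
      using generate.one[of "BijGroup UNIV" "root_refl n A ` {..n}"] unfolding bij_one act_Nil .
  next
    case (Cons i u)
    then have "root_refl n A i \<otimes>\<^bsub>BijGroup UNIV\<^esub> act n A u \<in>
        generate (BijGroup UNIV) (root_refl n A ` {..n})"
      by (intro generate.eng) (auto intro: generate.incl)
    then show ?case
      using Cons.prems by (simp add: mult[OF bij act_bij] comp_def)
  qed
  ultimately show ?thesis
    by blast
qed

lemma affine_weylE:
  assumes "v \<in> affine_weyl n A"
  obtains u where "set u \<subseteq> {..n}" "v = act n A u"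
  using assms affine_weyl_iff by blast

lemma act_in_affine_weyl: "set u \<subseteq> {..n} \<Longrightarrow> act n A u \<in> affine_weyl n A"
  using affine_weyl_iff by blast

lemma W_carrier: "carrier W = Q_lattice X n A \<times> affine_weyl n A"
  by (simp add: double_affine_weyl_def)

lemma W_mult: "(\<beta>, u) \<otimes>\<^bsub>W\<^esub> (\<gamma>, v) = (\<lambda>k. \<beta> k + u \<gamma> k, u \<circ> v)"
  by (simp add: double_affine_weyl_def)

lemma W_one: "\<one>\<^bsub>W\<^esub> = (\<lambda>k. 0, id)"
  by (simp add: double_affine_weyl_def)

lemma W_carrierE:
  assumes "p \<in> carrier W"
  obtains \<beta> u where "\<beta> \<in> Q_lattice X n A" "set u \<subseteq> {..n}" "p = (\<beta>, act n A u)"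
  using assms by (auto simp: W_carrier elim!: affine_weylE)

lemma W_carrierI: "\<beta> \<in> Q_lattice X n A \<Longrightarrow> set u \<subseteq> {..n} \<Longrightarrow> (\<beta>, act n A u) \<in> carrier W"
  by (simp add: W_carrier act_in_affine_weyl)

lemma Q_zero: "(\<lambda>k. 0) \<in> Q_lattice X n A"
  by (simp add: lattice_subset_Q lattice_zero)

lemma W_mult_act:
  "(\<beta>, act n A u) \<otimes>\<^bsub>W\<^esub> (\<gamma>, act n A v) = (\<lambda>k. \<beta> k + act n A u \<gamma> k, act n A (u @ v))"
  by (simp add: W_mult)

lemma group_W: "group W"
proof (rule groupI)
  fix p q assume "p \<in> carrier W" "q \<in> carrier W"
  then obtain \<beta> u \<gamma> v where "\<beta> \<in> Q_lattice X n A" "set u \<subseteq> {..n}" "p = (\<beta>, act n A u)"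
      "\<gamma> \<in> Q_lattice X n A" "set v \<subseteq> {..n}" "q = (\<gamma>, act n A v)"
    by (auto elim!: W_carrierE)
  moreover from this have "(\<lambda>k. \<beta> k + act n A u \<gamma> k) \<in> Q_lattice X n A"
    using Q_lattice_comb[of \<beta> "act n A u \<gamma>" 1 1] act_Q by simp
  ultimately show "p \<otimes>\<^bsub>W\<^esub> q \<in> carrier W"
    by (simp only: W_mult_act) (intro W_carrierI, auto)
next
  show "\<one>\<^bsub>W\<^esub> \<in> carrier W"
    using W_carrierI[OF Q_zero, of "[]"] by (simp add: W_one)
next
  fix p q r assume "p \<in> carrier W" "q \<in> carrier W" "r \<in> carrier W"
  then show "p \<otimes>\<^bsub>W\<^esub> q \<otimes>\<^bsub>W\<^esub> r = p \<otimes>\<^bsub>W\<^esub> (q \<otimes>\<^bsub>W\<^esub> r)"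
    by (elim W_carrierE) (simp add: W_mult act_add comp_assoc add.assoc)
next
  fix p assume "p \<in> carrier W"
  then show "\<one>\<^bsub>W\<^esub> \<otimes>\<^bsub>W\<^esub> p = p"
    by (elim W_carrierE) (simp add: W_mult W_one)
next
  fix p assume "p \<in> carrier W"
  then obtain \<beta> u where p: "\<beta> \<in> Q_lattice X n A" "set u \<subseteq> {..n}" "p = (\<beta>, act n A u)"
    by (rule W_carrierE)
  \<comment> \<open>The inverse of \<tau>_\<beta> u is u^-1 \<tau>_{-\<beta>}, which is written with
    the translation in front.\<close>
  let ?q = "(\<lambda>k. (- 1) * act n A (rev u) \<beta> k, act n A (rev u))"
  have "(\<lambda>k. (- 1) * act n A (rev u) \<beta> k) \<in> Q_lattice X n A"
    using Q_lattice_comb[of "act n A (rev u) \<beta>" "\<lambda>k. 0" "-1" 0] act_Q p Q_zero by simp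
  then have "?q \<in> carrier W"
    using p by (intro W_carrierI) auto
  moreover have "?q \<otimes>\<^bsub>W\<^esub> p = \<one>\<^bsub>W\<^esub>"
    using p by (simp add: W_mult W_one act_rev)
  ultimately show "\<exists>q\<in>carrier W. q \<otimes>\<^bsub>W\<^esub> p = \<one>\<^bsub>W\<^esub>"
    by blast
qed

sublocale W: group W
  by (rule group_W)

lemma tau_eq_act: "tau \<beta> = (\<beta>, act n A [])"
  by (simp add: tau_def)

lemma tau_closed: "\<beta> \<in> Q_lattice X n A \<Longrightarrow> tau \<beta> \<in> carrier W"
  unfolding tau_eq_act by (rule W_carrierI) auto

lemma tau_mult: "tau \<beta> \<otimes>\<^bsub>W\<^esub> tau \<gamma> = tau (\<lambda>k. \<beta> k + \<gamma> k)"
  by (simp add: tau_def W_mult)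

lemma tau_zero: "tau (\<lambda>k. 0) = \<one>\<^bsub>W\<^esub>"
  by (simp add: tau_def W_one)

lemma tau_inv: "\<beta> \<in> Q_lattice X n A \<Longrightarrow> inv\<^bsub>W\<^esub> tau \<beta> = tau (\<lambda>k. - \<beta> k)"
  using Q_lattice_comb[of \<beta> "\<lambda>k. 0" "-1" 0] Q_zero
  by (intro W.inv_equality) (auto simp: tau_mult tau_zero tau_closed)

lemma tau_delta_central: "p \<in> carrier W \<Longrightarrow> p \<otimes>\<^bsub>W\<^esub> tau \<delta> = tau \<delta> \<otimes>\<^bsub>W\<^esub> p"
  by (elim W_carrierE) (simp add: tau_def W_mult act_delta add.commute)

lemma tau_delta_pow: "tau \<delta> [^]\<^bsub>W\<^esub> (m :: int) = tau (\<lambda>k. of_int m * \<delta> k)"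
proof (induction m rule: int_induct[of _ 0])
  case base
  then show ?case by (simp add: tau_zero)
next
  case (step1 i)
  then show ?case
    using tau_closed[OF delta_Q] W.int_pow_mult[of "tau \<delta>" i 1]
    by (simp add: tau_mult distrib_right)
next
  case (step2 i)
  then show ?case
    using tau_closed[OF delta_Q] W.int_pow_diff[of "tau \<delta>" i 1] tau_inv[OF delta_Q]
    by (simp add: tau_mult left_diff_distrib)
qed

lemma aff_mult: "p \<in> carrier W \<Longrightarrow> q \<in> carrier W \<Longrightarrow> aff (p \<otimes>\<^bsub>W\<^esub> q) = aff p \<circ> aff q"
  by (elim W_carrierE) (auto simp: fun_eq_iff aff_def W_mult act_add add.assoc)

lemma aff_one: "aff \<one>\<^bsub>W\<^esub> = id"
  by (auto simp: aff_def W_one)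

text \<open>The linear part fixes 0, so the value at 0 is the translation part.\<close>

lemma aff_inj:
  assumes "p \<in> carrier W" "q \<in> carrier W" "aff p = aff q"
  shows "p = q"
proof -
  have "snd r (\<lambda>k. 0) = (\<lambda>k. 0)" if "r \<in> carrier W" for r
    using that by (elim W_carrierE) simp
  then have "fst p = fst q"
    using fun_cong[OF assms(3), of "\<lambda>k. 0"] assms(1,2) by (simp add: aff_def)
  moreover from this have "snd p x k = snd q x k" for x k
    using fun_cong[OF fun_cong[OF assms(3), of x], of k] by (simp add: aff_def)
  ultimately show ?thesis
    by (simp add: prod_eq_iff fun_eq_iff)
qed

lemma aff_word_prod:
  "(\<And>x. x \<in> set xs \<Longrightarrow> f x \<in> carrier W) \<Longrightarrow>
   aff (word_prod W f xs) = foldr (\<circ>) (map (\<lambda>x. aff (f x)) xs) id"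
  by (induction xs) (simp_all add: aff_one aff_mult)


subsection \<open>The images of the generators\<close>

text \<open>Root and constant of the affine reflection v -> v - (pairing + offset) root that
  represents a generator. All three affine generators use the pairing with the coroot of node 0;
  only root and constant differ.\<close>

fun gen_root :: "generator \<Rightarrow> vect" where
  "gen_root (Node i) = simple_root i"
| "gen_root (Affine k) = (if k = 3 then (\<lambda>j. - \<eta> j) else simple_root 0)"

fun gen_offset :: "generator \<Rightarrow> real" where
  "gen_offset (Node i) = 0"
| "gen_offset (Affine k) = (if k = 1 then 0 else 1)"

text \<open>In the usual notation: \<open>s\<^sub>0\<^sub>1\<close> goes to s_0,
  \<open>s\<^sub>0\<^sub>2\<close> to \<tau>_{-\<alpha>_0} s_0 and \<open>s\<^sub>0\<^sub>3\<close>
  to \<tau>_\<eta> s_\<theta>.\<close>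

fun gen_img :: "generator \<Rightarrow> vect \<times> (vect \<Rightarrow> vect)" where
  "gen_img (Node i) = (\<lambda>k. 0, act n A [i])"
| "gen_img (Affine k) =
    (if k = 1 then (\<lambda>j. 0, act n A [0])
     else if k = 3 then (\<eta>, act n A w) else (\<lambda>j. - simple_root 0 j, act n A [0]))"

lemma node_le: "x \<in> generators n \<Longrightarrow> node x \<le> n"
  by (auto simp: generators_def)

lemma simple_root_0_Q: "(\<lambda>j. - simple_root 0 j) \<in> Q_lattice X n A"
proof -
  have "(\<lambda>j. - simple_root 0 j) = (\<lambda>j. 1 * \<eta> j + (- 1) * \<delta> j)"
    by (auto simp: scaled_delta)
  then show ?thesis
    using Q_lattice_comb[OF lattice_subset_Q[OF eta] delta_Q, of 1 "-1"] by simp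
qed

lemma gen_img_closed: "x \<in> generators n \<Longrightarrow> gen_img x \<in> carrier W"
  unfolding generators_def
  by (auto intro!: W_carrierI Q_zero simple_root_0_Q lattice_subset_Q eta w_set(2)
      simp del: act_Cons)

lemma gen_img_Pi: "gen_img \<in> generators n \<rightarrow> carrier W"
  using gen_img_closed by auto

lemma aff_gen_img:
  "x \<in> generators n \<Longrightarrow>
   aff (gen_img x) = aff_refl (\<lambda>v. Mat v (node x) + gen_offset x) (gen_root x)"
  by (auto simp: generators_def aff_def aff_refl_def fun_eq_iff root_refl_eq act_w algebra_simps)

text \<open>Since -\<eta> = \<alpha>_0 - \<delta> and \<delta> is a null vector, -\<eta> has the
  pairings of \<alpha>_0. Every relation thus becomes the one for a pair of simple roots.\<close>

lemma Mat_gen_root: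
  assumes "x \<in> generators n" "i \<le> n"
  shows "Mat (gen_root x) i = of_int (A i (node x))"
proof -
  have "Mat (\<lambda>j. - \<eta> j) i = of_int (A i 0)"
    using matrix_apply_scale[of n A "-1" \<eta> i] Mat_eta[OF assms(2)] by simp
  then show ?thesis
    using assms by (auto simp: generators_def matrix_apply_simple_root)
qed

lemma gen_img_square:
  assumes "x \<in> generators n"
  shows "gen_img x \<otimes>\<^bsub>W\<^esub> gen_img x = \<one>\<^bsub>W\<^esub>"
proof (rule aff_inj)
  have "aff (gen_img x) (aff (gen_img x) v) = v" for v
    unfolding aff_gen_img[OF assms]
    using assms node_le[OF assms] diag
    by (intro aff_refl_involution) (simp add: matrix_apply_add matrix_apply_scale Mat_gen_root)
  then show "aff (gen_img x \<otimes>\<^bsub>W\<^esub> gen_img x) = aff \<one>\<^bsub>W\<^esub>"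
    by (auto simp: aff_mult gen_img_closed assms aff_one)
qed (use assms gen_img_closed in auto)

lemma gen_img_braid:
  assumes xy: "x \<in> generators n" "y \<in> generators n" "node x \<noteq> node y"
    and m: "(laces A (node x) (node y), m) \<in> {(0, 2), (1, 3), (2, 4), (3, 6)}"
  shows "word_prod W gen_img (alternating m x y) = word_prod W gen_img (alternating m y x)"
proof (rule aff_inj)
  have in_gens: "set (alternating m x y) \<subseteq> generators n" "set (alternating m y x) \<subseteq> generators n"
    using set_alternating[of m x y] set_alternating[of m y x] xy by auto
  then show "word_prod W gen_img (alternating m x y) \<in> carrier W"
    "word_prod W gen_img (alternating m y x) \<in> carrier W"
    by (auto intro!: W.word_prod_closed gen_img_closed)
  have "real_of_int (A (node x) (node y)) * real_of_int (A (node y) (node x)) =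
      of_int (laces A (node x) (node y))"
    by (simp add: laces_def)
  then have m': "(real_of_int (A (node x) (node y)) * real_of_int (A (node y) (node x)), m) \<in>
      {(0, 2), (1, 3), (2, 4), (3, 6)}"
    using m by auto
  have "foldr (\<circ>) (alternating m (aff (gen_img x)) (aff (gen_img y))) id =
      foldr (\<circ>) (alternating m (aff (gen_img y)) (aff (gen_img x))) id"
    unfolding aff_gen_img[OF xy(1)] aff_gen_img[OF xy(2)]
    by (rule aff_refl_braid[OF _ _ m'])
      (use xy node_le diag zero_iff in
        \<open>simp_all add: matrix_apply_add matrix_apply_scale Mat_gen_root\<close>)
  then show "aff (word_prod W gen_img (alternating m x y)) = aff (word_prod W gen_img (alternating m y x))"
    using in_gens gen_img_closed by (subst (1 2) aff_word_prod) (auto simp: map_alternating)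
qed

text \<open>Relation b) expresses an orthogonality: for two laces s_i(\<alpha>_0) pairs to 2 - 2 = 0
  with the coroot of node 0. Only the pairings of the roots a and b occur, so the same lemma covers
  \<alpha>_0 and -\<eta>, with any constants.\<close>

lemma aff_refl_conj_commute:
  assumes i: "i \<in> {1..n}" "laces A 0 i = 2"
    and a: "Mat a 0 = 2" "Mat a i = of_int (A i 0)" and b: "Mat b 0 = 2" "Mat b i = of_int (A i 0)"
    and F: "F = (\<lambda>v. Mat v 0 + c)" and G: "G = (\<lambda>v. Mat v 0 + c')"
  shows "aff_refl F a \<circ> (root_refl n A i \<circ> aff_refl G b \<circ> root_refl n A i) =
         (root_refl n A i \<circ> aff_refl G b \<circ> root_refl n A i) \<circ> aff_refl F a"
proof -
  have i': "i \<le> n"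
    using i by simp
  define b' where "b' = root_refl n A i b"
  define G' where "G' v = G (root_refl n A i v)" for v
  \<comment> \<open>A conjugate of an affine reflection is the affine reflection in the transported
    root and functional.\<close>
  have conj: "root_refl n A i \<circ> aff_refl G b \<circ> root_refl n A i = aff_refl G' b'"
  proof
    fix v
    have "root_refl n A i (\<lambda>k. root_refl n A i v k + (- G (root_refl n A i v)) * b k) =
        (\<lambda>k. v k + (- G (root_refl n A i v)) * b' k)"
      using root_refl_comb[of n A i 1 "root_refl n A i v" "- G (root_refl n A i v)" b]
      by (simp add: root_refl_root_refl[OF i'] b'_def)
    then show "(root_refl n A i \<circ> aff_refl G b \<circ> root_refl n A i) v = aff_refl G' b' v"
      by (simp add: aff_refl_def G'_def)
  qed
  have two: "of_int (A i 0) * of_int (A 0 i) = (2 :: real)"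
    using i(2) unfolding laces_def by (metis mult.commute of_int_mult of_int_numeral)
  have Mat_refl: "Mat (root_refl n A i v) 0 = Mat v 0 - Mat v i * of_int (A 0 i)" for v
    using matrix_apply_comb[of n A 1 v "- Mat v i" "simple_root i" 0] i'
    by (simp add: root_refl_eq matrix_apply_simple_root)
  \<comment> \<open>Commutation is the braid relation of length two, with both mixed pairings
    zero.\<close>
  have "foldr (\<circ>) (alternating 2 (aff_refl F a) (aff_refl G' b')) id =
      foldr (\<circ>) (alternating 2 (aff_refl G' b') (aff_refl F a)) id"
  proof (rule aff_refl_braid[where p = 0 and q = 0])
    fix v s t
    have "Mat b' 0 = 0"
      using b two by (simp add: b'_def Mat_refl)
    then show "F (\<lambda>k. v k + s * a k + t * b' k) = F v + 2 * s + 0 * t"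
      using a by (simp add: F matrix_apply_add matrix_apply_scale)
    have "Mat (root_refl n A i a) 0 = 0"
      using a two by (simp add: Mat_refl)
    moreover have "Mat (root_refl n A i b') 0 = 2"
      using b by (simp add: b'_def root_refl_root_refl[OF i'])
    ultimately show "G' (\<lambda>k. v k + s * a k + t * b' k) = G' v + 0 * s + 2 * t"
      using root_refl_comb[of n A i 1 "\<lambda>k. v k + s * a k" t b'] root_refl_comb[of n A i 1 v s a]
      by (simp add: G'_def G matrix_apply_add matrix_apply_scale)
  qed auto
  then show ?thesis
    unfolding conj by (simp add: numeral_eq_Suc)
qed

lemma gen_img_double_lace:
  assumes i: "i \<in> {1..n}" "laces A 0 i = 2"
  shows "word_prod W gen_img [Affine 1, Node i, Affine 3, Node i] =
         word_prod W gen_img [Node i, Affine 3, Node i, Affine 1]"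
proof (rule aff_inj)
  have g: "Affine 1 \<in> generators n" "Affine 3 \<in> generators n" "Node i \<in> generators n"
    using i by (auto simp: generators_def)
  then show "word_prod W gen_img [Affine 1, Node i, Affine 3, Node i] \<in> carrier W"
    "word_prod W gen_img [Node i, Affine 3, Node i, Affine 1] \<in> carrier W"
    using gen_img_closed by (auto simp del: gen_img.simps)
  have N: "aff (gen_img (Node i)) = root_refl n A i"
    by (auto simp: aff_def)
  have "aff (gen_img (Affine 1)) \<circ> (root_refl n A i \<circ> aff (gen_img (Affine 3)) \<circ> root_refl n A i) =
      root_refl n A i \<circ> aff (gen_img (Affine 3)) \<circ> root_refl n A i \<circ> aff (gen_img (Affine 1))"
    unfolding aff_gen_img[OF g(1)] aff_gen_img[OF g(2)]
    using i diag g by (intro aff_refl_conj_commute) (auto simp only: Mat_gen_root node.simps atLeastAtMost_iff)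
  then show "aff (word_prod W gen_img [Affine 1, Node i, Affine 3, Node i]) =
      aff (word_prod W gen_img [Node i, Affine 3, Node i, Affine 1])"
    using g gen_img_closed N
    by (subst (1 2) aff_word_prod) (auto simp: comp_assoc simp del: gen_img.simps)
qed

lemma act_w_w: "act n A w \<circ> act n A w = id"
proof
  fix x
  have "Mat (\<lambda>k. x k + Mat x 0 * \<eta> k) 0 = - Mat x 0"
    using Mat_eta[of 0] diag[of 0] by (simp add: matrix_apply_add matrix_apply_scale)
  then show "(act n A w \<circ> act n A w) x = id x"
    by (simp add: act_w)
qed

lemma word_prod_Node:
  "word_prod W gen_img (map Node u) = (\<lambda>k. 0, act n A u)"
proof (induction u)
  case (Cons i u)
  then show ?case
    using act_zero[of n A "[i]"] by (simp add: W_mult comp_def)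
qed (simp add: W_one id_def)

text \<open>The factor s_0 \<tau>_{-\<alpha>_0} s_0 equals \<tau>_{\<alpha>_0} and the two
  s_\<theta> cancel; what remains is \<tau>_{\<alpha>_0 + \<eta>}.\<close>

lemma gen_img_central: "word_prod W gen_img (central_word w) = tau \<delta>"
proof -
  have "root_refl n A 0 (\<lambda>k. - simple_root 0 k + root_refl n A 0 \<eta> k) = \<delta>"
    using root_refl_comb[of n A 0 "-1" "simple_root 0" 1 "root_refl n A 0 \<eta>"]
    by (auto simp: root_refl_root_refl root_refl_self scaled_delta)
  moreover have "root_refl n A 0 \<circ> (root_refl n A 0 \<circ> (act n A w \<circ> act n A w)) = id"
    by (auto simp: act_w_w root_refl_root_refl)
  ultimately show ?thesis
    by (simp add: central_word_def word_prod_Node W_mult tau_def)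
qed



subsection \<open>Translations in the affine Weyl group\<close>

text \<open>The invariant form, written with the symmetrising factors e_j = 1 / d_j; its symmetry is
  the assumption \<open>sym\<close>.\<close>

definition bform :: "vect \<Rightarrow> vect \<Rightarrow> real" where
  "bform x y = (\<Sum>j\<le>n. e j * x j * Mat y j)"

text \<open>The translation t_\<beta> inside the affine Weyl group, as it acts on the span of the
  roots, where \<delta> is isotropic. It must be distinguished from \<tau>_\<beta>. The division by
  e_0 makes s_0 s_\<theta> equal to t_\<eta>.\<close>

definition transl :: "vect \<Rightarrow> vect \<Rightarrow> vect" where
  "transl \<beta> x = (\<lambda>k. x k - bform x \<beta> / e 0 * \<delta> k)"

lemma bform_sym: "bform x y = bform y x"
proof -
  have "bform x y = (\<Sum>j\<le>n. \<Sum>k\<le>n. x j * y k * (e j * of_int (A j k)))"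
    unfolding bform_def matrix_apply_def sum_distrib_left
    by (intro sum.cong HOL.refl) (simp add: algebra_simps)
  also have "\<dots> = (\<Sum>k\<le>n. \<Sum>j\<le>n. x j * y k * (e j * of_int (A j k)))"
    by (rule sum.swap)
  also have "\<dots> = bform y x"
    unfolding bform_def matrix_apply_def sum_distrib_left
    by (intro sum.cong HOL.refl) (simp add: sym algebra_simps)
  finally show ?thesis .
qed

lemma bform_comb: "bform x (\<lambda>k. s * y k + t * z k) = s * bform x y + t * bform x z"
  unfolding bform_def by (simp add: matrix_apply_comb algebra_simps sum.distrib sum_distrib_left)

lemma bform_comb_left: "bform (\<lambda>k. s * y k + t * z k) x = s * bform y x + t * bform z x"
  using bform_comb bform_sym by metis

lemma bform_zero: "bform x (\<lambda>k. 0) = 0"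
  using bform_comb[of x 0 x 0 x] by simp

lemma bform_simple_root: "i \<le> n \<Longrightarrow> bform (simple_root i) y = e i * Mat y i"
  unfolding bform_def simple_root_def by (simp add: if_distrib if_distribR sum.delta cong: if_cong)

lemma bform_delta: "bform x \<delta> = 0"
  by (simp add: bform_def null)

text \<open>Both sides are (x, y) minus the symmetric term e_i times the two pairings with the i-th
  coroot.\<close>

lemma bform_root_refl:
  assumes "i \<le> n"
  shows "bform (root_refl n A i x) y = bform x (root_refl n A i y)"
  using bform_comb_left[of 1 x "- Mat x i" "simple_root i" y]
    bform_comb[of x 1 y "- Mat y i" "simple_root i"]
    bform_simple_root[OF assms] bform_sym[of x "simple_root i"]
  by (simp add: root_refl_eq)

lemma transl_zero: "transl (\<lambda>k. 0) = id"
  by (auto simp: transl_def bform_zero)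

lemma transl_add: "transl \<beta> \<circ> transl \<gamma> = transl (\<lambda>k. \<beta> k + \<gamma> k)"
proof
  fix x
  have "bform (\<lambda>k. x k - bform x \<gamma> / e 0 * \<delta> k) \<beta> = bform x \<beta>"
    using bform_comb_left[of 1 x "- bform x \<gamma> / e 0" \<delta> \<beta>] bform_delta bform_sym[of \<delta> \<beta>] by simp
  moreover have "bform x (\<lambda>k. \<beta> k + \<gamma> k) = bform x \<beta> + bform x \<gamma>"
    using bform_comb[of x 1 \<beta> 1 \<gamma>] by simp
  ultimately show "(transl \<beta> \<circ> transl \<gamma>) x = transl (\<lambda>k. \<beta> k + \<gamma> k) x"
    by (auto simp: transl_def algebra_simps add_divide_distrib)
qed

lemma transl_root_refl:
  assumes "i \<le> n"
  shows "root_refl n A i \<circ> transl \<beta> \<circ> root_refl n A i = transl (root_refl n A i \<beta>)"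
proof
  fix x
  have "root_refl n A i (\<lambda>k. 1 * root_refl n A i x k + (- bform x (root_refl n A i \<beta>) / e 0) * \<delta> k) =
      (\<lambda>k. 1 * x k + (- bform x (root_refl n A i \<beta>) / e 0) * \<delta> k)"
    by (simp only: root_refl_comb root_refl_root_refl[OF assms] root_refl_delta[OF assms])
  then show "(root_refl n A i \<circ> transl \<beta> \<circ> root_refl n A i) x = transl (root_refl n A i \<beta>) x"
    by (simp add: transl_def bform_root_refl[OF assms])
qed

lemma transl_act:
  "set u \<subseteq> {..n} \<Longrightarrow> act n A u \<circ> transl \<beta> \<circ> act n A (rev u) = transl (act n A u \<beta>)"
proof (induction u)
  case (Cons i u)
  then have IH: "act n A u \<circ> transl \<beta> \<circ> act n A (rev u) = transl (act n A u \<beta>)" and i: "i \<le> n"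
    by (auto simp: comp_def)
  have "act n A (i # u) \<circ> transl \<beta> \<circ> act n A (rev (i # u)) =
      root_refl n A i \<circ> (act n A u \<circ> transl \<beta> \<circ> act n A (rev u)) \<circ> root_refl n A i"
    by (simp add: comp_assoc)
  also have "\<dots> = transl (act n A (i # u) \<beta>)"
    unfolding IH transl_root_refl[OF i] by simp
  finally show ?case .
qed simp

text \<open>As \<eta> differs from -\<alpha>_0 by the isotropic \<delta>, the form satisfies (x,
  \<eta>) = -(x, \<alpha>_0), which turns the product of the two reflections into a
  translation.\<close>

lemma act_theta_translation: "act n A (0 # w) = transl \<eta>"
proof
  fix x
  have "bform x \<eta> = - e 0 * Mat x 0"
    using bform_comb[of x 1 \<delta> "-1" "simple_root 0"] bform_delta[of x]
      bform_simple_root[of 0 x] bform_sym[of x "simple_root 0"] by (simp add: scaled_delta)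
  moreover have "Mat (\<lambda>k. x k + Mat x 0 * \<eta> k) 0 = - Mat x 0"
    using Mat_eta[of 0] diag[of 0] by (simp add: matrix_apply_add matrix_apply_scale)
  ultimately show "act n A (0 # w) x = transl \<eta> x"
    using e0 by (auto simp: act_w root_refl_eq transl_def scaled_delta algebra_simps)
qed

lemma root_refl_eta_fixed: "i \<in> {1..n} \<Longrightarrow> laces A 0 i = 0 \<Longrightarrow> root_refl n A i \<eta> = \<eta>"
  using Mat_eta[of i] zero_iff[of 0 i] by (auto simp: root_refl_eq laces_def)

text \<open>The form of \<open>generation\<close> suited to sets that are stable under the whole
  finite Weyl group.\<close>

lemma lattice_generation:
  assumes "\<eta> \<in> M" and "\<And>x y. x \<in> M \<Longrightarrow> y \<in> M \<Longrightarrow> (\<lambda>k. x k - y k) \<in> M"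
    and "\<And>i x. i \<in> {1..n} \<Longrightarrow> x \<in> M \<Longrightarrow> root_refl n A i x \<in> M"
  shows "L \<subseteq> M"
  by (rule generation) (use assms in auto)


subsection \<open>Surjectivity\<close>

abbreviation "S \<equiv> generators n"
abbreviation "eval \<equiv> word_prod W (signed W gen_img)"

lemma eval_append: "u \<in> words S \<Longrightarrow> v \<in> words S \<Longrightarrow> eval (u @ v) = eval u \<otimes>\<^bsub>W\<^esub> eval v"
  by (rule W.word_prod_signed_append[OF gen_img_Pi])

lemma eval_closed: "u \<in> words S \<Longrightarrow> eval u \<in> carrier W"
  by (rule W.word_prod_signed_closed[OF gen_img_Pi])

lemma eval_pos_word: "eval (pos_word xs) = word_prod W gen_img xs"
  by (rule word_prod_pos_word)

lemma word_prod_rev: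
  "set xs \<subseteq> S \<Longrightarrow> word_prod W gen_img (rev xs) = inv\<^bsub>W\<^esub> (word_prod W gen_img xs)"
proof (induction xs)
  case (Cons x xs)
  then have x: "gen_img x \<in> carrier W" and xs: "\<And>y. y \<in> set xs \<Longrightarrow> gen_img y \<in> carrier W"
    using gen_img_closed by auto
  have "inv\<^bsub>W\<^esub> gen_img x = gen_img x"
    using gen_img_square Cons.prems x by (intro W.inv_equality) auto
  then show ?case
    using Cons x xs by (subst rev.simps, subst W.word_prod_append) (auto simp: W.inv_mult_group)
qed simp

text \<open>The index k selects the generator that stands for node 0, so one word in the nodes can
  be read in each of the three copies.\<close>

definition gen_node :: "nat \<Rightarrow> nat \<Rightarrow> generator" where
  "gen_node k i = (if i = 0 then Affine k else Node i)"

lemma gen_node_in: "k \<in> {1, 2, 3} \<Longrightarrow> set u \<subseteq> {..n} \<Longrightarrow> set (map (gen_node k) u) \<subseteq> S"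
  by (fastforce simp: gen_node_def generators_def)

lemma map_gen_node_finite: "set u \<subseteq> {1..n} \<Longrightarrow> map (gen_node k) u = map Node u"
  by (auto simp: gen_node_def)

lemma word_prod_act: "word_prod W gen_img (map (gen_node 1) u) = (\<lambda>k. 0, act n A u)"
proof (induction u)
  case (Cons i u)
  have "root_refl n A j (\<lambda>k. 0) = (\<lambda>k. 0)" for j
    using act_zero[of n A "[j]"] by simp
  with Cons show ?case
    by (simp add: gen_node_def W_mult comp_def)
qed (simp add: W_one id_def)

text \<open>One word spells two translations: t_\<beta> through its action and \<tau>_\<beta> when
  node 0 is read as \<open>s\<^sub>0\<^sub>3\<close>. Both properties hold for 0 followed by the
  word for s_\<theta>, with \<beta> = \<eta>, and pass to differences and conjugates.\<close>

lemma lattice_translation_words: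
  assumes "\<beta> \<in> L"
  shows "\<exists>v. set v \<subseteq> {..n} \<and> act n A v = transl \<beta> \<and>
    word_prod W gen_img (map (gen_node 3) v) = tau \<beta>"
proof -
  define M where "M = {\<beta> \<in> L. \<exists>v. set v \<subseteq> {..n} \<and> act n A v = transl \<beta> \<and>
    word_prod W gen_img (map (gen_node 3) v) = tau \<beta>}"
  have prod_append: "word_prod W gen_img (map (gen_node 3) (u @ v)) =
      word_prod W gen_img (map (gen_node 3) u) \<otimes>\<^bsub>W\<^esub> word_prod W gen_img (map (gen_node 3) v)"
    if "set u \<subseteq> {..n}" "set v \<subseteq> {..n}" for u v
    unfolding map_append
    by (rule W.word_prod_append) (use that gen_node_in[of 3] gen_img_closed in blast)
  have "L \<subseteq> M"
  proof (rule lattice_generation)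
    have "word_prod W gen_img (map (gen_node 3) (0 # w)) = tau \<eta>"
      by (simp add: gen_node_def map_gen_node_finite[OF w_set(1)] word_prod_Node W_mult act_w_w
          tau_def)
    then show "\<eta> \<in> M"
      using eta w_set(2) act_theta_translation unfolding M_def by (intro CollectI conjI exI[of _ "0 # w"]) auto
  next
    fix x y assume "x \<in> M" "y \<in> M"
    then obtain u v where u: "x \<in> L" "set u \<subseteq> {..n}" "act n A u = transl x"
        "word_prod W gen_img (map (gen_node 3) u) = tau x"
      and v: "y \<in> L" "set v \<subseteq> {..n}" "act n A v = transl y"
        "word_prod W gen_img (map (gen_node 3) v) = tau y"
      unfolding M_def by blast
    have "transl y \<circ> transl (\<lambda>k. - y k) = id"
      by (simp add: transl_add transl_zero)
    moreover have "act n A (rev v) \<circ> transl y = id"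
      using act_rev[OF v(2)] v(3) by simp
    ultimately have "act n A (rev v) = transl (\<lambda>k. - y k)"
      by (metis comp_assoc comp_id id_comp)
    then have "act n A (u @ rev v) = transl (\<lambda>k. x k - y k)"
      by (simp add: u(3) transl_add)
    moreover have "word_prod W gen_img (map (gen_node 3) (rev v)) = tau (\<lambda>k. - y k)"
      using word_prod_rev[OF gen_node_in[of 3 v]] v tau_inv[OF lattice_subset_Q] by (simp add: rev_map)
    then have "word_prod W gen_img (map (gen_node 3) (u @ rev v)) = tau (\<lambda>k. x k - y k)"
      using prod_append[of u "rev v"] u v by (simp add: tau_mult)
    ultimately show "(\<lambda>k. x k - y k) \<in> M"
      unfolding M_def using u(1,2) v(1,2) lattice_diff
      by (intro CollectI conjI exI[of _ "u @ rev v"]) auto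
  next
    fix i x assume i: "i \<in> {1..n}" and "x \<in> M"
    then obtain u where u: "x \<in> L" "set u \<subseteq> {..n}" "act n A u = transl x"
        "word_prod W gen_img (map (gen_node 3) u) = tau x"
      unfolding M_def by blast
    have "act n A ([i] @ u @ [i]) = transl (root_refl n A i x)"
      using transl_root_refl[of i x] i u(3) by (simp add: comp_assoc)
    moreover have "word_prod W gen_img (map (gen_node 3) ([i] @ u @ [i])) = tau (root_refl n A i x)"
    proof -
      have g: "word_prod W gen_img (map (gen_node 3) [i]) = (\<lambda>k. 0, root_refl n A i)"
        using i act_zero[of n A "[i]"] by (simp add: gen_node_def W_mult W_one comp_def)
      have "word_prod W gen_img (map (gen_node 3) ([i] @ u @ [i])) =
          (\<lambda>k. 0, root_refl n A i) \<otimes>\<^bsub>W\<^esub> (tau x \<otimes>\<^bsub>W\<^esub> (\<lambda>k. 0, root_refl n A i))"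
        using i u prod_append[of "[i]" "u @ [i]"] prod_append[of u "[i]"] g by simp
      also have "\<dots> = tau (root_refl n A i x)"
        using i root_refl_root_refl[of i] by (simp add: tau_def W_mult comp_def id_def)
      finally show ?thesis .
    qed
    ultimately show "root_refl n A i x \<in> M"
      unfolding M_def using i u root_refl_lattice
      by (intro CollectI conjI exI[of _ "[i] @ u @ [i]"]) auto
  qed
  then show ?thesis
    using assms unfolding M_def by blast
qed

text \<open>An element \<tau>_x \<tau>_{m \<delta>} u is spelled factor by factor: the first in the
  third copy, the second by powers of the central word, the third in the first copy.\<close>

lemma eval_surj:
  assumes "p \<in> carrier W"
  shows "\<exists>u\<in>words S. eval u = p"
proof -
  obtain \<beta> u where p: "\<beta> \<in> Q_lattice X n A" "set u \<subseteq> {..n}" "p = (\<beta>, act n A u)"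
    using assms by (rule W_carrierE)
  obtain x m where x: "x \<in> L" "\<beta> = (\<lambda>k. x k + of_int m * \<delta> k)"
    using p(1) Q_lattice_iff by blast
  obtain v where v: "set v \<subseteq> {..n}" "word_prod W gen_img (map (gen_node 3) v) = tau x"
    using lattice_translation_words[OF x(1)] by blast
  have c: "set (central_word w) \<subseteq> S"
    using w_set(1) by (auto simp: central_word_def generators_def)
  have "\<exists>u\<in>words S. eval u = tau \<delta> [^]\<^bsub>W\<^esub> m"
  proof -
    have nat: "\<exists>u\<in>words S. eval u = y [^]\<^bsub>W\<^esub> k" if y: "\<exists>u\<in>words S. eval u = y" for y and k :: nat
    proof (induction k)
      case 0
      then show ?case
        by (intro bexI[of _ "[]"]) auto
    next
      case (Suc k)
      then obtain u v where "u \<in> words S" "eval u = y [^]\<^bsub>W\<^esub> k" "v \<in> words S" "eval v = y"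
        using y by blast
      then show ?case
        by (intro bexI[of _ "u @ v"]) (auto simp: eval_append)
    qed
    have 1: "\<exists>u\<in>words S. eval u = tau \<delta>"
      using c gen_img_central by (intro bexI[of _ "pos_word (central_word w)"]) (auto simp: eval_pos_word)
    have 2: "\<exists>u\<in>words S. eval u = inv\<^bsub>W\<^esub> tau \<delta>"
      using c gen_img_central word_prod_rev[OF c]
      by (intro bexI[of _ "pos_word (rev (central_word w))"]) (auto simp: eval_pos_word)
    show ?thesis
    proof (cases "m \<ge> 0")
      case True
      then show ?thesis
        using nat[OF 1, of "nat m"] by (simp add: int_pow_int[symmetric] del: int_pow_int)
    next
      case False
      then obtain k where "m = - int k"
        by (metis nle_le nonpos_int_cases)
      then have "tau \<delta> [^]\<^bsub>W\<^esub> m = (inv\<^bsub>W\<^esub> tau \<delta>) [^]\<^bsub>W\<^esub> k"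
        using tau_closed[OF delta_Q] by (simp add: W.int_pow_neg_int W.nat_pow_inv del: int_pow_int)
      then show ?thesis
        using nat[OF 2, of k] by simp
    qed
  qed
  then obtain u' where u': "u' \<in> words S" "eval u' = tau \<delta> [^]\<^bsub>W\<^esub> m"
    by blast
  let ?u = "pos_word (map (gen_node 3) v) @ u' @ pos_word (map (gen_node 1) u)"
  have in_words: "pos_word (map (gen_node 3) v) \<in> words S" "pos_word (map (gen_node 1) u) \<in> words S"
    using gen_node_in v(1) p(2) by auto
  have "eval ?u = tau x \<otimes>\<^bsub>W\<^esub> (tau (\<lambda>k. of_int m * \<delta> k) \<otimes>\<^bsub>W\<^esub> (\<lambda>k. 0, act n A u))"
    using in_words u' v(2) word_prod_act by (simp add: eval_append eval_pos_word tau_delta_pow)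
  also have "\<dots> = p"
    by (simp add: p(3) x(2) tau_def W_mult)
  finally show ?thesis
    using in_words u'(1) by (intro bexI[of _ ?u]) auto
qed

end


section \<open>The relations of the elliptic Weyl group\<close>

context group
begin

lemma commute_mult:
  assumes "x \<otimes> y = y \<otimes> x" "x \<otimes> z = z \<otimes> x" "x \<in> carrier G" "y \<in> carrier G" "z \<in> carrier G"
  shows "x \<otimes> (y \<otimes> z) = y \<otimes> z \<otimes> x"
  using assms by (metis m_assoc)

lemma commute_inv:
  assumes "x \<otimes> y = y \<otimes> x" "x \<in> carrier G" "y \<in> carrier G"
  shows "x \<otimes> inv y = inv y \<otimes> x"
  using assms by (metis inv_closed inv_solve_left inv_solve_right m_assoc m_closed)

lemma involution_inv: "x \<otimes> x = \<one> \<Longrightarrow> x \<in> carrier G \<Longrightarrow> inv x = x"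
  by (rule inv_equality)

lemma involution_cancel: "x \<otimes> x = \<one> \<Longrightarrow> x \<in> carrier G \<Longrightarrow> y \<in> carrier G \<Longrightarrow> x \<otimes> (x \<otimes> y) = y"
  by (metis l_one m_assoc)

end

text \<open>An arbitrary group in which the elliptic relations hold. The computations below are then
  free of classes of words; the presented group is substituted at the end.\<close>

locale elliptic_images = double_affine n A X \<eta> e w + group G
  for n A X \<eta> e w and G (structure) +
  fixes g :: "generator \<Rightarrow> 'a"
  assumes g_closed [simp]: "x \<in> S \<Longrightarrow> g x \<in> carrier G"
    and g_square: "x \<in> S \<Longrightarrow> g x \<otimes> g x = \<one>"
    and g_braid: "x \<in> S \<Longrightarrow> y \<in> S \<Longrightarrow> node x \<noteq> node y \<Longrightarrow>
      (laces A (node x) (node y), m) \<in> {(0, 2), (1, 3), (2, 4), (3, 6)} \<Longrightarrow>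
      word_prod G g (alternating m x y) = word_prod G g (alternating m y x)"
    and g_double_lace: "i \<in> {1..n} \<Longrightarrow> laces A 0 i = 2 \<Longrightarrow>
      word_prod G g [Affine 1, Node i, Affine 3, Node i] =
      word_prod G g [Node i, Affine 3, Node i, Affine 1]"
    and g_central: "word_prod G g (central_word w) = \<one>"
begin

section \<open>Three copies of the affine Weyl group and their translations\<close>

abbreviation "P k u \<equiv> word_prod G g (map (gen_node k) u)"

lemma in_S: "Affine 1 \<in> S" "Affine 2 \<in> S" "Affine 3 \<in> S" "i \<in> {1..n} \<Longrightarrow> Node i \<in> S"
  by (auto simp: generators_def)

text \<open>For fixed k the relations a) and c) contain the Coxeter relations of the affine Weyl
  group, so Tits' theorem applies to each copy.\<close>

lemma coxeter: "k \<in> {1, 2, 3} \<Longrightarrow> coxeter_images G n A (\<lambda>i. g (gen_node k i))"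
proof unfold_locales
  assume k: "k \<in> {1, 2, 3}"
  have k_in: "gen_node k i \<in> S" if "i \<le> n" for i
    using gen_node_in[of k "[i]"] k that by simp
  have nd: "node (gen_node k i) = i" for i
    by (simp add: gen_node_def)
  fix i assume i: "i \<le> n"
  show "g (gen_node k i) \<in> carrier G" "g (gen_node k i) \<otimes> g (gen_node k i) = \<one>"
    using k_in[OF i] g_square by auto
  fix j and m :: nat assume j: "j \<le> n" "i \<noteq> j" "(laces A i j, m) \<in> {(0, 2), (1, 3), (2, 4), (3, 6)}"
  show "word_prod G (\<lambda>i. g (gen_node k i)) (alternating m i j) =
      word_prod G (\<lambda>i. g (gen_node k i)) (alternating m j i)"
    using g_braid[OF k_in[OF i] k_in[OF j(1)], of m] j
    by (simp only: word_prod_map[symmetric] map_alternating nd not_False_eq_True)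
qed

lemma P_closed [simp]: "k \<in> {1, 2, 3} \<Longrightarrow> set u \<subseteq> {..n} \<Longrightarrow> P k u \<in> carrier G"
  using gen_node_in[of k u] by (intro word_prod_closed) (auto intro!: g_closed)

lemma P_append:
  "k \<in> {1, 2, 3} \<Longrightarrow> set u \<subseteq> {..n} \<Longrightarrow> set v \<subseteq> {..n} \<Longrightarrow> P k (u @ v) = P k u \<otimes> P k v"
  unfolding map_append using gen_node_in[of k u] gen_node_in[of k v]
  by (intro word_prod_append) (blast intro: g_closed)

lemma P_eq:
  "k \<in> {1, 2, 3} \<Longrightarrow> set u \<subseteq> {..n} \<Longrightarrow> set v \<subseteq> {..n} \<Longrightarrow> act n A u = act n A v \<Longrightarrow> P k u = P k v"
  unfolding word_prod_map by (rule coxeter_images.act_eq_imp_prod_eq[OF coxeter])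

lemma P_finite: "set u \<subseteq> {1..n} \<Longrightarrow> P k u = P 1 u"
  by (simp add: map_gen_node_finite)

lemma P_Node: "i \<in> {1..n} \<Longrightarrow> P k [i] = g (Node i)"
  by (simp add: gen_node_def in_S)

text \<open>The chosen word does not matter: by faithfulness its value depends only on its action
  (\<open>T_eq\<close>).\<close>

definition T :: "nat \<Rightarrow> vect \<Rightarrow> 'a" where
  "T k \<beta> = P k (SOME v. set v \<subseteq> {..n} \<and> act n A v = transl \<beta>)"

text \<open>The vectors whose translation lies in the affine Weyl group. Closure under sums and
  finite reflections is immediate on words; \<open>L\<close> is a subset by
  \<open>lattice_translation_words\<close>.\<close>

definition TD :: "vect set" where
  "TD = {\<beta>. \<exists>v. set v \<subseteq> {..n} \<and> act n A v = transl \<beta>}"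

lemma T_eq:
  assumes "k \<in> {1, 2, 3}" "set v \<subseteq> {..n}" "act n A v = transl \<beta>"
  shows "T k \<beta> = P k v"
  unfolding T_def by (rule P_eq) (use assms someI[of "\<lambda>v. set v \<subseteq> {..n} \<and> act n A v = transl \<beta>" v] in auto)

lemma TD_E:
  assumes "\<beta> \<in> TD"
  obtains v where "set v \<subseteq> {..n}" "act n A v = transl \<beta>" "\<And>k. k \<in> {1, 2, 3} \<Longrightarrow> T k \<beta> = P k v"
  using assms T_eq unfolding TD_def by blast

lemma T_closed [simp]: "k \<in> {1, 2, 3} \<Longrightarrow> \<beta> \<in> TD \<Longrightarrow> T k \<beta> \<in> carrier G"
  by (elim TD_E) simp

lemma TD_add: "\<beta> \<in> TD \<Longrightarrow> \<gamma> \<in> TD \<Longrightarrow> (\<lambda>j. \<beta> j + \<gamma> j) \<in> TD"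
  and T_add: "k \<in> {1, 2, 3} \<Longrightarrow> \<beta> \<in> TD \<Longrightarrow> \<gamma> \<in> TD \<Longrightarrow> T k (\<lambda>j. \<beta> j + \<gamma> j) = T k \<beta> \<otimes> T k \<gamma>"
proof -
  assume "\<beta> \<in> TD" "\<gamma> \<in> TD"
  then obtain u v where u: "set u \<subseteq> {..n}" "act n A u = transl \<beta>" "\<And>k. k \<in> {1, 2, 3} \<Longrightarrow> T k \<beta> = P k u"
    and v: "set v \<subseteq> {..n}" "act n A v = transl \<gamma>" "\<And>k. k \<in> {1, 2, 3} \<Longrightarrow> T k \<gamma> = P k v"
    by (metis TD_E)
  have uv: "set (u @ v) \<subseteq> {..n}" "act n A (u @ v) = transl (\<lambda>j. \<beta> j + \<gamma> j)"
    using u v by (simp_all add: transl_add)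
  then show "(\<lambda>j. \<beta> j + \<gamma> j) \<in> TD"
    unfolding TD_def by blast
  assume "k \<in> {1, 2, 3}"
  then show "T k (\<lambda>j. \<beta> j + \<gamma> j) = T k \<beta> \<otimes> T k \<gamma>"
    using T_eq[OF _ uv] u v P_append by simp
qed

lemma T_comm:
  "k \<in> {1, 2, 3} \<Longrightarrow> \<beta> \<in> TD \<Longrightarrow> \<gamma> \<in> TD \<Longrightarrow> T k \<beta> \<otimes> T k \<gamma> = T k \<gamma> \<otimes> T k \<beta>"
  using T_add[of k \<beta> \<gamma>] T_add[of k \<gamma> \<beta>] by (simp add: add.commute)

lemma T_zero: "k \<in> {1, 2, 3} \<Longrightarrow> T k (\<lambda>j. 0) = \<one>"
  using T_eq[of k "[]" "\<lambda>j. 0"] by (simp add: transl_zero)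

lemma TD_neg:
  assumes "\<beta> \<in> TD"
  shows "(\<lambda>j. - \<beta> j) \<in> TD"
proof -
  obtain v where v: "set v \<subseteq> {..n}" "act n A v = transl \<beta>"
    using assms by (auto simp: TD_def)
  have "act n A (rev v) \<circ> transl \<beta> = id" "transl \<beta> \<circ> transl (\<lambda>j. - \<beta> j) = id"
    using act_rev[OF v(1)] v(2) by (simp_all add: transl_add transl_zero)
  then have "act n A (rev v) = transl (\<lambda>j. - \<beta> j)"
    by (metis comp_assoc comp_id id_comp)
  then show ?thesis
    unfolding TD_def using v(1) by (intro CollectI exI[of _ "rev v"]) simp
qed

lemma T_neg: "k \<in> {1, 2, 3} \<Longrightarrow> \<beta> \<in> TD \<Longrightarrow> T k (\<lambda>j. - \<beta> j) = inv (T k \<beta>)"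
  using T_add[of k "\<lambda>j. - \<beta> j" \<beta>] T_zero TD_neg by (intro inv_equality[symmetric]) auto

lemma TD_diff: "\<beta> \<in> TD \<Longrightarrow> \<gamma> \<in> TD \<Longrightarrow> (\<lambda>j. \<beta> j - \<gamma> j) \<in> TD"
  and T_diff: "k \<in> {1, 2, 3} \<Longrightarrow> \<beta> \<in> TD \<Longrightarrow> \<gamma> \<in> TD \<Longrightarrow> T k (\<lambda>j. \<beta> j - \<gamma> j) = T k \<beta> \<otimes> inv (T k \<gamma>)"
  using TD_add[of \<beta> "\<lambda>j. - \<gamma> j"] T_add[of k \<beta> "\<lambda>j. - \<gamma> j"] TD_neg T_neg by simp_all

text \<open>Conjugation by u translates by u(\<beta>). A word in the finite nodes has the same value
  in every copy, which is why \<open>P 1\<close> occurs for each k.\<close>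

lemma TD_act: "set u \<subseteq> {1..n} \<Longrightarrow> \<beta> \<in> TD \<Longrightarrow> act n A u \<beta> \<in> TD"
  and T_act: "k \<in> {1, 2, 3} \<Longrightarrow> set u \<subseteq> {1..n} \<Longrightarrow> \<beta> \<in> TD \<Longrightarrow>
    T k (act n A u \<beta>) = P 1 u \<otimes> T k \<beta> \<otimes> P 1 (rev u)"
proof -
  assume u: "set u \<subseteq> {1..n}" and "\<beta> \<in> TD"
  then obtain v where v: "set v \<subseteq> {..n}" "act n A v = transl \<beta>" "\<And>k. k \<in> {1, 2, 3} \<Longrightarrow> T k \<beta> = P k v"
    by (metis TD_E)
  have u': "set u \<subseteq> {..n}"
    using u by auto
  have uvu: "set (u @ v @ rev u) \<subseteq> {..n}" "act n A (u @ v @ rev u) = transl (act n A u \<beta>)"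
    using transl_act[OF u', of \<beta>] u' v by (simp_all add: comp_assoc)
  then show "act n A u \<beta> \<in> TD"
    unfolding TD_def by blast
  assume k: "k \<in> {1, 2, 3}"
  have "P k (u @ v @ rev u) = P k u \<otimes> (P k v \<otimes> P k (rev u))"
    using P_append[OF k, of u "v @ rev u"] P_append[OF k, of v "rev u"] u' v(1) by simp
  then show "T k (act n A u \<beta>) = P 1 u \<otimes> T k \<beta> \<otimes> P 1 (rev u)"
    using T_eq[OF k uvu] P_finite[of u k] P_finite[of "rev u" k] u v k u' by (simp add: m_assoc)
qed

lemma TD_root_refl: "i \<in> {1..n} \<Longrightarrow> \<beta> \<in> TD \<Longrightarrow> root_refl n A i \<beta> \<in> TD"
  and T_root_refl: "k \<in> {1, 2, 3} \<Longrightarrow> i \<in> {1..n} \<Longrightarrow> \<beta> \<in> TD \<Longrightarrow>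
    T k (root_refl n A i \<beta>) = g (Node i) \<otimes> T k \<beta> \<otimes> g (Node i)"
  using TD_act[of "[i]" \<beta>] T_act[of k "[i]" \<beta>] P_Node[of i 1] by simp_all

lemma TD_eta: "\<eta> \<in> TD"
  unfolding TD_def using act_theta_translation w_set(2) by (intro CollectI exI[of _ "0 # w"]) auto

lemma lattice_TD: "L \<subseteq> TD"
  using lattice_translation_words unfolding TD_def by blast

section \<open>Commutation between the first and the third copy\<close>

definition p :: 'a where "p = P 1 w"

lemma p_closed [simp]: "p \<in> carrier G"
  unfolding p_def using w_set(2) by (intro P_closed) auto

lemma p_square: "p \<otimes> p = \<one>"
  using P_append[of 1 w w] P_eq[of 1 "w @ w" "[]"] w_set(2) act_w_w by (simp add: p_def)

lemma act_rev_w: "act n A (rev w) = act n A w"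
  using act_rev[OF w_set(2)] act_w_w by (metis comp_assoc comp_id id_comp)

lemma p_rev: "P 1 (rev w) = p"
  unfolding p_def using w_set(2) act_rev_w by (intro P_eq) auto

lemma T_eta: "k \<in> {1, 2, 3} \<Longrightarrow> T k \<eta> = g (Affine k) \<otimes> p"
  using T_eq[OF _ _ act_theta_translation, of k] w_set P_finite[OF w_set(1), of k]
  by (simp add: p_def gen_node_def)

lemma T_act_w: "k \<in> {1, 2, 3} \<Longrightarrow> \<beta> \<in> TD \<Longrightarrow> T k (act n A w \<beta>) = p \<otimes> T k \<beta> \<otimes> p"
  using T_act[OF _ w_set(1)] p_rev by (simp add: p_def)

lemma g_Affine: "k \<in> {1, 2, 3} \<Longrightarrow> g (Affine k) = T k \<eta> \<otimes> p"
  using T_eta[of k] in_S p_square by (auto simp: m_assoc)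

lemma g_Affine_2: "g (Affine 2) = g (Affine 1) \<otimes> (p \<otimes> g (Affine 3))"
proof -
  have "word_prod G g (map Node w) = p"
    unfolding p_def map_gen_node_finite[OF w_set(1)] ..
  then have "g (Affine 1) \<otimes> (g (Affine 2) \<otimes> (g (Affine 3) \<otimes> p)) = \<one>"
    using g_central by (simp add: central_word_def)
  then have "g (Affine 2) \<otimes> (g (Affine 3) \<otimes> p) = g (Affine 1)"
    using involution_cancel[OF g_square[OF in_S(1)]] in_S by (metis g_closed m_closed p_closed r_one)
  then have "g (Affine 2) = g (Affine 1) \<otimes> inv (g (Affine 3) \<otimes> p)"
    using in_S by (simp add: inv_solve_right)
  then show ?thesis
    using in_S involution_inv g_square p_square by (simp add: inv_mult_group)
qed

text \<open>This is the relation that \<open>s\<^sub>0\<^sub>2\<close> has order two: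
  \<open>s\<^sub>0\<^sub>1 s\<^sub>\<theta> s\<^sub>0\<^sub>3\<close> equals its inverse
  \<open>s\<^sub>0\<^sub>3 s\<^sub>\<theta> s\<^sub>0\<^sub>1\<close>, and a factor s_\<theta> on
  the right gives the claim.\<close>

lemma T_eta_commute: "T 1 \<eta> \<otimes> T 3 \<eta> = T 3 \<eta> \<otimes> T 1 \<eta>"
proof -
  let ?a = "g (Affine 1)" and ?d = "g (Affine 3)"
  have "inv (g (Affine 2)) = g (Affine 2)"
    by (intro involution_inv g_square g_closed in_S)
  then have "?d \<otimes> (p \<otimes> ?a) = ?a \<otimes> (p \<otimes> ?d)"
    unfolding g_Affine_2 using in_S involution_inv g_square p_square
    by (simp add: inv_mult_group m_assoc)
  then have "?d \<otimes> (p \<otimes> ?a) \<otimes> p = ?a \<otimes> (p \<otimes> ?d) \<otimes> p"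
    by simp
  then show ?thesis
    using in_S by (simp add: T_eta m_assoc)
qed

lemma g_Affine_2': "g (Affine 2) = T 1 \<eta> \<otimes> T 3 \<eta> \<otimes> p"
  unfolding g_Affine_2 using in_S p_square by (simp add: T_eta m_assoc)

lemma act_w_aff_refl: "act n A w = aff_refl (\<lambda>x. Mat x 0) (\<lambda>k. - \<eta> k)"
  by (auto simp: act_w aff_refl_def)

text \<open>Put \<gamma> = s_i \<eta> = \<eta> - \<alpha>_i. The braid relation of s_i with
  \<open>s\<^sub>0\<^sub>2\<close>, divided by the one of s_i with s_\<theta>, is an identity
  between translations of the two copies; it says that \<open>T\<^sub>1(\<alpha>\<^sub>i)\<close>
  commutes with \<open>T\<^sub>3(\<eta>)\<close>. Combination with \<open>T_eta_commute\<close> and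
  conjugation by s_i finish the argument.\<close>

lemma single_lace_commute:
  assumes i: "i \<in> {1..n}" and lace: "laces A 0 i = 1"
  shows "T 1 \<eta> \<otimes> T 3 (root_refl n A i \<eta>) = T 3 (root_refl n A i \<eta>) \<otimes> T 1 \<eta>"
proof -
  let ?s = "g (Node i)" and ?b = "g (Affine 2)"
  define \<gamma> where "\<gamma> = root_refl n A i \<eta>"
  define \<alpha> where "\<alpha> = (simple_root i :: vect)"
  have i': "i \<le> n" "i \<noteq> 0"
    using i by auto
  have A: "A 0 i = -1" "A i 0 = -1"
  proof -
    have "A 0 i \<le> 0" "A i 0 \<le> 0"
      using offdiag i' by auto
    then show "A 0 i = -1" "A i 0 = -1"
      using lace unfolding laces_def by (auto simp: zmult_eq_1_iff)
  qed
  have gam: "\<gamma> = (\<lambda>k. \<eta> k - \<alpha> k)"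
    using Mat_eta[OF i'(1)] A by (auto simp: \<gamma>_def \<alpha>_def root_refl_eq)
  have "Mat \<gamma> 0 = -1"
    using Mat_eta[of 0] diag[of 0] matrix_apply_simple_root[OF i'(1), of A 0] A
      matrix_apply_comb[of n A 1 \<eta> "-1" \<alpha> 0] by (simp add: gam \<alpha>_def)
  \<comment> \<open>As \<gamma> pairs to -1 with the coroot of node 0, s_\<theta> sends it to
    \<gamma> - \<eta> = -\<alpha>.\<close>
  then have rot: "act n A (w @ [i]) \<eta> = (\<lambda>k. - \<alpha> k)"
    using act_w[of \<gamma>] by (auto simp: \<gamma>_def[symmetric]) (simp add: gam)
  have g_TD: "\<gamma> \<in> TD"
    unfolding \<gamma>_def using i TD_eta by (rule TD_root_refl)
  have "\<alpha> = (\<lambda>k. \<eta> k - \<gamma> k)"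
    by (simp add: gam)
  then have a_TD: "\<alpha> \<in> TD"
    using TD_diff[OF TD_eta g_TD] by simp
  have eta_split: "\<eta> = (\<lambda>k. \<alpha> k + \<gamma> k)"
    by (simp add: gam)
  have s: "?s \<in> carrier G" "?s \<otimes> ?s = \<one>"
    using in_S(4)[OF i] g_square by auto
  \<comment> \<open>s_\<theta> is the reflection in -\<eta>, which is joined to \<alpha>_i by one
    lace as \<alpha>_0 is; the braid relation is transferred to \<open>G\<close> by
    faithfulness.\<close>
  have sps: "?s \<otimes> (p \<otimes> ?s) = p \<otimes> (?s \<otimes> p)"
  proof -
    have neg: "Mat (\<lambda>k. - \<eta> k) j = - Mat \<eta> j" for j
      using matrix_apply_scale[of n A "-1" \<eta> j] by simp
    have "foldr (\<circ>) (alternating 3 (root_refl n A i) (act n A w)) id =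
        foldr (\<circ>) (alternating 3 (act n A w) (root_refl n A i)) id"
      unfolding root_refl_def act_w_aff_refl
      by (rule aff_refl_braid[where p = "-1" and q = "-1"])
        (use A diag[of 0] diag[of i] i' in
          \<open>simp_all only: matrix_apply_add matrix_apply_scale neg matrix_apply_simple_root Mat_eta\<close>, auto)
    then have "act n A ([i] @ w @ [i]) = act n A (w @ [i] @ w)"
      by (simp add: numeral_eq_Suc)
    then have "P 1 ([i] @ w @ [i]) = P 1 (w @ [i] @ w)"
      using w_set(2) i' by (intro P_eq) auto
    then show ?thesis
      using P_append[of 1 "[i]" "w @ [i]"] P_append[of 1 w "[i]"] P_append[of 1 w "[i] @ w"]
        P_append[of 1 "[i]" w] w_set(2) i' P_Node[OF i, of 1] by (simp add: p_def)
  qed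
  define Y where "Y = T 1 \<eta> \<otimes> T 3 \<eta>"
  have Y: "Y \<in> carrier G"
    by (simp add: Y_def TD_eta)
  have sYs: "?s \<otimes> (Y \<otimes> ?s) = T 1 \<gamma> \<otimes> T 3 \<gamma>"
    using s TD_eta involution_cancel[OF s(2,1)] unfolding \<gamma>_def
    by (simp add: T_root_refl[OF _ i] Y_def m_assoc)
  have psYsp: "p \<otimes> (?s \<otimes> (Y \<otimes> (?s \<otimes> p))) = inv (T 1 \<alpha>) \<otimes> inv (T 3 \<alpha>)"
  proof -
    have "T k (\<lambda>j. - \<alpha> j) = p \<otimes> (?s \<otimes> (T k \<eta> \<otimes> (?s \<otimes> p)))" if "k \<in> {1, 2, 3}" for k
      using T_act_w[OF that g_TD] rot T_root_refl[OF that i TD_eta] that s TD_eta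
      by (simp add: \<gamma>_def m_assoc)
    then have "T 1 (\<lambda>j. - \<alpha> j) \<otimes> T 3 (\<lambda>j. - \<alpha> j) = p \<otimes> (?s \<otimes> (Y \<otimes> (?s \<otimes> p)))"
      using s TD_eta involution_cancel[OF s(2,1)] involution_cancel[OF p_square p_closed]
      by (simp add: Y_def m_assoc)
    then show ?thesis
      using a_TD by (simp add: T_neg)
  qed
  have "word_prod G g (alternating 3 (Node i) (Affine 2)) = word_prod G g (alternating 3 (Affine 2) (Node i))"
    using lace i' in_S(2) in_S(4)[OF i] by (intro g_braid) (auto simp: laces_def mult.commute)
  \<comment> \<open>The left side is \<open>s\<^sub>i Y s\<^sub>i\<close> followed by
    \<open>s\<^sub>i p s\<^sub>i\<close>, the right side
    \<open>Y (p s\<^sub>i Y s\<^sub>i p)\<close> followed by \<open>p s\<^sub>i p\<close>; the last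
    factors agree by \<open>sps\<close>.\<close>
  then have "?s \<otimes> (?b \<otimes> ?s) = ?b \<otimes> (?s \<otimes> ?b)"
    using s in_S by (simp add: numeral_eq_Suc)
  moreover have "?b = Y \<otimes> p"
    by (simp add: g_Affine_2' Y_def)
  ultimately have "?s \<otimes> (Y \<otimes> (p \<otimes> ?s)) = Y \<otimes> (p \<otimes> (?s \<otimes> (Y \<otimes> p)))"
    using s Y by (simp add: m_assoc)
  moreover have "?s \<otimes> (Y \<otimes> (p \<otimes> ?s)) = ?s \<otimes> (Y \<otimes> ?s) \<otimes> (?s \<otimes> (p \<otimes> ?s))"
    using s Y involution_cancel[OF s(2,1)] by (simp add: m_assoc)
  moreover have "Y \<otimes> (p \<otimes> (?s \<otimes> (Y \<otimes> p))) = Y \<otimes> (p \<otimes> (?s \<otimes> (Y \<otimes> (?s \<otimes> p)))) \<otimes> (p \<otimes> (?s \<otimes> p))"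
    using s Y involution_cancel[OF s(2,1)] involution_cancel[OF p_square p_closed] by (simp add: m_assoc)
  ultimately have "?s \<otimes> (Y \<otimes> ?s) = Y \<otimes> (p \<otimes> (?s \<otimes> (Y \<otimes> (?s \<otimes> p))))"
    using s Y by (simp add: sps)
  then have main: "T 1 \<gamma> \<otimes> T 3 \<gamma> = T 1 \<eta> \<otimes> T 3 \<eta> \<otimes> (inv (T 1 \<alpha>) \<otimes> inv (T 3 \<alpha>))"
    unfolding sYs psYsp by (simp add: Y_def)
  note cl = T_closed[of _ \<alpha>] T_closed[of _ \<gamma>] T_closed[of _ \<eta>] a_TD g_TD TD_eta
  have "T 1 \<eta> = T 1 \<gamma> \<otimes> T 1 \<alpha>"
    using T_add[of 1 \<alpha> \<gamma>] T_comm[of 1 \<alpha> \<gamma>] eta_split a_TD g_TD by simp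
  \<comment> \<open>Here \<open>T 1 \<gamma>\<close> is cancelled on the left of
    \<open>main\<close>.\<close>
  then have "T 3 \<gamma> = T 1 \<alpha> \<otimes> T 3 \<eta> \<otimes> (inv (T 1 \<alpha>) \<otimes> inv (T 3 \<alpha>))"
    using main cl by (simp add: m_assoc)
  then have "T 3 \<gamma> \<otimes> T 3 \<alpha> = T 1 \<alpha> \<otimes> T 3 \<eta> \<otimes> inv (T 1 \<alpha>)"
    using cl by (simp add: m_assoc)
  moreover have "T 3 \<eta> = T 3 \<gamma> \<otimes> T 3 \<alpha>"
    using T_add[of 3 \<alpha> \<gamma>] T_comm[of 3 \<alpha> \<gamma>] eta_split a_TD g_TD by simp
  ultimately have "T 3 \<eta> = T 1 \<alpha> \<otimes> T 3 \<eta> \<otimes> inv (T 1 \<alpha>)"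
    by simp
  then have "T 3 \<eta> \<otimes> T 1 \<alpha> = T 1 \<alpha> \<otimes> T 3 \<eta>"
    using cl by (metis inv_closed inv_solve_right m_closed insertI1 insert_commute)
  then have "T 3 \<eta> \<otimes> inv (T 1 \<alpha>) = inv (T 1 \<alpha>) \<otimes> T 3 \<eta>"
    using cl by (intro commute_inv) auto
  then have "T 3 \<eta> \<otimes> (T 1 \<eta> \<otimes> inv (T 1 \<alpha>)) = T 1 \<eta> \<otimes> inv (T 1 \<alpha>) \<otimes> T 3 \<eta>"
    using cl T_eta_commute by (intro commute_mult) auto
  then have "T 3 \<eta> \<otimes> T 1 \<gamma> = T 1 \<gamma> \<otimes> T 3 \<eta>"
    using T_diff[of 1 \<eta> \<alpha>] a_TD TD_eta gam by simp
  \<comment> \<open>Conjugation by s_i exchanges \<eta> and \<gamma>, and with them the roles of the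
    two copies.\<close>
  then have "?s \<otimes> (T 3 \<eta> \<otimes> T 1 \<gamma>) \<otimes> ?s = ?s \<otimes> (T 1 \<gamma> \<otimes> T 3 \<eta>) \<otimes> ?s"
    by simp
  moreover have "root_refl n A i \<gamma> = \<eta>"
    by (simp add: \<gamma>_def root_refl_root_refl[OF i'(1)])
  then have "T 1 \<eta> = ?s \<otimes> T 1 \<gamma> \<otimes> ?s"
    using T_root_refl[of 1 i \<gamma>] i g_TD by simp
  ultimately show ?thesis
    unfolding \<gamma>_def[symmetric]
    using T_root_refl[of 3 i \<eta>] i TD_eta s cl involution_cancel[OF s(2,1)]
    by (simp add: \<gamma>_def[symmetric] m_assoc)
qed


text \<open>s_0 and s_\<theta> are reflections with the same functional up to sign conventions of
  their roots \<alpha>_0 and -\<eta>, which have equal pairings; so all four combinations fall under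
  one orthogonality.\<close>

lemma act_conj_commute:
  assumes i: "i \<in> {1..n}" "laces A 0 i = 2" and uv: "u \<in> {[0], w}" "v \<in> {[0], w}"
  shows "act n A (u @ [i] @ v @ [i]) = act n A ([i] @ v @ [i] @ u)"
proof -
  have neg: "Mat (\<lambda>k. - \<eta> k) j = of_int (A j 0)" if "j \<le> n" for j
    using matrix_apply_scale[of n A "-1" \<eta> j] Mat_eta[OF that] by simp
  have refl: "\<exists>a. act n A u = aff_refl (\<lambda>x. Mat x 0 + 0) a \<and> Mat a 0 = 2 \<and> Mat a i = of_int (A i 0)"
    if "u \<in> {[0], w}" for u
    using that
  proof (elim insertE emptyE)
    assume "u = [0]"
    then show ?thesis
      using i diag[of 0] matrix_apply_simple_root[of 0 n A]
      by (intro exI[of _ "simple_root 0"]) (auto simp: root_refl_def)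
  next
    assume "u = w"
    then show ?thesis
      using i diag[of 0] neg by (intro exI[of _ "\<lambda>k. - \<eta> k"]) (auto simp: act_w_aff_refl)
  qed
  obtain a b where "act n A u = aff_refl (\<lambda>x. Mat x 0 + 0) a" "Mat a 0 = 2" "Mat a i = of_int (A i 0)"
      "act n A v = aff_refl (\<lambda>x. Mat x 0 + 0) b" "Mat b 0 = 2" "Mat b i = of_int (A i 0)"
    using refl uv by metis
  then show ?thesis
    using aff_refl_conj_commute[OF i, of a b _ 0 _ 0] by (simp add: comp_assoc)
qed

text \<open>Both translations are products: \<open>T 1 \<eta>\<close> of
  \<open>s\<^sub>0\<^sub>1\<close> and s_\<theta>, the other one of the conjugates by s_i of
  \<open>s\<^sub>0\<^sub>3\<close> and s_\<theta>. The factors commute in pairs. Relation b) is the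
  pair that mixes the copies; the other three pairs lie in a single copy and follow from
  faithfulness.\<close>

lemma double_lace_commute:
  assumes i: "i \<in> {1..n}" and lace: "laces A 0 i = 2"
  shows "T 1 \<eta> \<otimes> T 3 (root_refl n A i \<eta>) = T 3 (root_refl n A i \<eta>) \<otimes> T 1 \<eta>"
proof -
  let ?s = "g (Node i)" and ?a = "g (Affine 1)" and ?d = "g (Affine 3)"
  have s: "?s \<in> carrier G" "?s \<otimes> ?s = \<one>"
    using in_S(4)[OF i] g_square by auto
  have i': "i \<le> n"
    using i by simp
  have P: "P k (u @ [i] @ v @ [i]) = P k u \<otimes> (?s \<otimes> (P k v \<otimes> ?s))"
    "P k ([i] @ v @ [i] @ u) = ?s \<otimes> (P k v \<otimes> ?s) \<otimes> P k u"
    if "k \<in> {1, 2, 3}" "set u \<subseteq> {..n}" "set v \<subseteq> {..n}" for k u v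
    using that i' s P_Node[OF i, of k]
      P_append[of k u "[i] @ v @ [i]"] P_append[of k "[i]" "v @ [i]"] P_append[of k v "[i]"]
      P_append[of k "[i]" "v @ [i] @ u"] P_append[of k v "[i] @ u"] P_append[of k "[i]" u]
    by (simp_all add: m_assoc)
  have comm: "P k u \<otimes> (?s \<otimes> (P k v \<otimes> ?s)) = ?s \<otimes> (P k v \<otimes> ?s) \<otimes> P k u"
    if k: "k \<in> {1, 2, 3}" and uv: "u \<in> {[0], w}" "v \<in> {[0], w}" for k u v
  proof -
    have "set u \<subseteq> {..n}" "set v \<subseteq> {..n}"
      using uv w_set(2) by auto
    then show ?thesis
      using P_eq[OF k _ _ act_conj_commute[OF i lace uv]] P[OF k] i' by simp
  qed
  have P0: "P k [0] = g (Affine k)" if "k \<in> {1, 2, 3}" for k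
    using that in_S by (auto simp: gen_node_def)
  have Pw: "P k w = p" for k
    by (simp add: p_def P_finite[OF w_set(1), of k])
  have ad: "?a \<otimes> (?s \<otimes> (?d \<otimes> ?s)) = ?s \<otimes> (?d \<otimes> ?s) \<otimes> ?a"
    using g_double_lace[OF i lace] s in_S by (simp add: m_assoc)
  have ap: "?a \<otimes> (?s \<otimes> (p \<otimes> ?s)) = ?s \<otimes> (p \<otimes> ?s) \<otimes> ?a"
    using comm[of 1 "[0]" w] P0[of 1] Pw[of 1] by simp
  have pd: "p \<otimes> (?s \<otimes> (?d \<otimes> ?s)) = ?s \<otimes> (?d \<otimes> ?s) \<otimes> p"
    using comm[of 3 w "[0]"] P0[of 3] Pw[of 3] by simp
  have pp: "p \<otimes> (?s \<otimes> (p \<otimes> ?s)) = ?s \<otimes> (p \<otimes> ?s) \<otimes> p"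
    using comm[of 1 w w] Pw[of 1] by simp
  define D where "D = ?s \<otimes> (?d \<otimes> ?s)"
  define E where "E = ?s \<otimes> (p \<otimes> ?s)"
  have DE: "D \<in> carrier G" "E \<in> carrier G"
    using s in_S by (auto simp: D_def E_def)
  have "D \<otimes> E \<otimes> ?a = ?a \<otimes> (D \<otimes> E)" "D \<otimes> E \<otimes> p = p \<otimes> (D \<otimes> E)"
    using ad ap pd pp DE in_S by (auto intro: commute_mult[symmetric] simp: D_def[symmetric] E_def[symmetric])
  then have "D \<otimes> E \<otimes> (?a \<otimes> p) = ?a \<otimes> p \<otimes> (D \<otimes> E)"
    using DE in_S by (intro commute_mult) auto
  moreover have "D \<otimes> E = T 3 (root_refl n A i \<eta>)"
    using s in_S involution_cancel[OF s(2,1)] T_root_refl[of 3 i \<eta>] i TD_eta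
    by (simp add: D_def E_def T_eta m_assoc)
  ultimately show ?thesis
    by (simp add: T_eta)
qed

text \<open>The set of admissible \<beta> is fed into \<open>generation\<close>. Stability is
  available only for nodes not joined to 0: these fix \<eta>, so s_i commutes with
  \<open>T 1 \<eta>\<close>.\<close>

lemma T_commute:
  assumes "\<beta> \<in> L"
  shows "T 1 \<eta> \<otimes> T 3 \<beta> = T 3 \<beta> \<otimes> T 1 \<eta>"
proof -
  define M where "M = {\<beta> \<in> TD. T 1 \<eta> \<otimes> T 3 \<beta> = T 3 \<beta> \<otimes> T 1 \<eta>}"
  have "L \<subseteq> M"
  proof (rule generation)
    show "\<eta> \<in> M"
      using T_eta_commute by (simp add: M_def TD_eta)
  next
    fix x y assume "x \<in> M" "y \<in> M"
    then show "(\<lambda>k. x k - y k) \<in> M"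
      unfolding M_def by (auto simp: TD_diff T_diff TD_eta intro!: commute_mult commute_inv)
  next
    fix i assume i: "i \<in> {1..n}" and "laces A 0 i \<in> {1, 2}"
    then show "root_refl n A i \<eta> \<in> M"
      unfolding M_def using TD_root_refl[OF i TD_eta] single_lace_commute double_lace_commute by auto
  next
    fix i x assume i: "i \<in> {1..n}" and lace: "laces A 0 i = 0" and x: "x \<in> M"
    have s: "g (Node i) \<in> carrier G" "g (Node i) \<otimes> g (Node i) = \<one>"
      using in_S(4)[OF i] g_square by auto
    have "T 1 \<eta> = g (Node i) \<otimes> T 1 \<eta> \<otimes> g (Node i)"
      using T_root_refl[of 1 i \<eta>] i TD_eta root_refl_eta_fixed[OF i lace] by simp
    then have "T 1 \<eta> \<otimes> g (Node i) = g (Node i) \<otimes> T 1 \<eta> \<otimes> g (Node i) \<otimes> g (Node i)"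
      by simp
    then have "T 1 \<eta> \<otimes> g (Node i) = g (Node i) \<otimes> T 1 \<eta>"
      using s TD_eta by (simp add: m_assoc)
    then have "T 1 \<eta> \<otimes> (g (Node i) \<otimes> T 3 x \<otimes> g (Node i)) = g (Node i) \<otimes> T 3 x \<otimes> g (Node i) \<otimes> T 1 \<eta>"
      using x s TD_eta by (intro commute_mult) (auto simp: M_def)
    then show "root_refl n A i x \<in> M"
      using x i by (simp add: M_def TD_root_refl T_root_refl)
  qed
  then show ?thesis
    using assms by (auto simp: M_def)
qed

section \<open>Normal form\<close>

definition normal_form :: "'a \<Rightarrow> bool" where
  "normal_form y \<longleftrightarrow> (\<exists>\<beta>\<in>L. \<exists>u. set u \<subseteq> {..n} \<and> y = T 3 \<beta> \<otimes> P 1 u)"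

lemma normal_form_Node:
  assumes "i \<in> {1..n}" "normal_form y"
  shows "normal_form (g (Node i) \<otimes> y)"
proof -
  obtain \<beta> u where u: "\<beta> \<in> L" "\<beta> \<in> TD" "set u \<subseteq> {..n}" "y = T 3 \<beta> \<otimes> P 1 u"
    using assms(2) lattice_TD by (auto simp: normal_form_def)
  have s: "g (Node i) \<in> carrier G" "g (Node i) \<otimes> g (Node i) = \<one>"
    using in_S(4)[OF assms(1)] g_square by auto
  have "g (Node i) \<otimes> y = T 3 (root_refl n A i \<beta>) \<otimes> P 1 ([i] @ u)"
    using P_append[of 1 "[i]" u] P_Node[of i 1] assms(1) u s involution_cancel[OF s(2,1)]
    by (simp add: T_root_refl m_assoc)
  then show ?thesis
    unfolding normal_form_def using root_refl_lattice[OF assms(1) u(1)] u(3) assms(1)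
    by (intro bexI[of _ "root_refl n A i \<beta>"] exI[of _ "[i] @ u"]) auto
qed

lemma normal_form_finite: "set v \<subseteq> {1..n} \<Longrightarrow> normal_form y \<Longrightarrow> y \<in> carrier G \<Longrightarrow> normal_form (P 1 v \<otimes> y)"
proof (induction v)
  case (Cons i v)
  have "P 1 (i # v) \<otimes> y = g (Node i) \<otimes> (P 1 v \<otimes> y)"
    using Cons.prems in_S(4)[of i] P_closed[of 1 v] by (auto simp: gen_node_def m_assoc subset_iff)
  then show ?case
    using Cons normal_form_Node by simp
qed simp

text \<open>Write \<open>s\<^sub>0\<^sub>k\<close> as \<open>T k \<eta>\<close> times s_\<theta>.
  Moving s_\<theta> past \<open>T 3 \<beta>\<close> replaces \<beta> by s_\<theta>(\<beta>). For k =
  1 the translation then passes by \<open>T_commute\<close>, for k = 3 it is absorbed by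
  additivity.\<close>

lemma normal_form_Affine:
  assumes "normal_form y"
  shows "normal_form (g (Affine 1) \<otimes> y)" "normal_form (g (Affine 3) \<otimes> y)"
proof -
  obtain \<beta> u where u: "\<beta> \<in> L" "\<beta> \<in> TD" "set u \<subseteq> {..n}" "y = T 3 \<beta> \<otimes> P 1 u"
    using assms lattice_TD by (auto simp: normal_form_def)
  define \<gamma> where "\<gamma> = act n A w \<beta>"
  have g: "\<gamma> \<in> L" "\<gamma> \<in> TD"
    unfolding \<gamma>_def using act_lattice[OF w_set(1)] TD_act[OF w_set(1)] u by auto
  have py: "p \<otimes> y = T 3 \<gamma> \<otimes> (p \<otimes> P 1 u)"
    using u T_act_w[of 3 \<beta>] involution_cancel[OF p_square p_closed] by (simp add: \<gamma>_def m_assoc)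
  have y: "y \<in> carrier G"
    using u by simp
  have "g (Affine 1) \<otimes> y = T 1 \<eta> \<otimes> (p \<otimes> y)"
    using y TD_eta g_Affine[of 1] by (simp add: m_assoc)
  also have "\<dots> = T 1 \<eta> \<otimes> T 3 \<gamma> \<otimes> (p \<otimes> P 1 u)"
    unfolding py using u g TD_eta by (simp add: m_assoc)
  also have "\<dots> = T 3 \<gamma> \<otimes> T 1 \<eta> \<otimes> (p \<otimes> P 1 u)"
    unfolding T_commute[OF g(1)] ..
  also have "\<dots> = T 3 \<gamma> \<otimes> (g (Affine 1) \<otimes> P 1 u)"
    using u g TD_eta g_Affine[of 1] by (simp add: m_assoc)
  also have "g (Affine 1) \<otimes> P 1 u = P 1 (0 # u)"
    by (simp add: gen_node_def)
  finally show "normal_form (g (Affine 1) \<otimes> y)"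
    unfolding normal_form_def using g u by (intro bexI[of _ \<gamma>] exI[of _ "0 # u"]) auto
  have "g (Affine 3) \<otimes> y = T 3 \<eta> \<otimes> (p \<otimes> y)"
    using y TD_eta by (simp add: g_Affine[of 3] m_assoc)
  also have "\<dots> = T 3 (\<lambda>k. \<eta> k + \<gamma> k) \<otimes> P 1 (w @ u)"
    unfolding py using u g TD_eta P_append[of 1 w u] w_set(2) by (simp add: T_add p_def m_assoc)
  finally show "normal_form (g (Affine 3) \<otimes> y)"
    unfolding normal_form_def using g u w_set(2) lattice_add[OF eta g(1)]
    by (intro bexI[of _ "\<lambda>k. \<eta> k + \<gamma> k"] exI[of _ "w @ u"]) auto
qed

text \<open>Left multiplication by each generator preserves the normal form;
  \<open>s\<^sub>0\<^sub>2\<close> is treated as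
  \<open>s\<^sub>0\<^sub>1 s\<^sub>\<theta> s\<^sub>0\<^sub>3\<close>.\<close>

lemma normal_form_word:
  "set xs \<subseteq> S \<Longrightarrow> normal_form (word_prod G g xs)"
proof (induction xs)
  case Nil
  then show ?case
    unfolding normal_form_def using lattice_zero T_zero[of 3]
    by (intro bexI[of _ "\<lambda>k. 0"] exI[of _ "[]"]) auto
next
  case (Cons x xs)
  have y: "word_prod G g xs \<in> carrier G"
    using Cons.prems by (intro word_prod_closed) auto
  have nf: "normal_form (word_prod G g xs)"
    using Cons by simp
  have "(\<exists>i\<in>{1..n}. x = Node i) \<or> x = Affine 1 \<or> x = Affine 3 \<or> x = Affine 2"
    using Cons.prems by (auto simp: generators_def)
  then have "normal_form (g x \<otimes> word_prod G g xs)"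
  proof (elim disjE bexE)
    assume x: "x = Affine 2"
    have "g x \<otimes> word_prod G g xs = g (Affine 1) \<otimes> (p \<otimes> (g (Affine 3) \<otimes> word_prod G g xs))"
      using y in_S by (simp add: x g_Affine_2 m_assoc)
    then show ?thesis
      using normal_form_Affine(1)[OF normal_form_finite[OF w_set(1) normal_form_Affine(2)[OF nf]]] y in_S
      by (simp add: p_def)
  qed (use nf normal_form_Node normal_form_Affine in auto)
  then show ?case
    by simp
qed

end


lemma word_prod_hom:
  assumes h: "h \<in> hom G H" and G: "group G" and H: "group H"
    and f: "f \<in> S \<rightarrow> carrier G" and "u \<in> words S"
  shows "word_prod H (signed H (\<lambda>x. h (f x))) u = h (word_prod G (signed G f) u)"
  using assms(5)
proof (induction u)
  case Nil
  then show ?case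
    using hom_one[OF h G H] by simp
next
  case (Cons y u)
  interpret h: group_hom G H h
    using h G H by (simp add: group_hom_def group_hom_axioms_def)
  obtain x b where y: "y = (x, b)" "x \<in> S" "u \<in> words S"
    using Cons.prems by (cases y) auto
  have "f x \<in> carrier G" "word_prod G (signed G f) u \<in> carrier G"
    using y f h.G.word_prod_signed_closed[OF f] by auto
  then show ?case
    using Cons.IH[OF y(3)] by (simp add: y(1) signed_def)
qed


section \<open>The presentations\<close>

context double_affine
begin

abbreviation "R \<equiv> double_affine_relations n A w"
abbreviation "R' \<equiv> elliptic_relations n A w"
abbreviation "N \<equiv> central_subgroup X n A"
abbreviation "cw \<equiv> central_word w"

lemma cw_in: "set cw \<subseteq> S"
  using w_set(1) by (auto simp: central_word_def generators_def)

lemma eval_central_word: "eval (pos_word cw) = tau \<delta>"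
  unfolding eval_pos_word by (rule gen_img_central)

lemma common_relation_eval:
  assumes "(u, v) \<in> braid_relations n A \<union> double_lace_relations n A \<union> order_two_relations n"
  shows "eval u = eval v"
proof -
  have Nil: "eval [] = \<one>\<^bsub>W\<^esub>"
    by simp
  show ?thesis
    using assms
  proof (elim UnE)
    assume "(u, v) \<in> braid_relations n A"
    then obtain m x y where "u = pos_word (alternating m x y)" "v = pos_word (alternating m y x)"
        "x \<in> S" "y \<in> S" "node x \<noteq> node y"
        "(laces A (node x) (node y), m) \<in> {(0, 2), (1, 3), (2, 4), (3, 6)}"
      unfolding braid_relations_def by blast
    then show ?thesis
      using gen_img_braid by (simp only: eval_pos_word)
  next
    assume "(u, v) \<in> double_lace_relations n A"
    then obtain i where "u = pos_word [Affine 1, Node i, Affine 3, Node i]"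
        "v = pos_word [Node i, Affine 3, Node i, Affine 1]" "i \<in> {1..n}" "laces A 0 i = 2"
      unfolding double_lace_relations_def by blast
    then show ?thesis
      using gen_img_double_lace by (simp only: eval_pos_word)
  next
    assume "(u, v) \<in> order_two_relations n"
    then obtain x where "u = pos_word [x, x]" "v = []" "x \<in> S"
      unfolding order_two_relations_def by blast
    then show ?thesis
      using gen_img_square gen_img_closed Nil by (simp add: eval_pos_word)
  qed
qed

lemma relation_eval:
  assumes "(u, v) \<in> R"
  shows "eval u = eval v"
proof (cases "(u, v) \<in> braid_relations n A \<union> double_lace_relations n A \<union> order_two_relations n")
  case False
  then obtain x where x: "u = pos_word (cw @ [x])" "v = pos_word (x # cw)" "x \<in> S"
    using assms unfolding double_affine_relations_def by blast
  have pos: "pos_word [x] \<in> words S" "pos_word cw \<in> words S"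
    using x(3) cw_in by auto
  have "u = pos_word cw @ pos_word [x]" "v = pos_word [x] @ pos_word cw"
    by (simp_all add: x pos_word_def)
  then show ?thesis
    using eval_append pos eval_central_word tau_delta_central[OF eval_closed[OF pos(1)]] by simp
qed (rule common_relation_eval)

abbreviation "PR \<equiv> presented_group S R"
abbreviation "PR' \<equiv> presented_group S R'"
abbreviation "c \<equiv> word_class S R (pos_word cw)"

lemma c_central:
  assumes "u \<in> words S"
  shows "c \<otimes>\<^bsub>PR\<^esub> word_class S R u = word_class S R u \<otimes>\<^bsub>PR\<^esub> c"
  using assms
proof (induction u)
  case Nil
  then show ?case
    using cw_in by (simp add: presented_mult)
next
  case (Cons y u)
  interpret PR: group PR
    by (rule group_presented_group)
  obtain x b where y: "y = (x, b)" "x \<in> S" "u \<in> words S"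
    using Cons.prems by (cases y) auto
  have c: "c \<in> carrier PR" and gx: "word_class S R [(x, True)] \<in> carrier PR"
    using cw_in y by auto
  have "(pos_word (cw @ [x]), pos_word (x # cw)) \<in> R"
    using y(2) unfolding double_affine_relations_def by blast
  then have "word_class S R (pos_word (cw @ [x])) = word_class S R (pos_word (x # cw))"
    using y(2) cw_in by (intro word_class_rel) auto
  then have pos: "c \<otimes>\<^bsub>PR\<^esub> word_class S R [(x, True)] = word_class S R [(x, True)] \<otimes>\<^bsub>PR\<^esub> c"
    using y(2) cw_in by (simp add: presented_mult) (simp add: pos_word_def)
  have signed: "word_class S R [y] = signed PR (\<lambda>x. word_class S R [(x, True)]) y"
    using word_class_conv_word_prod[of "[y]" S R] y gx by (auto simp: signed_def)
  have "c \<otimes>\<^bsub>PR\<^esub> word_class S R [y] = word_class S R [y] \<otimes>\<^bsub>PR\<^esub> c"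
    unfolding signed using pos PR.commute_inv[OF pos c gx] by (simp add: y signed_def)
  moreover have "word_class S R (y # u) = word_class S R [y] \<otimes>\<^bsub>PR\<^esub> word_class S R u"
    using presented_mult[of "[y]" S u R] y by simp
  moreover have "word_class S R [y] \<in> carrier PR" "word_class S R u \<in> carrier PR"
    using y by auto
  ultimately show ?case
    using PR.commute_mult[of c "word_class S R [y]" "word_class S R u"] Cons.IH y(3) c by simp
qed

lemma c_pow_central:
  assumes "x \<in> carrier PR"
  shows "x \<otimes>\<^bsub>PR\<^esub> c [^]\<^bsub>PR\<^esub> (m :: int) = c [^]\<^bsub>PR\<^esub> m \<otimes>\<^bsub>PR\<^esub> x"
proof -
  interpret PR: group PR
    by (rule group_presented_group)
  have c: "c \<in> carrier PR"
    using cw_in by auto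
  obtain u where u: "u \<in> words S" "x = word_class S R u"
    using assms by (rule presented_carrierE)
  have "x \<otimes>\<^bsub>PR\<^esub> c [^]\<^bsub>PR\<^esub> (k :: nat) = c [^]\<^bsub>PR\<^esub> k \<otimes>\<^bsub>PR\<^esub> x" for k
  proof (induction k)
    case (Suc k)
    then show ?case
      using PR.commute_mult[OF Suc, of c] c_central[OF u(1)] assms c by (simp add: u(2))
  qed (use assms in simp)
  then have nat: "x \<otimes>\<^bsub>PR\<^esub> c [^]\<^bsub>PR\<^esub> int k = c [^]\<^bsub>PR\<^esub> int k \<otimes>\<^bsub>PR\<^esub> x" for k
    by (simp add: int_pow_int)
  show ?thesis
  proof (cases m rule: int_cases2)
    case (nonneg k)
    then show ?thesis using nat by simp
  next
    case (nonpos k)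
    then show ?thesis
      using PR.commute_inv[OF nat assms] c by (simp add: PR.int_pow_neg)
  qed
qed

text \<open>The elliptic presentation adds to the double affine one only that \<open>c\<close> is
  trivial. Since \<open>c\<close> is central there, the powers of \<open>c\<close> that arise in a
  derivation can be collected in front.\<close>

lemma elliptic_cong_lift:
  assumes "(u, v) \<in> word_cong S R'"
  shows "\<exists>m :: int. word_class S R u = c [^]\<^bsub>PR\<^esub> m \<otimes>\<^bsub>PR\<^esub> word_class S R v"
proof -
  interpret PR: group PR
    by (rule group_presented_group)
  have c: "c \<in> carrier PR"
    using cw_in by auto
  have triv: "\<exists>m :: int. word_class S R u = c [^]\<^bsub>PR\<^esub> m \<otimes>\<^bsub>PR\<^esub> word_class S R v"
    if "word_class S R u = word_class S R v" "v \<in> words S" for u v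
    using that c by (intro exI[of _ 0]) (simp add: presented_carrierI)
  show ?thesis
    using assms
  proof (induction rule: word_cong.induct)
    case (refl u)
    then show ?case by (intro triv) auto
  next
    case (sym u v)
    then obtain m :: int where "word_class S R u = c [^]\<^bsub>PR\<^esub> m \<otimes>\<^bsub>PR\<^esub> word_class S R v"
      by blast
    then have "word_class S R v = c [^]\<^bsub>PR\<^esub> (- m) \<otimes>\<^bsub>PR\<^esub> word_class S R u"
      using c word_cong_in_words[OF sym.hyps]
      by (simp add: PR.int_pow_neg presented_carrierI PR.m_assoc[symmetric])
    then show ?case by blast
  next
    case (trans u v t)
    then obtain m m' :: int where "word_class S R u = c [^]\<^bsub>PR\<^esub> m \<otimes>\<^bsub>PR\<^esub> word_class S R v"
        "word_class S R v = c [^]\<^bsub>PR\<^esub> m' \<otimes>\<^bsub>PR\<^esub> word_class S R t"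
      by blast
    then have "word_class S R u = c [^]\<^bsub>PR\<^esub> (m + m') \<otimes>\<^bsub>PR\<^esub> word_class S R t"
      using c word_cong_in_words[OF trans.hyps(2)]
      by (simp add: PR.int_pow_mult presented_carrierI PR.m_assoc)
    then show ?case by blast
  next
    case (app u u' v v')
    then obtain m m' :: int where m: "word_class S R u = c [^]\<^bsub>PR\<^esub> m \<otimes>\<^bsub>PR\<^esub> word_class S R u'"
        "word_class S R v = c [^]\<^bsub>PR\<^esub> m' \<otimes>\<^bsub>PR\<^esub> word_class S R v'"
      by blast
    have in_words: "u \<in> words S" "v \<in> words S" "u' \<in> words S" "v' \<in> words S"
      using app.hyps word_cong_in_words by blast+
    have cl: "word_class S R u' \<in> carrier PR" "word_class S R v' \<in> carrier PR"
      using in_words by auto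
    have "word_class S R (u @ v) = word_class S R u \<otimes>\<^bsub>PR\<^esub> word_class S R v"
      using in_words by (simp add: presented_mult)
    also have "\<dots> = c [^]\<^bsub>PR\<^esub> m \<otimes>\<^bsub>PR\<^esub> (word_class S R u' \<otimes>\<^bsub>PR\<^esub> c [^]\<^bsub>PR\<^esub> m') \<otimes>\<^bsub>PR\<^esub> word_class S R v'"
      unfolding m using c cl by (simp add: PR.m_assoc)
    also have "\<dots> = c [^]\<^bsub>PR\<^esub> (m + m') \<otimes>\<^bsub>PR\<^esub> (word_class S R u' \<otimes>\<^bsub>PR\<^esub> word_class S R v')"
      unfolding c_pow_central[OF cl(1)] using c cl by (simp add: PR.m_assoc PR.int_pow_mult)
    also have "word_class S R u' \<otimes>\<^bsub>PR\<^esub> word_class S R v' = word_class S R (u' @ v')"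
      using in_words by (simp add: presented_mult)
    finally show ?case by blast
  next
    case (cancel x b)
    then show ?case
      by (intro triv) (auto simp: word_class_eq_iff intro: word_cong.cancel)
  next
    case (rel u v)
    then consider "(u, v) \<in> R" | "u = pos_word cw" "v = []"
      unfolding elliptic_relations_def double_affine_relations_def by blast
    then show ?case
    proof cases
      case 1
      then show ?thesis
        using rel by (intro triv word_class_rel) auto
    next
      case 2
      then show ?thesis
        using c by (intro exI[of _ 1]) (simp add: presented_one[symmetric])
    qed
  qed
qed

abbreviation "\<phi> \<equiv> presented_map W gen_img"

lemma phi_word_class: "u \<in> words S \<Longrightarrow> \<phi> (word_class S R u) = eval u"
  by (rule W.presented_map_word_class[OF gen_img_Pi]) (rule relation_eval)

lemma phi_hom: "\<phi> \<in> hom PR W"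
  by (rule W.presented_map_hom[OF gen_img_Pi]) (rule relation_eval)

lemma phi_c_pow:
  assumes "u \<in> words S"
  shows "\<phi> (c [^]\<^bsub>PR\<^esub> (m :: int) \<otimes>\<^bsub>PR\<^esub> word_class S R u) = tau (\<lambda>k. of_int m * \<delta> k) \<otimes>\<^bsub>W\<^esub> eval u"
proof -
  interpret PR: group PR
    by (rule group_presented_group)
  have c: "c \<in> carrier PR"
    using cw_in by auto
  then have "\<phi> (c [^]\<^bsub>PR\<^esub> m) = tau (\<lambda>k. of_int m * \<delta> k)"
    using hom_int_pow[OF phi_hom c PR.is_group W.is_group] phi_word_class[of "pos_word cw"] cw_in
    by (simp add: eval_central_word tau_delta_pow)
  then show ?thesis
    using hom_mult[OF phi_hom, of "c [^]\<^bsub>PR\<^esub> m" "word_class S R u"] c assms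
    by (simp add: presented_carrierI phi_word_class)
qed

lemma elliptic_images_presented:
  "elliptic_images n A X \<eta> e w PR' (\<lambda>x. word_class S R' [(x, True)])"
proof -
  interpret PR': group PR'
    by (rule group_presented_group)
  have rel: "word_prod PR' (\<lambda>x. word_class S R' [(x, True)]) xs =
      word_prod PR' (\<lambda>x. word_class S R' [(x, True)]) ys"
    if "(pos_word xs, pos_word ys) \<in> R'" "set xs \<subseteq> S" "set ys \<subseteq> S" for xs ys
    using that word_class_rel[OF that(1), of S] by (simp add: word_class_pos_word)
  show ?thesis
  proof unfold_locales
    fix x assume x: "x \<in> S"
    then show cl: "word_class S R' [(x, True)] \<in> carrier PR'"
      by auto
    have "(pos_word [x, x], pos_word []) \<in> R'"
      using x unfolding elliptic_relations_def order_two_relations_def by (auto simp: pos_word_def)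
    from rel[OF this] show "word_class S R' [(x, True)] \<otimes>\<^bsub>PR'\<^esub> word_class S R' [(x, True)] = \<one>\<^bsub>PR'\<^esub>"
      using x cl by simp
  next
    fix x y and m :: nat
    assume xy: "x \<in> S" "y \<in> S" "node x \<noteq> node y"
      "(laces A (node x) (node y), m) \<in> {(0, 2), (1, 3), (2, 4), (3, 6)}"
    then have "(pos_word (alternating m x y), pos_word (alternating m y x)) \<in> R'"
      unfolding elliptic_relations_def braid_relations_def by blast
    then show "word_prod PR' (\<lambda>x. word_class S R' [(x, True)]) (alternating m x y) =
        word_prod PR' (\<lambda>x. word_class S R' [(x, True)]) (alternating m y x)"
      using set_alternating[of m x y] set_alternating[of m y x] xy by (intro rel) auto
  next
    fix i assume i: "i \<in> {1..n}" "laces A 0 i = 2"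
    then have "(pos_word [Affine 1, Node i, Affine 3, Node i],
        pos_word [Node i, Affine 3, Node i, Affine 1]) \<in> R'"
      unfolding elliptic_relations_def double_lace_relations_def by blast
    then show "word_prod PR' (\<lambda>x. word_class S R' [(x, True)]) [Affine 1, Node i, Affine 3, Node i] =
        word_prod PR' (\<lambda>x. word_class S R' [(x, True)]) [Node i, Affine 3, Node i, Affine 1]"
      using i by (intro rel) (auto simp: generators_def)
  next
    have "(pos_word cw, pos_word []) \<in> R'"
      unfolding elliptic_relations_def by (auto simp: pos_word_def)
    from rel[OF this cw_in] show "word_prod PR' (\<lambda>x. word_class S R' [(x, True)]) cw = \<one>\<^bsub>PR'\<^esub>"
      by simp
  qed
qed

text \<open>The power m is left arbitrary: m = 0 serves the double affine presentation, general m
  the kernel of the map to the elliptic quotient. The normal form is found in \<open>PR'\<close>,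
  lifted to \<open>PR\<close> up to a power of \<open>c\<close>, and evaluated in
  \<open>W\<close>.\<close>

lemma elliptic_kernel:
  assumes u: "u \<in> words S" and eval_u: "eval u = tau (\<lambda>k. of_int m * \<delta> k)"
  shows "(u, []) \<in> word_cong S R'"
proof -
  define g where "g x = word_class S R' [(x, True)]" for x
  interpret E: elliptic_images n A X \<eta> e w PR' g
    unfolding g_def by (rule elliptic_images_presented)
  have "word_class S R' u = word_prod PR' (signed PR' g) u"
    using word_class_conv_word_prod[OF u, of R'] by (simp add: g_def[abs_def])
  also have "\<dots> = word_prod PR' (\<lambda>y. g (fst y)) u"
    using words_fst[OF u] E.involution_inv[OF E.g_square E.g_closed]
    by (intro word_prod_cong) (force simp: signed_def)
  also have "\<dots> = word_prod PR' g (map fst u)"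
    by (simp add: word_prod_map)
  finally have cu: "word_class S R' u = word_prod PR' g (map fst u)" .
  have "E.normal_form (word_class S R' u)"
    unfolding cu using words_fst[OF u] by (intro E.normal_form_word) auto
  then obtain \<beta> u' where \<beta>: "\<beta> \<in> L" and u': "set u' \<subseteq> {..n}"
    and nf: "word_class S R' u = E.T 3 \<beta> \<otimes>\<^bsub>PR'\<^esub> word_prod PR' g (map (gen_node 1) u')"
    unfolding E.normal_form_def by blast
  obtain v where v: "set v \<subseteq> {..n}" "act n A v = transl \<beta>"
      "word_prod W gen_img (map (gen_node 3) v) = tau \<beta>"
    using lattice_translation_words[OF \<beta>] by blast
  let ?x = "map (gen_node 3) v" and ?y = "map (gen_node 1) u'"
  have xy: "set ?x \<subseteq> S" "set ?y \<subseteq> S"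
    using gen_node_in v(1) u' by blast+
  have "word_class S R' u = word_class S R' (pos_word ?x) \<otimes>\<^bsub>PR'\<^esub> word_class S R' (pos_word ?y)"
    unfolding nf E.T_eq[OF _ v(1,2), of 3, simplified] word_class_pos_word[OF xy(1)]
      word_class_pos_word[OF xy(2)] g_def ..
  then have "word_class S R' u = word_class S R' (pos_word ?x @ pos_word ?y)"
    using xy by (simp add: presented_mult)
  then have "(u, pos_word ?x @ pos_word ?y) \<in> word_cong S R'"
    using xy u word_class_eq_iff[of u S "pos_word ?x @ pos_word ?y" R'] by simp
  then obtain k :: int where "word_class S R u = c [^]\<^bsub>PR\<^esub> k \<otimes>\<^bsub>PR\<^esub> word_class S R (pos_word ?x @ pos_word ?y)"
    using elliptic_cong_lift by blast
  then have "\<phi> (word_class S R u) = tau (\<lambda>j. of_int k * \<delta> j) \<otimes>\<^bsub>W\<^esub> eval (pos_word ?x @ pos_word ?y)"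
    using phi_c_pow[of "pos_word ?x @ pos_word ?y" k] xy by simp
  then have "eval u = tau (\<lambda>j. of_int k * \<delta> j) \<otimes>\<^bsub>W\<^esub> (tau \<beta> \<otimes>\<^bsub>W\<^esub> (\<lambda>j. 0, act n A u'))"
    using u xy word_prod_act[of u'] by (simp add: phi_word_class eval_append eval_pos_word v(3))
  \<comment> \<open>Components of the two pairs are compared: the Weyl group part of the normal form
    is trivial, and \<beta> is a multiple of \<delta>.\<close>
  then have fun_eq: "(\<lambda>j. of_int m * \<delta> j) = (\<lambda>j. of_int k * \<delta> j + \<beta> j)" and act_u': "act n A u' = id"
    unfolding eval_u by (simp_all add: tau_def W_mult)
  have eq: "of_int m * \<delta> j = of_int k * \<delta> j + \<beta> j" for j
    using fun_eq by (rule fun_cong)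
  \<comment> \<open>Vectors of the lattice have no \<alpha>_0-coordinate, whereas \<delta>, divided
    by a_0, has coordinate 1; this separates k from \<beta>.\<close>
  have "\<delta> 0 = 1"
    using lattice_0[OF eta] by (simp add: scaled_delta simple_root_def)
  then have "m = k"
    using eq[of 0] lattice_0[OF \<beta>] by simp
  then have "\<beta> = (\<lambda>j. 0)"
    using eq by auto
  then have "word_class S R' u = \<one>\<^bsub>PR'\<^esub>"
    unfolding nf using E.T_zero[of 3] E.P_eq[of 1 u' "[]"] u' act_u' by simp
  then show ?thesis
    using u by (simp add: presented_one word_class_eq_iff)
qed

text \<open>By \<open>elliptic_kernel\<close> the word is a power of \<open>c\<close>, and different
  powers of \<open>c\<close> have different images.\<close>

lemma kernel:
  assumes u: "u \<in> words S" and eval_u: "eval u = \<one>\<^bsub>W\<^esub>"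
  shows "(u, []) \<in> word_cong S R"
proof -
  interpret PR: group PR
    by (rule group_presented_group)
  have "(u, []) \<in> word_cong S R'"
    using elliptic_kernel[OF u, of 0] eval_u by (simp add: tau_zero)
  then obtain m :: int where m: "word_class S R u = c [^]\<^bsub>PR\<^esub> m \<otimes>\<^bsub>PR\<^esub> word_class S R []"
    using elliptic_cong_lift by blast
  then have "eval u = tau (\<lambda>k. of_int m * \<delta> k) \<otimes>\<^bsub>W\<^esub> eval []"
    using phi_c_pow[of "[]" m] phi_word_class[OF u] by simp
  then have "(\<lambda>k. of_int m * \<delta> k) = (\<lambda>k. 0)"
    by (simp add: eval_u tau_def W_mult W_one)
  then have "of_int m * \<delta> 0 = 0"
    by (rule fun_cong)
  moreover have "\<delta> 0 = 1"
    using lattice_0[OF eta] by (simp add: scaled_delta simple_root_def)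
  ultimately have "m = 0"
    by simp
  then show ?thesis
    using m u by (simp add: word_class_eq_iff presented_one[symmetric] presented_carrierI)
      (simp add: presented_one word_class_eq_iff)
qed

lemma N_eq: "N = {tau (\<lambda>k. of_int m * \<delta> k) | m :: int. True}"
  unfolding central_subgroup_def W.generate_pow[OF tau_closed[OF delta_Q]] tau_delta_pow by simp

lemma N_normal: "N \<lhd> W"
  unfolding W.normal_inv_iff
proof (intro conjI ballI)
  show "subgroup N W"
    unfolding central_subgroup_def using tau_closed[OF delta_Q] by (intro W.generate_is_subgroup) simp
  then interpret N: subgroup N W .
  fix x h assume x: "x \<in> carrier W" and h: "h \<in> N"
  have "x \<otimes>\<^bsub>W\<^esub> h = h \<otimes>\<^bsub>W\<^esub> x"
  proof -
    obtain m :: int where m: "h = tau (\<lambda>k. of_int m * \<delta> k)"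
      using h N_eq by blast
    show ?thesis
      using x unfolding m
      by (elim W_carrierE) (simp add: tau_def W_mult act_scale act_delta add.commute)
  qed
  then have "x \<otimes>\<^bsub>W\<^esub> h \<otimes>\<^bsub>W\<^esub> inv\<^bsub>W\<^esub> x = h"
    using x N.subset h by (simp add: W.m_assoc subset_iff)
  then show "x \<otimes>\<^bsub>W\<^esub> h \<otimes>\<^bsub>W\<^esub> inv\<^bsub>W\<^esub> x \<in> N"
    using h by simp
qed

text \<open>The elliptic isomorphism is built from the images of the generators followed by the
  projection modulo \<open>N\<close>, which makes its compatibility with the first isomorphism
  immediate.\<close>

theorem presentations:
  "\<exists>\<phi> \<in> iso PR W.
     (\<forall>i\<in>{1..n}. \<phi> (word_class S R (pos_word [Node i])) = weyl_elt (simple_reflection n A i)) \<and>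
     \<phi> (word_class S R (pos_word cw)) = tau \<delta> \<and>
     (\<exists>\<psi> \<in> iso PR' (elliptic_weyl X n A).
        \<forall>x\<in>S. \<psi> (word_class S R' (pos_word [x])) = N #>\<^bsub>W\<^esub> \<phi> (word_class S R (pos_word [x])))"
proof (rule bexI[of _ \<phi>], intro conjI ballI)
  show "\<phi> \<in> iso PR W"
    by (rule W.presented_map_iso[OF gen_img_Pi]) (use relation_eval eval_surj kernel in auto)
next
  fix i assume i: "i \<in> {1..n}"
  then have "\<phi> (word_class S R (pos_word [Node i])) = gen_img (Node i) \<otimes>\<^bsub>W\<^esub> \<one>\<^bsub>W\<^esub>"
    by (subst phi_word_class) (auto simp: eval_pos_word generators_def simp del: gen_img.simps)
  then show "\<phi> (word_class S R (pos_word [Node i])) = weyl_elt (simple_reflection n A i)"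
    using i act_zero[of n A "[i]"] by (simp add: W_mult W_one weyl_elt_def simple_reflection)
next
  show "\<phi> (word_class S R (pos_word cw)) = tau \<delta>"
    using cw_in by (subst phi_word_class) (auto simp: eval_central_word)
next
  interpret N: normal N W
    by (rule N_normal)
  let ?Q = "elliptic_weyl X n A"
  interpret Q: group ?Q
    unfolding elliptic_weyl_def by (rule N.factorgroup_is_group)
  define h where "h p = N #>\<^bsub>W\<^esub> p" for p
  have h: "h \<in> hom W ?Q"
    unfolding elliptic_weyl_def h_def[abs_def] by (rule N.r_coset_hom_Mod)
  have carrier_Q: "carrier ?Q = h ` carrier W"
    unfolding elliptic_weyl_def h_def[abs_def] by (rule carrier_FactGroup)
  have one_Q: "\<one>\<^bsub>?Q\<^esub> = N"
    unfolding elliptic_weyl_def by simp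
  have f: "(\<lambda>x. h (gen_img x)) \<in> S \<rightarrow> carrier ?Q"
    using gen_img_Pi carrier_Q by auto
  have eval_Q: "word_prod ?Q (signed ?Q (\<lambda>x. h (gen_img x))) u = h (eval u)" if "u \<in> words S" for u
    by (rule word_prod_hom[OF h W.is_group Q.is_group gen_img_Pi that])
  have h_iff: "h p = N \<longleftrightarrow> p \<in> N" if "p \<in> carrier W" for p
    unfolding h_def
    using W.coset_join1[OF _ that N.is_subgroup] W.coset_join2[OF that N.is_subgroup] by blast
  have rel: "word_prod ?Q (signed ?Q (\<lambda>x. h (gen_img x))) u =
      word_prod ?Q (signed ?Q (\<lambda>x. h (gen_img x))) v"
    if "(u, v) \<in> R'" "u \<in> words S" "v \<in> words S" for u v
  proof -
    have "h (eval u) = h (eval v)"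
    proof (cases "(u, v) \<in> braid_relations n A \<union> double_lace_relations n A \<union> order_two_relations n")
      case True
      then show ?thesis
        by (simp add: common_relation_eval)
    next
      case False
      then have uv: "u = pos_word cw" "v = []"
        using that(1) unfolding elliptic_relations_def by blast+
      have "tau \<delta> \<in> N"
        unfolding central_subgroup_def by (rule generate.incl) simp
      then show ?thesis
        using h_iff[of "tau \<delta>"] h_iff[of "\<one>\<^bsub>W\<^esub>"] tau_closed[OF delta_Q]
        by (simp add: uv eval_central_word)
    qed
    then show ?thesis
      using that eval_Q by simp
  qed
  have psi_iso: "presented_map ?Q (\<lambda>x. h (gen_img x)) \<in> iso PR' ?Q"
  proof (rule Q.presented_map_iso[OF f rel])
    fix q assume "q \<in> carrier ?Q"
    then obtain p where "p \<in> carrier W" "q = h p"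
      using carrier_Q by blast
    then obtain u where "u \<in> words S" "q = h (eval u)"
      using eval_surj by blast
    then show "\<exists>u\<in>words S. word_prod ?Q (signed ?Q (\<lambda>x. h (gen_img x))) u = q"
      using eval_Q by blast
  next
    fix u assume u: "u \<in> words S" and "word_prod ?Q (signed ?Q (\<lambda>x. h (gen_img x))) u = \<one>\<^bsub>?Q\<^esub>"
    then have "eval u \<in> N"
      using eval_Q one_Q h_iff eval_closed by simp
    then show "(u, []) \<in> word_cong S R'"
      using elliptic_kernel[OF u] unfolding N_eq by blast
  qed
  show "\<exists>\<psi> \<in> iso PR' ?Q.
      \<forall>x\<in>S. \<psi> (word_class S R' (pos_word [x])) = N #>\<^bsub>W\<^esub> \<phi> (word_class S R (pos_word [x]))"
  proof (rule bexI[OF _ psi_iso], intro ballI)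
    fix x assume x: "x \<in> S"
    then have x': "pos_word [x] \<in> words S"
      by simp
    have "presented_map ?Q (\<lambda>x. h (gen_img x)) (word_class S R' (pos_word [x])) = h (eval (pos_word [x]))"
      using Q.presented_map_word_class[OF f rel x'] eval_Q[OF x'] by simp
    then show "presented_map ?Q (\<lambda>x. h (gen_img x)) (word_class S R' (pos_word [x])) =
        N #>\<^bsub>W\<^esub> \<phi> (word_class S R (pos_word [x]))"
      by (simp only: h_def phi_word_class[OF x'])
  qed
qed

end


section \<open>Numerical labels\<close>

lemma numerical_labels_null:
  assumes "is_numerical_labels n A a" "i \<le> n"
  shows "matrix_apply n A (\<lambda>j. real (a j)) i = 0"
proof -
  have "real_of_int (\<Sum>j\<le>n. A i j * int (a j)) = 0"
    using assms by (simp add: is_numerical_labels_def)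
  then show ?thesis
    by (simp add: matrix_apply_def)
qed

text \<open>With a one-dimensional null space and a label equal to 1, any other labelling is an
  integral multiple of \<open>a\<close>; coprimality forces the factor 1.\<close>

lemma labels_eqI:
  fixes a :: "nat \<Rightarrow> nat"
  assumes u: "\<And>j. j \<le> n \<Longrightarrow> u j > 0"
    and null: "\<And>v. (\<And>i. i \<le> n \<Longrightarrow> matrix_apply n A v i = 0) \<Longrightarrow> \<exists>c. \<forall>j\<le>n. v j = c * u j"
    and a: "is_numerical_labels n A a" and l: "l \<le> n" "a l = 1"
  shows "labels n A = a"
  unfolding labels_def
proof (rule the_equality)
  show "is_numerical_labels n A a"
    by (rule a)
  fix b assume b: "is_numerical_labels n A b"
  obtain s t where s: "\<And>j. j \<le> n \<Longrightarrow> real (a j) = s * u j"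
    and t: "\<And>j. j \<le> n \<Longrightarrow> real (b j) = t * u j"
    using null[OF numerical_labels_null[OF a]] null[OF numerical_labels_null[OF b]] by auto
  have ratio: "b j = b l * a j" if "j \<le> n" for j
  proof -
    have "real (b j) * real (a l) = real (b l) * real (a j)"
      unfolding s[OF that] s[OF l(1)] t[OF that] t[OF l(1)] by simp
    then show ?thesis
      using l(2) by (simp flip: of_nat_mult)
  qed
  have "b l dvd Gcd (b ` {..n})"
    by (rule Gcd_greatest) (use ratio in \<open>auto intro: dvdI\<close>)
  then have "b l = 1"
    using b by (simp add: is_numerical_labels_def)
  then show "b = a"
    using ratio a b by (auto simp: is_numerical_labels_def fun_eq_iff) (metis linorder_not_le nat_mult_1)
qed

section \<open>Cartan matrices given by lists of edges\<close>

text \<open>The sum of -a_ij a_j over the neighbours j of i, taken over the edges. A vector is null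
  exactly when this is 2 a_i, and for concrete diagrams it evaluates without a sum over
  nodes.\<close>

definition weighted_row :: "edge list \<Rightarrow> (nat \<Rightarrow> int) \<Rightarrow> nat \<Rightarrow> int" where
  "weighted_row es a i = (\<Sum>(k, l, p, q)\<leftarrow>es. (if k = i then p * a l else 0) + (if l = i then q * a k else 0))"

lemma weighted_row_simps [simp]:
  "weighted_row [] a i = 0"
  "weighted_row ((k, l, p, q) # es) a i =
     (if k = i then p * a l else 0) + (if l = i then q * a k else 0) + weighted_row es a i"
  "weighted_row (es @ es') a i = weighted_row es a i + weighted_row es' a i"
  by (simp_all add: weighted_row_def)

lemma weighted_row_chain:
  "weighted_row (chain s t) a i =
     (if s \<le> i \<and> i < t then a (Suc i) else 0) + (if s < i \<and> i \<le> t then a (i - 1) else 0)"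
proof (cases "s \<le> t")
  case True
  then show ?thesis
    by (induction t rule: dec_induct) (auto simp: chain_def)
qed (simp add: chain_def)

definition edge_entry :: "edge list \<Rightarrow> nat \<Rightarrow> nat \<Rightarrow> int" where
  "edge_entry es i j = (\<Sum>(k, l, p, q)\<leftarrow>es. if k = i \<and> l = j then p else if k = j \<and> l = i then q else 0)"

lemma edge_entry_simps [simp]:
  "edge_entry [] i j = 0"
  "edge_entry ((k, l, p, q) # es) i j =
     (if k = i \<and> l = j then p else if k = j \<and> l = i then q else 0) + edge_entry es i j"
  "edge_entry (es @ es') i j = edge_entry es i j + edge_entry es' i j"
  by (simp_all add: edge_entry_def)

lemma edge_entry_chain:
  "edge_entry (chain s t) i j =
     (if s \<le> i \<and> i < t \<and> j = Suc i \<or> s \<le> j \<and> j < t \<and> i = Suc j then 1 else 0)"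
proof (cases "s \<le> t")
  case True
  then show ?thesis
    by (induction t rule: dec_induct) (auto simp: chain_def)
qed (simp add: chain_def)

lemma set_chain: "set (chain s t) = {(i, Suc i, 1, 1) | i. s \<le> i \<and> i < t}"
  by (auto simp: chain_def)

lemma kac_matrix_eq: "kac_matrix X i j = (if i = j then 2 else - edge_entry (kac_edges X) i j)"
  by (simp add: kac_matrix_def edge_entry_def)

lemma edge_entry_row:
  assumes "\<And>k l p q. (k, l, p, q) \<in> set es \<Longrightarrow> k \<noteq> l \<and> k \<le> n \<and> l \<le> n"
  shows "(\<Sum>j\<le>n. edge_entry es i j * a j) = weighted_row es a i"
  using assms
proof (induction es)
  case (Cons e es)
  obtain k l p q where e: "e = (k, l, p, q)"
    by (cases e)
  have kl: "k \<noteq> l" "k \<le> n" "l \<le> n"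
    using Cons.prems[of k l p q] by (auto simp: e)
  have IH: "(\<Sum>j\<le>n. edge_entry es i j * a j) = weighted_row es a i"
    by (rule Cons.IH) (use Cons.prems in auto)
  have "(\<Sum>j\<le>n. (if k = i \<and> l = j then p else if k = j \<and> l = i then q else 0) * a j) =
      (\<Sum>j\<le>n. (if j = l then (if k = i then p * a l else 0) else 0) +
        (if j = k then (if l = i then q * a k else 0) else 0))"
    using kl(1) by (intro sum.cong) auto
  also have "\<dots> = (if k = i then p * a l else 0) + (if l = i then q * a k else 0)"
    using kl by (simp add: sum.distrib)
  finally show ?case
    using IH by (simp add: e distrib_right sum.distrib)
qed simp

text \<open>Symmetrisability is an identity for each entry, so it may be checked edge by
  edge.\<close>

lemma edge_entry_sym:
  assumes "\<And>k l p q. (k, l, p, q) \<in> set es \<Longrightarrow> b k * a l * p = b l * a k * q" and "i \<noteq> j"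
  shows "b i * a j * edge_entry es i j = b j * a i * edge_entry es j i"
  using assms(1)
proof (induction es)
  case (Cons e es)
  obtain k l p q where e: "e = (k, l, p, q)"
    by (cases e)
  have "b k * a l * p = b l * a k * q"
    using Cons.prems[of k l p q] by (simp add: e)
  moreover have "b i * a j * edge_entry es i j = b j * a i * edge_entry es j i"
    using Cons.IH Cons.prems by simp
  ultimately show ?case
    using assms(2) by (auto simp: e distrib_left)
qed simp

section \<open>Tables of the numerical labels\<close>

text \<open>The last clause gives the labels of the types \<open>A1\<close> and \<open>D2\<close>;
  for the excluded types it is a default value and not Kac's label.\<close>

fun raw_label :: "kac_type \<Rightarrow> nat \<Rightarrow> nat" where
  "raw_label (D1 n) j = (if j \<in> {0, 1, n - 1, n} then 1 else 2)"
| "raw_label E6_1 j = [1, 1, 2, 3, 2, 1, 2] ! j"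
| "raw_label E7_1 j = [1, 2, 3, 4, 3, 2, 1, 2] ! j"
| "raw_label E8_1 j = [1, 2, 3, 4, 5, 6, 4, 2, 3] ! j"
| "raw_label (Aeven2 n) j = (if j = n then 1 else 2)"
| "raw_label (Aodd2 n) j = (if j \<in> {0, 1, n} then 1 else 2)"
| "raw_label E6_2 j = [1, 2, 3, 2, 1] ! j"
| "raw_label D4_3 j = [1, 2, 1] ! j"
| "raw_label _ j = 1"

fun raw_dual_label :: "kac_type \<Rightarrow> nat \<Rightarrow> nat" where
  "raw_dual_label (Aeven2 n) j = (if j = 0 then 1 else 2)"
| "raw_dual_label (Aodd2 n) j = (if j \<in> {0, 1} then 1 else 2)"
| "raw_dual_label (D2 n) j = (if j \<in> {0, n} then 1 else 2)"
| "raw_dual_label E6_2 j = [1, 2, 3, 4, 2] ! j"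
| "raw_dual_label D4_3 j = [1, 2, 3] ! j"
| "raw_dual_label X j = raw_label X j"

text \<open>The tables are cut off to 0 beyond the rank, as \<open>is_numerical_labels\<close>
  demands in order to determine a function.\<close>

definition kac_label :: "kac_type \<Rightarrow> nat \<Rightarrow> nat" where
  "kac_label X j = (if j \<le> kac_rank X then raw_label X j else 0)"

definition kac_dual_label :: "kac_type \<Rightarrow> nat \<Rightarrow> nat" where
  "kac_dual_label X j = (if j \<le> kac_rank X then raw_dual_label X j else 0)"

lemma exceptional_edges:
  "kac_edges E6_1 = [(1, 2, 1, 1), (2, 3, 1, 1), (3, 4, 1, 1), (4, 5, 1, 1), (3, 6, 1, 1), (0, 6, 1, 1)]"
  "kac_edges E7_1 = [(0, 1, 1, 1), (1, 2, 1, 1), (2, 3, 1, 1), (3, 4, 1, 1), (4, 5, 1, 1), (5, 6, 1, 1),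
     (3, 7, 1, 1)]"
  "kac_edges E8_1 = [(0, 1, 1, 1), (1, 2, 1, 1), (2, 3, 1, 1), (3, 4, 1, 1), (4, 5, 1, 1), (5, 6, 1, 1),
     (6, 7, 1, 1), (5, 8, 1, 1)]"
  by (simp_all add: chain_def upt_conv_Cons eval_nat_numeral)

declare kac_edges.simps(5-7) [simp del]

lemma le_numeral_cases:
  fixes i :: nat
  shows "i \<le> 2 \<longleftrightarrow> i = 0 \<or> i = 1 \<or> i = 2"
    and "i \<le> 4 \<longleftrightarrow> i = 0 \<or> i = 1 \<or> i = 2 \<or> i = 3 \<or> i = 4"
    and "i \<le> 6 \<longleftrightarrow> i = 0 \<or> i = 1 \<or> i = 2 \<or> i = 3 \<or> i = 4 \<or> i = 5 \<or> i = 6"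
    and "i \<le> 7 \<longleftrightarrow> i = 0 \<or> i = 1 \<or> i = 2 \<or> i = 3 \<or> i = 4 \<or> i = 5 \<or> i = 6 \<or> i = 7"
    and "i \<le> 8 \<longleftrightarrow> i = 0 \<or> i = 1 \<or> i = 2 \<or> i = 3 \<or> i = 4 \<or> i = 5 \<or> i = 6 \<or> i = 7 \<or> i = 8"
  by linarith+

lemma kac_edges_le:
  assumes "kac_admissible X" "(k, l, p, q) \<in> set (kac_edges X)"
  shows "k \<noteq> l \<and> k \<le> kac_rank X \<and> l \<le> kac_rank X"
  using assms by (cases X) (auto simp: set_chain exceptional_edges split: if_splits)

lemma kac_label_pos:
  assumes "\<not> excluded_type X" "j \<le> kac_rank X"
  shows "kac_label X j > 0" "kac_dual_label X j > 0"
  using assms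
  by (cases X; auto simp: kac_label_def kac_dual_label_def excluded_type_def le_numeral_cases)+

text \<open>The normalising entry required by \<open>labels_eqI\<close>. In type
  \<open>Aeven2\<close> node 0 has label 2, and node n is used instead.\<close>

lemma kac_label_one:
  assumes "kac_admissible X" "\<not> excluded_type X"
  shows "kac_label X (if \<exists>m. X = Aeven2 m then kac_rank X else 0) = 1" "kac_dual_label X 0 = 1"
  using assms by (cases X; simp add: kac_label_def kac_dual_label_def excluded_type_def)+

text \<open>The symmetry of the matrix with entries a_ij / d_i, after clearing denominators. It also
  makes the dual labels a null vector of the transpose.\<close>

lemma kac_edge_label_sym:
  assumes "kac_admissible X" "\<not> excluded_type X" "(k, l, p, q) \<in> set (kac_edges X)"
  shows "int (kac_dual_label X k) * int (kac_label X l) * p = int (kac_dual_label X l) * int (kac_label X k) * q"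
proof (cases X)
  case (Aeven2 n)
  then show ?thesis
    using assms by (auto simp: kac_dual_label_def kac_label_def set_chain split: if_splits)
next
  case (Aodd2 n)
  then show ?thesis
    using assms by (auto simp: kac_dual_label_def kac_label_def set_chain split: if_splits)
next
  case (D2 n)
  then show ?thesis
    using assms by (auto simp: kac_dual_label_def kac_label_def set_chain split: if_splits)
qed (use assms in \<open>auto simp: kac_dual_label_def kac_label_def excluded_type_def set_chain
      exceptional_edges split: if_splits\<close>)

lemma kac_weighted_row:
  assumes "kac_admissible X" "\<not> excluded_type X" "i \<le> kac_rank X"
  shows "weighted_row (kac_edges X) (\<lambda>j. int (kac_label X j)) i = 2 * int (kac_label X i)"
proof (cases X)
  case (A1 n)
  then show ?thesis
    using assms by (auto simp: kac_label_def weighted_row_chain)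
next
  case (D1 n)
  have n: "n \<ge> 4" and i: "i \<le> n"
    using assms D1 by auto
  define a where "a j = int (kac_label X j)" for j
  have a: "a 0 = 1" "a 1 = 1" "a (n - 1) = 1" "a n = 1" "\<And>j. 2 \<le> j \<Longrightarrow> j \<le> n - 2 \<Longrightarrow> a j = 2"
    using n by (auto simp: a_def D1 kac_label_def)
  have edges: "weighted_row (kac_edges X) a i =
      (if i = 0 then a 2 else 0) + (if i = 2 then a 0 else 0) +
      ((if 1 \<le> i \<and> i < n - 1 then a (Suc i) else 0) + (if 1 < i \<and> i \<le> n - 1 then a (i - 1) else 0)) +
      ((if i = n - 2 then a n else 0) + (if i = n then a (n - 2) else 0))"
    by (simp add: D1 weighted_row_chain eq_commute[of _ i])
  \<comment> \<open>The diagram forks at nodes 2 and n - 2, which coincide for n = 4; the positions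
    are separated by hand because of the truncated subtractions.\<close>
  consider "i = 0" | "i = 1" | "i = n - 1" | "i = n" | "2 \<le> i" "i \<le> n - 2"
    using i by linarith
  then have "weighted_row (kac_edges X) a i = 2 * a i"
  proof cases
    case 5
    have "a (Suc i) = (if i = n - 2 then 1 else 2)"
    proof (cases "i = n - 2")
      case True
      then have "Suc i = n - 1"
        using n by simp
      then show ?thesis
        using a(3) True by simp
    qed (use 5 a(5)[of "Suc i"] in simp)
    moreover have "a (i - 1) = (if i = 2 then 1 else 2)"
      using 5 a(2) a(5)[of "i - 1"] by auto
    ultimately show ?thesis
      unfolding edges using 5 a n by auto
  next
    case 3
    then have "i - 1 = n - 2" "i \<noteq> 0" "i \<noteq> 2" "i \<noteq> n - 2" "i \<noteq> n" "1 < i" "i \<le> n - 1" "\<not> i < n - 1"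
      using n by linarith+
    moreover have "a (n - 2) = 2"
      using n by (intro a(5)) linarith+
    ultimately show ?thesis
      unfolding edges using 3 a(3) by simp
  next
    case 1
    then show ?thesis
      unfolding edges using a(1) a(5)[of 2] n by simp
  next
    case 2
    then have "i \<noteq> 2" "i \<noteq> n - 2" "i \<noteq> n" "i < n - 1"
      using n by linarith+
    moreover have "a (Suc i) = 2"
      using n 2 by (intro a(5)) linarith+
    ultimately show ?thesis
      unfolding edges using 2 a(2) by simp
  next
    case 4
    then have "i \<noteq> 0" "i \<noteq> 2" "i \<noteq> n - 2" "\<not> i < n - 1" "\<not> i \<le> n - 1"
      using n by linarith+
    moreover have "a (n - 2) = 2"
      using n by (intro a(5)) linarith+
    ultimately show ?thesis
      unfolding edges using 4 a(4) by simp
  qed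
  then show ?thesis
    by (simp add: a_def[abs_def])
next
  case (Aeven2 n)
  then show ?thesis
    using assms by (auto simp: kac_label_def weighted_row_chain)
next
  case (Aodd2 n)
  then show ?thesis
    using assms by (auto simp: kac_label_def weighted_row_chain)
next
  case (D2 n)
  then show ?thesis
    using assms by (auto simp: kac_label_def weighted_row_chain)
qed (use assms in \<open>auto simp: kac_label_def excluded_type_def exceptional_edges le_numeral_cases\<close>)

lemma edge_entry_diag:
  "(\<And>k l p q. (k, l, p, q) \<in> set es \<Longrightarrow> k \<noteq> l) \<Longrightarrow> edge_entry es i i = 0"
proof (induction es)
  case (Cons e es)
  obtain k l p q where e: "e = (k, l, p, q)"
    by (cases e)
  have "k \<noteq> l"
    using Cons.prems[of k l p q] by (simp add: e)
  moreover have "edge_entry es i i = 0"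
    by (rule Cons.IH) (use Cons.prems in auto)
  ultimately show ?case
    by (auto simp: e)
qed simp


section \<open>The affine Cartan matrices\<close>

locale kac_affine =
  fixes X :: kac_type and n :: nat and A :: cmatrix and w :: "nat list"
  assumes affine: "irreducible_affine_cartan_matrix n A"
    and labelled: "labelled_as_in_kac X n A"
    and not_excluded: "\<not> excluded_type X"
    and theta_word: "theta_word n A w"
begin

sublocale cartan n A
  using affine by unfold_locales (simp add: irreducible_affine_cartan_matrix_def)

text \<open>The inverse of d_j, computed from the tables until these are known to be the labels of
  \<open>A\<close>.\<close>

definition e :: "nat \<Rightarrow> real" where
  "e j = real (kac_dual_label X j) / real (kac_label X j)"

lemma admissible: "kac_admissible X"
  and rank: "n = kac_rank X"
  and A_eq: "i \<le> n \<Longrightarrow> j \<le> n \<Longrightarrow> A i j = kac_matrix X i j"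
  using labelled by (auto simp: labelled_as_in_kac_def)

lemma label_pos: "j \<le> n \<Longrightarrow> kac_label X j > 0" "j \<le> n \<Longrightarrow> kac_dual_label X j > 0"
  using kac_label_pos[OF not_excluded] rank by auto

lemma e_pos: "j \<le> n \<Longrightarrow> e j > 0"
  using label_pos by (simp add: e_def)

lemma sym:
  assumes "i \<le> n" "j \<le> n"
  shows "e i * of_int (A i j) = e j * of_int (A j i)"
proof (cases "i = j")
  case False
  have "int (kac_dual_label X i) * int (kac_label X j) * edge_entry (kac_edges X) i j =
      int (kac_dual_label X j) * int (kac_label X i) * edge_entry (kac_edges X) j i"
    by (rule edge_entry_sym[OF kac_edge_label_sym[OF admissible not_excluded] False])
  then have "int (kac_dual_label X i) * int (kac_label X j) * A i j =
      int (kac_dual_label X j) * int (kac_label X i) * A j i"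
    using False by (simp add: A_eq assms kac_matrix_eq)
  then have "real_of_int (int (kac_dual_label X i) * int (kac_label X j) * A i j) =
      real_of_int (int (kac_dual_label X j) * int (kac_label X i) * A j i)"
    by (rule arg_cong)
  then show ?thesis
    using label_pos(1)[OF assms(1)] label_pos(1)[OF assms(2)] by (simp add: e_def field_simps)
qed simp

lemma Gcd_one: "l \<le> n \<Longrightarrow> a l = (1 :: nat) \<Longrightarrow> Gcd (a ` {..n}) = 1"
  by (metis Gcd_dvd atMost_iff image_eqI nat_dvd_1_iff_1)

lemma label_one: "\<exists>l\<le>n. kac_label X l = 1" "kac_dual_label X 0 = 1"
  using kac_label_one[OF admissible not_excluded] rank by (auto split: if_splits)

lemma numerical_labels: "is_numerical_labels n A (kac_label X)"
proof -
  have "(\<Sum>j\<le>n. A i j * int (kac_label X j)) = 0" if i: "i \<le> n" for i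
  proof -
    have entry: "A i j = (if i = j then 2 else 0) - edge_entry (kac_edges X) i j" if "j \<le> n" for j
      using edge_entry_diag[of "kac_edges X" i] kac_edges_le[OF admissible] i that
      by (auto simp: A_eq kac_matrix_eq)
    have "(\<Sum>j\<le>n. A i j * int (kac_label X j)) =
        (\<Sum>j\<le>n. (if i = j then 2 * int (kac_label X i) else 0) -
          edge_entry (kac_edges X) i j * int (kac_label X j))"
      by (intro sum.cong) (auto simp: entry left_diff_distrib)
    also have "\<dots> = 2 * int (kac_label X i) - weighted_row (kac_edges X) (\<lambda>j. int (kac_label X j)) i"
    proof -
      have "(\<Sum>j\<le>n. edge_entry (kac_edges X) i j * int (kac_label X j)) =
          weighted_row (kac_edges X) (\<lambda>j. int (kac_label X j)) i"
        by (rule edge_entry_row) (use kac_edges_le[OF admissible] rank in auto)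
      then show ?thesis
        using i by (simp add: sum_subtractf)
    qed
    finally show ?thesis
      using kac_weighted_row[OF admissible not_excluded] i rank by simp
  qed
  moreover have "Gcd (kac_label X ` {..n}) = 1"
    using label_one(1) Gcd_one by blast
  ultimately show ?thesis
    using label_pos(1) rank by (auto simp: is_numerical_labels_def kac_label_def)
qed

text \<open>By symmetry, column i of \<open>A\<close> weighted with the dual labels is e_i times row
  i weighted with the labels.\<close>

lemma numerical_dual_labels: "is_numerical_labels n (\<lambda>i j. A j i) (kac_dual_label X)"
proof -
  have "(\<Sum>j\<le>n. A j i * int (kac_dual_label X j)) = 0" if i: "i \<le> n" for i
  proof -
    have "real_of_int (\<Sum>j\<le>n. A j i * int (kac_dual_label X j)) =
        (\<Sum>j\<le>n. e i * (of_int (A i j) * real (kac_label X j)))"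
      unfolding of_int_sum
    proof (intro sum.cong HOL.refl)
      fix j assume "j \<in> {..n}"
      then have "real (kac_dual_label X j) = e j * real (kac_label X j)"
        using label_pos(1)[of j] by (simp add: e_def)
      then show "real_of_int (A j i * int (kac_dual_label X j)) =
          e i * (of_int (A i j) * real (kac_label X j))"
        using sym[OF i, of j] \<open>j \<in> {..n}\<close> by (simp add: mult.assoc[symmetric])
    qed
    also have "\<dots> = e i * of_int (\<Sum>j\<le>n. A i j * int (kac_label X j))"
      by (simp add: sum_distrib_left)
    also have "\<dots> = 0"
      using numerical_labels i by (simp add: is_numerical_labels_def)
    finally show ?thesis
      by (simp only: of_int_eq_0_iff)
  qed
  moreover have "Gcd (kac_dual_label X ` {..n}) = 1"
    using label_one(2) Gcd_one by blast
  ultimately show ?thesis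
    using label_pos(2) rank by (auto simp: is_numerical_labels_def kac_dual_label_def)
qed

text \<open>The affine condition provides the one-dimensional null space of \<open>A\<close>.
  Dividing by e carries null vectors of the transpose to null vectors of \<open>A\<close>, so the
  transpose has the same property.\<close>

lemma labels_eq: "labels n A = kac_label X"
  and dual_labels_eq: "dual_labels n A = kac_dual_label X"
proof -
  obtain u where u: "\<And>j. j \<le> n \<Longrightarrow> u j > 0"
      "\<And>v. (\<And>i. i \<le> n \<Longrightarrow> matrix_apply n A v i = 0) \<Longrightarrow> \<exists>c. \<forall>j\<le>n. v j = c * u j"
    using affine unfolding irreducible_affine_cartan_matrix_def affine_matrix_def by metis
  obtain l where "l \<le> n" "kac_label X l = 1"
    using label_one(1) by blast
  then show "labels n A = kac_label X"
    using labels_eqI[OF u numerical_labels] by simp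
  have "\<exists>c. \<forall>j\<le>n. v j = c * (e j * u j)"
    if v: "\<And>i. i \<le> n \<Longrightarrow> matrix_apply n (\<lambda>i j. A j i) v i = 0" for v
  proof -
    have "matrix_apply n A (\<lambda>j. v j / e j) i = 0" if i: "i \<le> n" for i
    proof -
      have "e i * matrix_apply n A (\<lambda>j. v j / e j) i = (\<Sum>j\<le>n. of_int (A j i) * v j)"
        unfolding matrix_apply_def sum_distrib_left
      proof (intro sum.cong HOL.refl)
        fix j assume "j \<in> {..n}"
        then show "e i * (of_int (A i j) * (v j / e j)) = of_int (A j i) * v j"
          using sym[OF i, of j] e_pos[of j] by (simp add: mult.assoc[symmetric])
      qed
      then show ?thesis
        using v[OF i] e_pos[OF i] by (simp add: matrix_apply_def)
    qed
    then obtain s where "\<And>j. j \<le> n \<Longrightarrow> v j / e j = s * u j"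
      using u(2) by blast
    then have "\<forall>j\<le>n. v j = s * (e j * u j)"
      using e_pos by (fastforce simp: field_simps)
    then show ?thesis ..
  qed
  then show "dual_labels n A = kac_dual_label X"
    unfolding dual_labels_def
    by (intro labels_eqI[of n "\<lambda>j. e j * u j" _ _ 0] numerical_dual_labels label_one(2))
      (use u(1) e_pos in auto)
qed

lemma dcoeff_eq: "dcoeff n A j = inverse (e j)"
  by (simp add: dcoeff_def labels_eq dual_labels_eq e_def)

lemma inv_form_eq: "inv_form n A x y = (\<Sum>j\<le>n. e j * x j * matrix_apply n A y j)"
  unfolding inv_form_def matrix_apply_def dcoeff_eq sum_distrib_left
  by (intro sum.cong HOL.refl) (simp add: algebra_simps)

lemma inv_form_simple_root:
  assumes "j \<le> n"
  shows "inv_form n A x (\<lambda>k. s * simple_root j k) = s * e j * matrix_apply n A x j"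
proof -
  have "inv_form n A x (\<lambda>k. s * simple_root j k) = (\<Sum>k\<le>n. s * e j * (of_int (A j k) * x k))"
    unfolding inv_form_eq
  proof (intro sum.cong HOL.refl)
    fix k assume k: "k \<in> {..n}"
    have "e k * x k * matrix_apply n A (\<lambda>k. s * simple_root j k) k = s * x k * (e k * of_int (A k j))"
      by (simp add: matrix_apply_scale matrix_apply_simple_root[OF assms] algebra_simps)
    also have "e k * of_int (A k j) = e j * of_int (A j k)"
      using k assms by (intro sym) auto
    finally show "e k * x k * matrix_apply n A (\<lambda>k. s * simple_root j k) k = s * e j * (of_int (A j k) * x k)"
      by (simp add: algebra_simps)
  qed
  then show ?thesis
    by (simp add: matrix_apply_def sum_distrib_left)
qed

lemma simple_reflection_eq:
  assumes "j \<le> n"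
  shows "simple_reflection n A j = root_refl n A j"
proof
  fix x
  have "inv_form n A x (simple_coroot n A j) = matrix_apply n A x j"
    unfolding simple_coroot_def inv_form_simple_root[OF assms] dcoeff_eq
    using e_pos[OF assms] by simp
  then show "simple_reflection n A j x = root_refl n A j x"
    by (simp add: simple_reflection_def root_refl_eq)
qed

abbreviation "a0 \<equiv> real (kac_label X 0)"

definition \<eta> :: vect where
  "\<eta> k = (if k = 0 then 0 else real (kac_label X k) / a0)"

lemma delta_eq: "delta n A k = real (kac_label X k)"
proof -
  have "delta n A k = (\<Sum>j\<le>n. if j = k then real (kac_label X k) else 0)"
    unfolding delta_def labels_eq simple_root_def by (intro sum.cong) auto
  also have "\<dots> = real (kac_label X k)"
    using rank by (simp add: kac_label_def)
  finally show ?thesis .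
qed

lemma scaled_delta_eq: "scaled_delta n A = (\<lambda>k. \<eta> k + simple_root 0 k)"
  using label_pos(1)[of 0]
  by (auto simp: scaled_delta_def labels_eq delta_eq \<eta>_def simple_root_def field_simps)

lemma null: "i \<le> n \<Longrightarrow> matrix_apply n A (scaled_delta n A) i = 0"
  using numerical_labels_null[OF numerical_labels, of i]
  by (simp add: scaled_delta_def labels_eq delta_eq matrix_apply_scale)

text \<open>Since \<theta> = \<delta> - a_0 \<alpha>_0 with \<delta> in the radical, (x, \<theta>)
  is -a_0 e_0 times the pairing of x with the coroot of node 0, and (\<theta>, \<theta>) = 2 a_0^2
  e_0.\<close>

lemma s_theta_eq: "s_theta n A x = (\<lambda>k. x k + matrix_apply n A x 0 * \<eta> k)"
proof -
  have a0: "a0 > 0" and e0: "e 0 > 0"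
    using label_pos(1)[of 0] e_pos[of 0] by auto
  have theta: "theta n A = (\<lambda>k. a0 * \<eta> k)"
    using a0 by (auto simp: theta_def delta_eq labels_eq \<eta>_def simple_root_def)
  have eta: "\<eta> = (\<lambda>k. 1 * scaled_delta n A k + (-1) * simple_root 0 k)"
    by (auto simp: scaled_delta_eq)
  have form: "inv_form n A y (theta n A) = - a0 * e 0 * matrix_apply n A y 0" for y
  proof -
    have "inv_form n A y (theta n A) = inv_form n A y (\<lambda>k. (- a0) * simple_root 0 k)"
      unfolding inv_form_eq theta
    proof (intro sum.cong HOL.refl)
      fix k assume "k \<in> {..n}"
      then have "matrix_apply n A \<eta> k = - matrix_apply n A (simple_root 0) k"
        unfolding eta matrix_apply_comb using null[of k] by simp
      then show "e k * y k * matrix_apply n A (\<lambda>k. a0 * \<eta> k) k =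
          e k * y k * matrix_apply n A (\<lambda>k. (- a0) * simple_root 0 k) k"
        unfolding matrix_apply_scale by simp
    qed
    then show ?thesis
      unfolding inv_form_simple_root[OF le0] by simp
  qed
  have "matrix_apply n A (theta n A) 0 = - 2 * a0"
    unfolding theta matrix_apply_scale unfolding eta matrix_apply_comb
    using null[of 0] matrix_apply_simple_root[of 0 n A 0] diag[of 0] by simp
  then show ?thesis
    unfolding s_theta_def form using a0 e0 by (auto simp: theta field_simps)
qed


lemma eta_Aeven2: "X = Aeven2 n \<Longrightarrow> 1 \<le> k \<Longrightarrow> k < n \<Longrightarrow> \<eta> k = 1" "X = Aeven2 n \<Longrightarrow> 1 \<le> n \<Longrightarrow> \<eta> n = 1 / 2"
  unfolding \<eta>_def by (auto simp: kac_label_def)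

lemma eta_lattice: "\<eta> \<in> finite_lattice X n"
proof -
  have n: "n \<ge> 1"
    using admissible rank by (cases X) auto
  have "kac_label X 0 = 1 \<or> X = Aeven2 n"
    using admissible not_excluded rank by (cases X) (auto simp: kac_label_def excluded_type_def)
  then have int: "\<eta> k \<in> \<int>" if "\<not> (X = Aeven2 n \<and> k = n)" "k \<in> {1..n}" for k
  proof
    assume "X = Aeven2 n"
    then show ?thesis
      using eta_Aeven2(1)[of k] that by simp
  qed (simp add: \<eta>_def)
  moreover have "\<eta> k = 0" if "k \<notin> {1..n}" for k
    using that rank by (auto simp: \<eta>_def kac_label_def)
  moreover have "2 * \<eta> n \<in> \<int>" if "X = Aeven2 n"
    unfolding eta_Aeven2(2)[OF that n] by simp
  ultimately show ?thesis
    unfolding finite_lattice_def by auto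
qed

text \<open>Half-integral multiples of \<alpha>_n have integral pairings because column n of the
  Cartan matrix is even.\<close>

lemma A_even:
  assumes "X = Aeven2 n" "i \<le> n"
  shows "even (A i n)"
  using assms admissible
  by (auto simp: A_eq kac_matrix_eq edge_entry_chain)

lemma lattice_int:
  assumes x: "x \<in> finite_lattice X n" and i: "i \<le> n"
  shows "matrix_apply n A x i \<in> \<int>"
  unfolding matrix_apply_def
proof (rule Ints_sum)
  fix k assume "k \<in> {..n}"
  then consider "k = 0" | "X = Aeven2 n" "k = n" "k \<noteq> 0" | "k \<in> {1..n}" "\<not> (X = Aeven2 n \<and> k = n)"
    by force
  then show "of_int (A i k) * x k \<in> \<int>"
  proof cases
    case 1
    then show ?thesis
      using x by (simp add: finite_lattice_def)
  next
    case 2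
    then have "even (A i n)"
      using A_even i by simp
    then obtain m where m: "A i n = 2 * m"
      by (elim evenE)
    have "2 * x n \<in> \<int>"
      using x 2 unfolding finite_lattice_def by force
    then have "of_int m * (2 * x n) \<in> \<int>"
      by (rule Ints_mult[OF Ints_of_int])
    then show ?thesis
      by (simp add: 2(2) m mult_ac)
  next
    case 3
    then have "x k \<in> \<int>"
      using x unfolding finite_lattice_def by auto
    then show ?thesis
      by (rule Ints_mult[OF Ints_of_int])
  qed
qed

section \<open>Generation of the lattice from \<eta>\<close>

context
  fixes M :: "vect set"
  assumes eta_M: "\<eta> \<in> M"
    and diff_M: "\<And>x y. x \<in> M \<Longrightarrow> y \<in> M \<Longrightarrow> (\<lambda>k. x k - y k) \<in> M"
    and adjacent_M: "\<And>i. i \<in> {1..n} \<Longrightarrow> laces A 0 i \<in> {1, 2} \<Longrightarrow> root_refl n A i \<eta> \<in> M"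
    and stable_M: "\<And>i x. i \<in> {1..n} \<Longrightarrow> laces A 0 i = 0 \<Longrightarrow> x \<in> M \<Longrightarrow> root_refl n A i x \<in> M"
begin

lemma zero_M: "(\<lambda>k. 0) \<in> M"
  using diff_M[OF eta_M eta_M] by simp

lemma add_M: "x \<in> M \<Longrightarrow> y \<in> M \<Longrightarrow> (\<lambda>k. x k + y k) \<in> M"
  using diff_M[of x "\<lambda>k. 0 - y k"] diff_M[OF zero_M, of y] by simp

lemma scale_M:
  assumes "x \<in> M" "c \<in> \<int>"
  shows "(\<lambda>k. c * x k) \<in> M"
proof -
  have "(\<lambda>k. of_int m * x k) \<in> M" for m :: int
  proof (induction m rule: int_induct[of _ 0])
    case (step1 m)
    then show ?case
      using add_M[OF step1(2) assms(1)] by (simp add: distrib_right)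
  next
    case (step2 m)
    then show ?case
      using diff_M[OF step2(2) assms(1)] by (simp add: left_diff_distrib)
  qed (simp add: zero_M)
  then show ?thesis
    using assms(2) by (auto elim: Ints_cases)
qed

lemma support_M:
  assumes "finite J" "\<And>j. j \<in> J \<Longrightarrow> simple_root j \<in> M" "\<And>j. j \<in> J \<Longrightarrow> x j \<in> \<int>" "\<And>j. j \<notin> J \<Longrightarrow> x j = 0"
  shows "x \<in> M"
proof -
  have "(\<lambda>k. \<Sum>j\<in>J. x j * simple_root j k) \<in> M"
    using assms(1-3) by (induction J) (auto intro!: add_M scale_M simp: zero_M)
  moreover have "(\<Sum>j\<in>J. x j * simple_root j k) = x k" for k
  proof -
    have "(\<Sum>j\<in>J. x j * simple_root j k) = (\<Sum>j\<in>J. if j = k then x k else 0)"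
      by (intro sum.cong) (auto simp: simple_root_def)
    then show ?thesis
      using assms(1,4) by simp
  qed
  ultimately show ?thesis
    by simp
qed

text \<open>The difference of \<eta> and s_i \<eta> is -a_{i0} \<alpha>_i. In the excluded type
  \<open>C1\<close> the entry is -2 and only 2 \<alpha>_1 would be obtained.\<close>

lemma adjacent_root_M:
  assumes "i \<in> {1..n}" "laces A 0 i \<in> {1, 2}" "A i 0 = -1"
  shows "simple_root i \<in> M"
proof -
  have "matrix_apply n A (\<lambda>k. 1 * scaled_delta n A k + (-1) * simple_root 0 k) i = 1"
    unfolding matrix_apply_comb using null[of i] matrix_apply_simple_root[of 0 n A i] assms by simp
  then have "matrix_apply n A \<eta> i = 1"
    by (simp add: scaled_delta_eq)
  then show ?thesis
    using diff_M[OF eta_M adjacent_M[OF assms(1,2)]] by (simp add: root_refl_eq)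
qed

text \<open>The difference of s_k \<alpha>_j and \<alpha>_j is -a_{kj} \<alpha>_k. An edge can
  therefore be crossed from j to k when a_{kj} = -1; in the excluded types \<open>B1\<close>,
  \<open>F4_1\<close> and \<open>G2_1\<close> the multiple edge has -2 or -3 in the outward
  direction.\<close>

lemma next_root_M:
  assumes "k \<in> {1..n}" "laces A 0 k = 0" "j \<le> n" "A k j = -1" "simple_root j \<in> M"
  shows "simple_root k \<in> M"
  using diff_M[OF stable_M[OF assms(1,2,5)] assms(5)] matrix_apply_simple_root[OF assms(3), of A k] assms(4)
  by (simp add: root_refl_eq)

lemma generation_roots:
  assumes "\<And>j. j \<in> {1..n} \<Longrightarrow> simple_root j \<in> M" "X \<noteq> Aeven2 n"
  shows "finite_lattice X n \<subseteq> M"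
proof
  fix x assume x: "x \<in> finite_lattice X n"
  show "x \<in> M"
    by (rule support_M[of "{1..n}"]) (use x assms in \<open>auto simp: finite_lattice_def\<close>)
qed

text \<open>
  In the types \<open>A\<^sub>2\<^sub>n\<^sup>(\<^sup>2\<^sup>)\<close> and \<open>D\<^sub>n\<^sub>+\<^sub>1\<^sup>(\<^sup>2\<^sup>)\<close> the last basis vector of the lattice is not reached along the
  Dynkin diagram; it comes from \<open>\<eta>\<close>.
\<close>

lemma generation_eta:
  assumes roots: "\<And>j. 1 \<le> j \<Longrightarrow> j < n \<Longrightarrow> simple_root j \<in> M" and n: "1 \<le> n"
    and eta_n: "\<eta> n = (if X = Aeven2 n then 1 / 2 else 1)"
  shows "finite_lattice X n \<subseteq> M"
proof
  fix x assume x: "x \<in> finite_lattice X n"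
  \<comment> \<open>The multiple of \<eta> that removes the last coordinate of x; the rest is an
    integral combination of the roots already found.\<close>
  define c where "c = x n / \<eta> n"
  have c: "c \<in> \<int>" "c * \<eta> n = x n"
  proof -
    have "(if X = Aeven2 n then 2 * x n else x n) \<in> \<int>"
      using x n unfolding finite_lattice_def by (auto dest!: bspec[of _ _ n])
    then show "c \<in> \<int>"
      unfolding c_def eta_n by (simp add: mult.commute split: if_splits)
    show "c * \<eta> n = x n"
      unfolding c_def eta_n by simp
  qed
  have int: "x j \<in> \<int>" "\<eta> j \<in> \<int>" if "j \<in> {1..<n}" for j
    using x eta_lattice that unfolding finite_lattice_def by auto
  have "(\<lambda>k. x k - c * \<eta> k) \<in> M"
  proof (rule support_M[of "{1..<n}"])
    show "x j - c * \<eta> j \<in> \<int>" if "j \<in> {1..<n}" for j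
      using int[OF that] c(1) by simp
    show "x j - c * \<eta> j = 0" if "j \<notin> {1..<n}" for j
    proof (cases "j = n")
      case False
      then have "j \<notin> {1..n}"
        using that by auto
      then show ?thesis
        using x eta_lattice unfolding finite_lattice_def by simp
    qed (simp add: c(2))
  qed (use roots in auto)
  from add_M[OF this scale_M[OF eta_M c(1)]] show "x \<in> M"
    by simp
qed

lemmas entry = A_eq kac_matrix_eq edge_entry_chain laces_def

lemma chain_M:
  assumes "simple_root s \<in> M" "1 \<le> s" "t \<le> n"
    and "\<And>k. s < k \<Longrightarrow> k \<le> t \<Longrightarrow> laces A 0 k = 0 \<and> A k (k - 1) = -1"
    and "s \<le> k" "k \<le> t"
  shows "simple_root k \<in> M"
  using assms(5,6)
proof (induction k rule: dec_induct)
  case (step k)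
  then show ?case
    using assms(2,3) assms(4)[of "Suc k"] by (intro next_root_M[of "Suc k" k]) auto
qed (use assms(1) in simp)

text \<open>In each type one starts at the neighbours of node 0 and moves outwards along edges that
  can be crossed; where the last basis vector cannot be reached so, \<open>generation_eta\<close>
  supplies it.\<close>

lemma generation: "finite_lattice X n \<subseteq> M"
proof (cases X)
  case (A1 m)
  have m: "m = n" and n: "n \<ge> 1"
    using admissible rank A1 by auto
  show ?thesis
  proof (cases "n = 1")
    case True
    \<comment> \<open>With four laces no neighbour is available, but \<eta> alone spans the lattice
      of rank one.\<close>
    then have "\<eta> n = 1"
      using A1 m unfolding \<eta>_def by (simp add: kac_label_def)
    then show ?thesis
      by (intro generation_eta) (use True A1 in auto)
  next
    case False
    have "simple_root 1 \<in> M"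
      by (rule adjacent_root_M) (use A1 m n False in \<open>auto simp: entry\<close>)
    then have "simple_root k \<in> M" if "1 \<le> k" "k \<le> n - 1" for k
      by (rule chain_M[of 1 "n - 1" k]) (use A1 m n False that in \<open>auto simp: entry\<close>)
    \<comment> \<open>In the cycle node n is itself a neighbour of node 0, so it is reached from
      \<eta> and not along the chain.\<close>
    moreover have "simple_root n \<in> M"
      by (rule adjacent_root_M) (use A1 m n False in \<open>auto simp: entry\<close>)
    ultimately have "simple_root k \<in> M" if "k \<in> {1..n}" for k
      using that by (cases "k = n") auto
    then show ?thesis
      using A1 by (intro generation_roots) auto
  qed
next
  case (D1 m)
  have m: "m = n" and n: "n \<ge> 4"
    using admissible rank D1 by auto
  have 2: "simple_root 2 \<in> M"
    by (rule adjacent_root_M) (use D1 m n in \<open>auto simp: entry\<close>)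
  have 1: "simple_root 1 \<in> M"
    by (rule next_root_M[of 1 2]) (use 2 D1 m n in \<open>auto simp: entry\<close>)
  have k: "simple_root k \<in> M" if "2 \<le> k" "k \<le> n - 1" for k
    by (rule chain_M[of 2 "n - 1" k]) (use 2 D1 m n that in \<open>auto simp: entry\<close>)
  have "simple_root n \<in> M"
    by (rule next_root_M[of n "n - 2"]) (use k[of "n - 2"] D1 m n in \<open>auto simp: entry\<close>)
  then have "simple_root k \<in> M" if "k \<in> {1..n}" for k
    using that 1 k[of k] by (cases "k = n"; cases "k = 1") auto
  then show ?thesis
    using D1 by (intro generation_roots) auto
next
  case E6_1
  have n: "n = 6"
    using rank E6_1 by simp
  have 6: "simple_root 6 \<in> M"
    by (rule adjacent_root_M) (use E6_1 n in \<open>auto simp: entry exceptional_edges\<close>)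
  have 3: "simple_root 3 \<in> M"
    by (rule next_root_M[of 3 6]) (use 6 E6_1 n in \<open>auto simp: entry exceptional_edges\<close>)
  have 2: "simple_root 2 \<in> M"
    by (rule next_root_M[of 2 3]) (use 3 E6_1 n in \<open>auto simp: entry exceptional_edges\<close>)
  have 1: "simple_root 1 \<in> M"
    by (rule next_root_M[of 1 2]) (use 2 E6_1 n in \<open>auto simp: entry exceptional_edges\<close>)
  have 4: "simple_root 4 \<in> M"
    by (rule next_root_M[of 4 3]) (use 3 E6_1 n in \<open>auto simp: entry exceptional_edges\<close>)
  have 5: "simple_root 5 \<in> M"
    by (rule next_root_M[of 5 4]) (use 4 E6_1 n in \<open>auto simp: entry exceptional_edges\<close>)
  show ?thesis
    using E6_1 n 1 2 3 4 5 6 by (intro generation_roots) (auto simp: le_numeral_cases)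
next
  case E7_1
  have n: "n = 7"
    using rank E7_1 by simp
  have 1: "simple_root 1 \<in> M"
    by (rule adjacent_root_M) (use E7_1 n in \<open>auto simp: entry exceptional_edges\<close>)
  have 2: "simple_root 2 \<in> M"
    by (rule next_root_M[of 2 1]) (use 1 E7_1 n in \<open>auto simp: entry exceptional_edges\<close>)
  have 3: "simple_root 3 \<in> M"
    by (rule next_root_M[of 3 2]) (use 2 E7_1 n in \<open>auto simp: entry exceptional_edges\<close>)
  have 4: "simple_root 4 \<in> M"
    by (rule next_root_M[of 4 3]) (use 3 E7_1 n in \<open>auto simp: entry exceptional_edges\<close>)
  have 5: "simple_root 5 \<in> M"
    by (rule next_root_M[of 5 4]) (use 4 E7_1 n in \<open>auto simp: entry exceptional_edges\<close>)
  have 6: "simple_root 6 \<in> M"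
    by (rule next_root_M[of 6 5]) (use 5 E7_1 n in \<open>auto simp: entry exceptional_edges\<close>)
  have 7: "simple_root 7 \<in> M"
    by (rule next_root_M[of 7 3]) (use 3 E7_1 n in \<open>auto simp: entry exceptional_edges\<close>)
  show ?thesis
    using E7_1 n 1 2 3 4 5 6 7 by (intro generation_roots) (auto simp: le_numeral_cases)
next
  case E8_1
  have n: "n = 8"
    using rank E8_1 by simp
  have 1: "simple_root 1 \<in> M"
    by (rule adjacent_root_M) (use E8_1 n in \<open>auto simp: entry exceptional_edges\<close>)
  have 2: "simple_root 2 \<in> M"
    by (rule next_root_M[of 2 1]) (use 1 E8_1 n in \<open>auto simp: entry exceptional_edges\<close>)
  have 3: "simple_root 3 \<in> M"
    by (rule next_root_M[of 3 2]) (use 2 E8_1 n in \<open>auto simp: entry exceptional_edges\<close>)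
  have 4: "simple_root 4 \<in> M"
    by (rule next_root_M[of 4 3]) (use 3 E8_1 n in \<open>auto simp: entry exceptional_edges\<close>)
  have 5: "simple_root 5 \<in> M"
    by (rule next_root_M[of 5 4]) (use 4 E8_1 n in \<open>auto simp: entry exceptional_edges\<close>)
  have 6: "simple_root 6 \<in> M"
    by (rule next_root_M[of 6 5]) (use 5 E8_1 n in \<open>auto simp: entry exceptional_edges\<close>)
  have 7: "simple_root 7 \<in> M"
    by (rule next_root_M[of 7 6]) (use 6 E8_1 n in \<open>auto simp: entry exceptional_edges\<close>)
  have 8: "simple_root 8 \<in> M"
    by (rule next_root_M[of 8 5]) (use 5 E8_1 n in \<open>auto simp: entry exceptional_edges\<close>)
  show ?thesis
    using E8_1 n 1 2 3 4 5 6 7 8 by (intro generation_roots) (auto simp: le_numeral_cases)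
next
  case (Aeven2 m)
  have m: "m = n" and n: "n \<ge> 1"
    using admissible rank Aeven2 by auto
  have "simple_root k \<in> M" if "1 \<le> k" "k < n" for k
  proof -
    have "simple_root 1 \<in> M"
      by (rule adjacent_root_M) (use Aeven2 m that in \<open>auto simp: entry\<close>)
    then show ?thesis
      by (rule chain_M[of 1 "n - 1" k]) (use Aeven2 m that in \<open>auto simp: entry\<close>)
  qed
  then show ?thesis
    using Aeven2 m n eta_Aeven2(2) by (intro generation_eta) auto
next
  case (Aodd2 m)
  have m: "m = n" and n: "n \<ge> 3"
    using admissible rank Aodd2 by auto
  have 2: "simple_root 2 \<in> M"
    by (rule adjacent_root_M) (use Aodd2 m n in \<open>auto simp: entry\<close>)
  have 1: "simple_root 1 \<in> M"
    by (rule next_root_M[of 1 2]) (use 2 Aodd2 m n in \<open>auto simp: entry\<close>)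
  have k: "simple_root k \<in> M" if "2 \<le> k" "k \<le> n" for k
    by (rule chain_M[of 2 n k]) (use 2 Aodd2 m n that in \<open>auto simp: entry\<close>)
  have "simple_root k \<in> M" if "k \<in> {1..n}" for k
    using that 1 k[of k] by (cases "k = 1") auto
  then show ?thesis
    using Aodd2 by (intro generation_roots) auto
next
  case (D2 m)
  have m: "m = n" and n: "n \<ge> 2"
    using admissible rank D2 by auto
  have "simple_root k \<in> M" if "1 \<le> k" "k < n" for k
  proof -
    have "simple_root 1 \<in> M"
      by (rule adjacent_root_M) (use D2 m n in \<open>auto simp: entry\<close>)
    then show ?thesis
      by (rule chain_M[of 1 "n - 1" k]) (use D2 m that in \<open>auto simp: entry\<close>)
  qed
  moreover have "\<eta> n = 1"
    using D2 m n unfolding \<eta>_def by (simp add: kac_label_def)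
  ultimately show ?thesis
    by (intro generation_eta) (use D2 n in auto)
next
  case E6_2
  have n: "n = 4"
    using rank E6_2 by simp
  have 1: "simple_root 1 \<in> M"
    by (rule adjacent_root_M) (use E6_2 n in \<open>auto simp: entry\<close>)
  have 2: "simple_root 2 \<in> M"
    by (rule next_root_M[of 2 1]) (use 1 E6_2 n in \<open>auto simp: entry\<close>)
  have 3: "simple_root 3 \<in> M"
    by (rule next_root_M[of 3 2]) (use 2 E6_2 n in \<open>auto simp: entry\<close>)
  have 4: "simple_root 4 \<in> M"
    by (rule next_root_M[of 4 3]) (use 3 E6_2 n in \<open>auto simp: entry\<close>)
  show ?thesis
    using E6_2 n 1 2 3 4 by (intro generation_roots) (auto simp: le_numeral_cases)
next
  case D4_3
  have n: "n = 2"
    using rank D4_3 by simp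
  have 1: "simple_root 1 \<in> M"
    by (rule adjacent_root_M) (use D4_3 n in \<open>auto simp: entry\<close>)
  have 2: "simple_root 2 \<in> M"
    by (rule next_root_M[of 2 1]) (use 1 D4_3 n in \<open>auto simp: entry\<close>)
  show ?thesis
    using D4_3 n 1 2 by (intro generation_roots) (auto simp: le_numeral_cases)
qed (use not_excluded in \<open>auto simp: excluded_type_def\<close>)

end

sublocale double_affine n A X \<eta> e w
proof
  show "e 0 \<noteq> 0"
    using e_pos[of 0] by simp
qed (use simple_reflection_eq s_theta_eq scaled_delta_eq null sym eta_lattice lattice_int
      generation theta_word in auto)

end

theorem theorem3p12:
  fixes X :: kac_type and n :: nat and A :: "nat \<Rightarrow> nat \<Rightarrow> int" and w :: "nat list"
  assumes "irreducible_affine_cartan_matrix n A"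
    and "labelled_as_in_kac X n A"
    and "\<not> excluded_type X"
    and "theta_word n A w"
  defines "S \<equiv> generators n"
    and "R \<equiv> double_affine_relations n A w"
    and "R' \<equiv> elliptic_relations n A w"
    and "W \<equiv> double_affine_weyl X n A"
    and "N \<equiv> central_subgroup X n A"
  shows "\<exists>\<phi> \<in> iso (presented_group S R) W.
           (\<forall>i\<in>{1..n}. \<phi> (word_class S R (pos_word [Node i])) = weyl_elt (simple_reflection n A i)) \<and>
           \<phi> (word_class S R (pos_word (central_word w))) = tau (scaled_delta n A) \<and>
           (\<exists>\<psi> \<in> iso (presented_group S R') (elliptic_weyl X n A).
              \<forall>x\<in>S. \<psi> (word_class S R' (pos_word [x])) =
                     N #>\<^bsub>W\<^esub> \<phi> (word_class S R (pos_word [x])))"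
proof -
  interpret kac_affine X n A w
    using assms(1-4) by unfold_locales
  show ?thesis
    unfolding S_def R_def R'_def W_def N_def by (rule presentations)
qed

end
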